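(* Let $\kappa$ be a regular uncountable cardinal, $\chi<\kappa$ an infinite regular cardinal such that $\kappa$ is $({<}\chi)$-closed, and $\varsigma<\kappa$ an ordinal. If $\mathrm P^\bullet(\kappa,\kappa,{}_\chi{\sqsubseteq},\kappa,\{E^\kappa_{\ge\chi}\},\kappa)$ holds, then there exists a normal, prolific, $\varsigma$-splitting, $\chi$-complete, uniformly homogeneous streamlined $\kappa$-Souslin tree.
   Context: $\kappa$ is $({<}\chi)$-closed if $\lambda^{<\chi}<\kappa$ for all $\lambda<\kappa$. $E^\kappa_{\ge\chi}:=\{\alpha<\kappa\mid\mathrm{cf}(\alpha)\ge\chi\}$. $H_\kappa$: sets of hereditary cardinality $<\kappa$. A streamlined tree is a set $T\subseteq{}^{<\kappa}H_\kappa$ closed under restrictions, ordered by $\subsetneq$; $T_\alpha:=T\cap{}^\alpha H_\kappa$. It is a streamlined $\kappa$-Souslin tree if $(T,\subsetneq)$ has height $\kappa$, levels of size $<\kappa$, and no branch or antichain of size $\kappa$. $T$ is normal if for $\alpha<\beta$ with $T_\beta\neq\emptyset$ every $s\in T_\alpha$ extends to some element of $T_\beta$; prolific if for all $\alpha<\kappa$, $t\in T_\alpha$, $\{t^\frown\langle i\rangle\mid i<\max\{\omega,\alpha\}\}\subseteq T_{\alpha+1}$; $\varsigma$-splitting if every node has at least $\varsigma$ immediate successors; $\chi$-complete if unions of $\subsetneq$-increasing sequences from $T$ of length $<\chi$ lie in $T$. For $x,y\in{}^{<\kappa}H_\kappa$ with $\mathrm{dom}(x)<\mathrm{dom}(y)$,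 $x*y$ is the function on $\mathrm{dom}(y)$ equal to $x$ on $\mathrm{dom}(x)$ and to $y$ elsewhere. $T$ is uniformly homogeneous if for all $y\in T$ and $x\in T$ with $\mathrm{dom}(x)<\mathrm{dom}(y)$, $x*y\in T$. Notation: $\mathrm{acc}(C):=\{\alpha\in C\mid\sup(C\cap\alpha)=\alpha>0\}$; $C(j)$ is the $j$-th element of $C$; $\mathrm{succ}_n(C):=\{C(j+1)\mid j<n,\ j+1<\mathrm{otp}(C)\}$; $\mathrm{acc}(\kappa)$: nonzero limit ordinals below $\kappa$. $\mathcal F(\kappa)$: functions $C$ whose domain $\partial C$ is a nonempty club subset of $\sup(\partial C)$ not containing its supremum, with values in $H_\kappa$; $\alpha_C:=\sup(\partial C)$. $C\,{}_\chi{\sqsubseteq}\,D$ iff ($C=D\restriction\alpha_C$ or $\mathrm{cf}(\alpha_C)<\chi$). For $B\subseteq\kappa$, $\Omega\subseteq H_\kappa$, $p\in H_{\kappa^+}$, $C\in\mathcal F(\kappa)$: $B(\Omega,p,C)$ is the set of $\beta\in B\cap\partial C$ for which some $\mathcal M\prec H_{\kappa^+}$ has $p\in\mathcal M$, $\mathcal M\cap\kappa=\beta$, $\mathcal M\cap\Omega=C(\beta)$. $\mathrm P^\bullet(\kappa,\mu,\mathcal R,\theta,\mathcal S,\nu)$ asserts the existence of $\langle\mathcal C_\alpha\mid\alpha<\kappa\rangle$ and a partition $\langle B_\iota\mid\iota<\kappa\rangle$ of $\kappa$ such that for every $\alpha\in\mathrm{acc}(\kappa)$: $\mathcal C_\alpha\subseteq\{C\in\mathcal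 F(\kappa)\mid\alpha_C=\alpha\}$, $0<|\mathcal C_\alpha|<\mu$, and for all $C\in\mathcal C_\alpha$, $\bar\alpha\in\mathrm{acc}(\partial C)$ there is $D\in\mathcal C_{\bar\alpha}$ with $D\,\mathcal R\,C$; and for every $\langle(\Omega_i,p_i,\iota_i)\mid i<\theta\rangle$ of elements of $\mathcal P(H_\kappa)\times H_{\kappa^+}\times\kappa$, every $S\in\mathcal S$ and every $n<\omega$, there are stationarily many $\alpha\in S$ with $|\mathcal C_\alpha|<\nu$ such that for all $C\in\mathcal C_\alpha$, $i<\min\{\alpha,\theta\}$: $\sup\{\gamma\in\partial C\mid\mathrm{succ}_n(\partial C\setminus\gamma)\subseteq B_{\iota_i}(\Omega_i,p_i,C)\}=\alpha$. *)

theory Defs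
  imports Main "HOL-Library.Disjoint_Sets"
begin

unbundle cardinal_syntax

section \<open>The set-theoretic universe\<close>

text \<open>
  The type \<open>'a hset\<close> consists of all sets of hereditary cardinality at most \<open>\<mu> = \<aleph>\<^sub>0 + |'a|\<close>,
  i.e. it is \<open>H\<^bsub>\<mu>\<^sup>+\<^esub>\<close>. It is built as the well-founded trees with branching \<open>nat + 'a\<close>
  modulo bisimilarity. Its membership structure \<open>elts\<close> is determined up to isomorphism by
  \<open>elts_inject\<close>, \<open>wf_mem\<close>, \<open>elts_bound\<close> and \<open>elts_surj\<close> below. For every cardinal
  \<open>\<kappa> \<le> \<mu>\<close> it contains \<open>\<kappa>\<close> itself and all of \<open>H\<^bsub>\<kappa>\<^sup>+\<^esub>\<close>. HOL sets of type \<open>'a hset set\<close> serve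
  as arbitrary subcollections (trees, subsets of \<open>H\<^sub>\<kappa>\<close>, elementary submodels, \<open>H\<^bsub>\<kappa>\<^sup>+\<^esub>\<close> itself).
\<close>

datatype 'a pset = Empty | Fam "nat + 'a \<Rightarrow> 'a pset"

primrec pelts :: "'a pset \<Rightarrow> 'a pset set" where
  "pelts Empty = {}"
| "pelts (Fam f) = range f"

primrec peq :: "'a pset \<Rightarrow> 'a pset \<Rightarrow> bool" where
  "peq Empty y \<longleftrightarrow> pelts y = {}"
| "peq (Fam f) y \<longleftrightarrow> (\<forall>i. \<exists>z\<in>pelts y. peq (f i) z) \<and> (\<forall>z\<in>pelts y. \<exists>i. peq (f i) z)"

lemma peq_iff:
  "peq x y \<longleftrightarrow> (\<forall>u\<in>pelts x. \<exists>z\<in>pelts y. peq u z) \<and> (\<forall>z\<in>pelts y. \<exists>u\<in>pelts x. peq u z)"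
  by (cases x) auto

lemma peq_refl: "peq x x"
proof (induction x)
  case (Fam f)
  then show ?case by auto
qed simp

lemma peq_sym: "peq x y \<Longrightarrow> peq y x"
proof (induction x arbitrary: y)
  case Empty
  then show ?case by (simp add: peq_iff[of y])
next
  case (Fam f)
  have "\<exists>u\<in>range f. peq z u" if z: "z \<in> pelts y" for z
  proof -
    obtain i where "peq (f i) z" using Fam.prems z by auto
    then have "peq z (f i)" by (rule Fam.IH[OF rangeI])
    then show ?thesis by blast
  qed
  moreover have "\<exists>z\<in>pelts y. peq z (f i)" for i
  proof -
    obtain z where z: "z \<in> pelts y" "peq (f i) z" using Fam.prems by auto
    have "peq z (f i)" by (rule Fam.IH[OF rangeI z(2)])
    with z show ?thesis by blast
  qed
  ultimately show ?case
    unfolding peq_iff[of y] by (simp only: pelts.simps) blast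
qed

lemma peq_trans: "peq x y \<Longrightarrow> peq y z \<Longrightarrow> peq x z"
proof (induction x arbitrary: y z)
  case Empty
  then show ?case by (simp add: peq_iff[of y])
next
  case (Fam f)
  have yz: "\<forall>v\<in>pelts y. \<exists>w\<in>pelts z. peq v w" "\<forall>w\<in>pelts z. \<exists>v\<in>pelts y. peq v w"
    using Fam.prems(2) unfolding peq_iff[of y] by auto
  have "\<exists>w\<in>pelts z. peq (f i) w" for i
  proof -
    obtain v where v: "v \<in> pelts y" "peq (f i) v" using Fam.prems(1) by auto
    obtain w where w: "w \<in> pelts z" "peq v w" using yz v by blast
    have "peq (f i) w" by (rule Fam.IH[OF rangeI v(2) w(2)])
    with w show ?thesis by blast
  qed
  moreover have "\<exists>i. peq (f i) w" if w: "w \<in> pelts z" for w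
  proof -
    obtain v where v: "v \<in> pelts y" "peq v w" using yz w by blast
    obtain i where i: "peq (f i) v" using Fam.prems(1) v by auto
    have "peq (f i) w" by (rule Fam.IH[OF rangeI i v(2)])
    then show ?thesis by blast
  qed
  ultimately show ?case by simp
qed

quotient_type 'a hset = "'a pset" / peq
  by (intro equivpI reflpI sympI transpI) (blast intro: peq_refl peq_sym peq_trans)+

definition elts :: "'a hset \<Rightarrow> 'a hset set" where
  "elts x = abs_hset ` pelts (rep_hset x)"

lemma abs_hset_eq_iff: "abs_hset x = abs_hset y \<longleftrightarrow> peq x y"
  by (rule hset.abs_eq_iff)

lemma abs_rep_hset: "abs_hset (rep_hset x) = x"
  by (rule Quotient3_abs_rep[OF Quotient3_hset])

lemma image_abs_hset_eq_iff: "abs_hset ` pelts x = abs_hset ` pelts y \<longleftrightarrow> peq x y"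
proof -
  have "abs_hset ` pelts x \<subseteq> abs_hset ` pelts y \<longleftrightarrow> (\<forall>u\<in>pelts x. \<exists>z\<in>pelts y. peq u z)"
    by (simp add: image_subset_iff image_iff abs_hset_eq_iff)
  moreover have "abs_hset ` pelts y \<subseteq> abs_hset ` pelts x \<longleftrightarrow> (\<forall>z\<in>pelts y. \<exists>u\<in>pelts x. peq u z)"
    by (simp add: image_subset_iff image_iff abs_hset_eq_iff[symmetric])
      (metis (no_types))
  ultimately show ?thesis
    unfolding set_eq_subset peq_iff[of x y] by simp
qed

lemma elts_abs: "elts (abs_hset x) = abs_hset ` pelts x"
proof -
  have "peq (rep_hset (abs_hset x)) x"
    using abs_hset_eq_iff abs_rep_hset by blast
  then show ?thesis
    unfolding elts_def by (simp add: image_abs_hset_eq_iff)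
qed

lemma elts_inject: "elts x = elts y \<longleftrightarrow> x = y"
proof -
  have "elts x = elts y \<longleftrightarrow> abs_hset (rep_hset x) = abs_hset (rep_hset y)"
    unfolding elts_def image_abs_hset_eq_iff abs_hset_eq_iff ..
  then show ?thesis by (simp only: abs_rep_hset)
qed

lemma elts_bound: "|elts (x :: 'a hset)| \<le>o |UNIV :: (nat + 'a) set|"
proof (cases "rep_hset x")
  case Empty
  then show ?thesis by (simp add: elts_def card_of_empty)
next
  case (Fam f)
  then have "elts x = (abs_hset \<circ> f) ` UNIV"
    by (auto simp: elts_def)
  then show ?thesis by (metis card_of_image)
qed

lemma elts_surj:
  fixes A :: "'a hset set"
  assumes "|A| \<le>o |UNIV :: (nat + 'a) set|"
  shows "\<exists>x. elts x = A"
proof (cases "A = {}")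
  case True
  then have "elts (abs_hset Empty) = A"
    by (simp add: elts_abs)
  then show ?thesis by blast
next
  case False
  from card_of_ordLeq2[OF this, of "UNIV :: (nat + 'a) set"] assms
  obtain g :: "nat + 'a \<Rightarrow> 'a hset" where g: "range g = A"
    by (elim iffD2[THEN exE]) auto
  have "elts (abs_hset (Fam (rep_hset \<circ> g))) = range g"
    by (simp add: elts_abs abs_rep_hset image_image)
  then have "elts (abs_hset (Fam (rep_hset \<circ> g))) = A"
    by (simp only: g)
  then show ?thesis by blast
qed

definition mem_rel :: "('a hset \<times> 'a hset) set" where
  "mem_rel = {(x, y). x \<in> elts y}"

lemma wf_mem: "wf (mem_rel :: ('a hset \<times> 'a hset) set)"
proof (rule wfUNIVI)
  fix P :: "'a hset \<Rightarrow> bool" and x :: "'a hset"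
  assume step: "\<forall>x. (\<forall>y. (y, x) \<in> mem_rel \<longrightarrow> P y) \<longrightarrow> P x"
  have "P (abs_hset u)" for u
  proof (induction u)
    case Empty
    show ?case using step by (simp add: mem_rel_def elts_abs)
  next
    case (Fam f)
    have "\<forall>y. (y, abs_hset (Fam f)) \<in> mem_rel \<longrightarrow> P y"
      using Fam.IH by (auto simp: mem_rel_def elts_abs)
    then show ?case using step by blast
  qed
  then have "P (abs_hset (rep_hset x))" .
  then show "P x" by (simp only: abs_rep_hset)
qed

text \<open>\<open>mk A\<close> is the element whose members are those of \<open>A\<close>; meaningful for \<open>|A| \<le> \<mu>\<close>.\<close>

definition mk :: "'a hset set \<Rightarrow> 'a hset" where
  "mk A = (THE x. elts x = A)"

lemma elts_mk:
  assumes "|A :: 'a hset set| \<le>o |UNIV :: (nat + 'a) set|"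
  shows "elts (mk A) = A"
proof -
  obtain x where x: "elts x = A" using elts_surj[OF assms] by (rule exE)
  then have "(THE y. elts y = A) = x"
    by (intro the_equality) (simp_all add: elts_inject[symmetric])
  with x show ?thesis by (simp only: mk_def)
qed

section \<open>Ordinals and cardinals\<close>

definition Ord :: "'a hset \<Rightarrow> bool" where
  "Ord \<alpha> \<longleftrightarrow> (\<forall>x\<in>elts \<alpha>. elts x \<subseteq> elts \<alpha>) \<and> (\<forall>x\<in>elts \<alpha>. \<forall>y\<in>elts x. elts y \<subseteq> elts x)"

text \<open>For ordinals, \<open>\<alpha> < \<beta>\<close> is \<open>\<alpha> \<in> elts \<beta>\<close> and \<open>\<alpha> \<le> \<beta>\<close> is \<open>elts \<alpha> \<subseteq> elts \<beta>\<close>.\<close>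

definition zero :: "'a hset" where "zero = mk {}"

definition succ :: "'a hset \<Rightarrow> 'a hset" where "succ x = mk (insert x (elts x))"

primrec ord_of_nat :: "nat \<Rightarrow> 'a hset" where
  "ord_of_nat 0 = zero"
| "ord_of_nat (Suc n) = succ (ord_of_nat n)"

definition omega :: "'a hset" where "omega = mk (range ord_of_nat)"

definition omax :: "'a hset \<Rightarrow> 'a hset \<Rightarrow> 'a hset" where
  "omax \<alpha> \<beta> = (if elts \<alpha> \<subseteq> elts \<beta> then \<beta> else \<alpha>)"

definition omin :: "'a hset \<Rightarrow> 'a hset \<Rightarrow> 'a hset" where
  "omin \<alpha> \<beta> = (if elts \<alpha> \<subseteq> elts \<beta> then \<alpha> else \<beta>)"

definition osup :: "'a hset set \<Rightarrow> 'a hset" where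
  "osup A = mk (\<Union>x\<in>A. elts x)"

definition otp :: "'a hset set \<Rightarrow> 'a hset" where
  "otp A = (THE \<alpha>. Ord \<alpha> \<and>
     (\<exists>f. bij_betw f (elts \<alpha>) A \<and> (\<forall>\<xi>\<in>elts \<alpha>. \<forall>\<eta>\<in>elts \<alpha>. \<xi> \<in> elts \<eta> \<longleftrightarrow> f \<xi> \<in> elts (f \<eta>))))"

definition Cardinal :: "'a hset \<Rightarrow> bool" where
  "Cardinal \<kappa> \<longleftrightarrow> Ord \<kappa> \<and> (\<forall>\<alpha>\<in>elts \<kappa>. |elts \<alpha>| <o |elts \<kappa>| )"

definition has_cofinal_map :: "'a hset \<Rightarrow> 'a hset \<Rightarrow> bool" where
  "has_cofinal_map \<beta> \<alpha> \<longleftrightarrow>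
     (\<exists>f. f ` elts \<beta> \<subseteq> elts \<alpha> \<and> (\<forall>\<xi>\<in>elts \<alpha>. \<exists>\<eta>\<in>elts \<beta>. elts \<xi> \<subseteq> elts (f \<eta>)))"

definition cf :: "'a hset \<Rightarrow> 'a hset" where
  "cf \<alpha> = (THE \<beta>. Ord \<beta> \<and> has_cofinal_map \<beta> \<alpha> \<and> (\<forall>\<gamma>\<in>elts \<beta>. \<not> has_cofinal_map \<gamma> \<alpha>))"

definition regular_cardinal :: "'a hset \<Rightarrow> bool" where
  "regular_cardinal \<kappa> \<longleftrightarrow> Cardinal \<kappa> \<and> elts omega \<subseteq> elts \<kappa> \<and> cf \<kappa> = \<kappa>"

text \<open>\<open>acc(C)\<close> for a set \<open>C\<close> of ordinals, so that \<open>acc(\<kappa>)\<close> is \<open>acc_pts (elts \<kappa>)\<close>; and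
  \<open>E\<^sup>\<kappa>\<^bsub>\<ge>\<chi>\<^esub>\<close>.\<close>

definition acc_pts :: "'a hset set \<Rightarrow> 'a hset set" where
  "acc_pts C = {\<alpha> \<in> C. osup (C \<inter> elts \<alpha>) = \<alpha> \<and> zero \<in> elts \<alpha>}"

definition cof_ge :: "'a hset \<Rightarrow> 'a hset \<Rightarrow> 'a hset set" where
  "cof_ge \<kappa> \<chi> = {\<alpha> \<in> elts \<kappa>. elts \<chi> \<subseteq> elts (cf \<alpha>)}"

definition club_in :: "'a hset \<Rightarrow> 'a hset set \<Rightarrow> bool" where
  "club_in \<delta> C \<longleftrightarrow> C \<subseteq> elts \<delta> \<and> osup C = \<delta> \<and>
     (\<forall>\<gamma>\<in>elts \<delta>. zero \<in> elts \<gamma> \<and> osup (C \<inter> elts \<gamma>) = \<gamma> \<longrightarrow> \<gamma> \<in> C)"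

definition stationary_in :: "'a hset \<Rightarrow> 'a hset set \<Rightarrow> bool" where
  "stationary_in \<kappa> S \<longleftrightarrow> S \<subseteq> elts \<kappa> \<and> (\<forall>C. club_in \<kappa> C \<longrightarrow> S \<inter> C \<noteq> {})"

text \<open>\<open>C(j)\<close>, the \<open>j\<close>-th element of a set of ordinals \<open>C\<close>, and \<open>succ\<^sub>n(C)\<close> for \<open>n < \<omega>\<close>.\<close>

definition nth_elt :: "'a hset set \<Rightarrow> 'a hset \<Rightarrow> 'a hset" where
  "nth_elt C j = (THE \<gamma>. \<gamma> \<in> C \<and> otp (C \<inter> elts \<gamma>) = j)"

definition succ_n :: "nat \<Rightarrow> 'a hset set \<Rightarrow> 'a hset set" where
  "succ_n n C = {nth_elt C (ord_of_nat (Suc j)) | j. j < n \<and> ord_of_nat (Suc j) \<in> elts (otp C)}"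

section \<open>Functions as sets of Kuratowski pairs\<close>

definition pair :: "'a hset \<Rightarrow> 'a hset \<Rightarrow> 'a hset" where
  "pair x y = mk {mk {x}, mk {x, y}}"

definition is_fun :: "'a hset \<Rightarrow> bool" where
  "is_fun f \<longleftrightarrow> (\<forall>z\<in>elts f. \<exists>x y. z = pair x y) \<and>
     (\<forall>x y y'. pair x y \<in> elts f \<and> pair x y' \<in> elts f \<longrightarrow> y = y')"

definition fdom :: "'a hset \<Rightarrow> 'a hset set" where
  "fdom f = {x. \<exists>y. pair x y \<in> elts f}"

definition fran :: "'a hset \<Rightarrow> 'a hset set" where
  "fran f = {y. \<exists>x. pair x y \<in> elts f}"

definition app :: "'a hset \<Rightarrow> 'a hset \<Rightarrow> 'a hset" where
  "app f x = (THE y. pair x y \<in> elts f)"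

definition restr :: "'a hset \<Rightarrow> 'a hset set \<Rightarrow> 'a hset" where
  "restr f A = mk {z \<in> elts f. \<exists>x\<in>A. \<exists>y. z = pair x y}"

text \<open>\<open>\<^sup>\<alpha>X\<close> and \<open>\<^sup><\<^sup>\<alpha>X\<close>.\<close>

definition seqs :: "'a hset \<Rightarrow> 'a hset set \<Rightarrow> 'a hset set" where
  "seqs \<alpha> X = {f. is_fun f \<and> fdom f = elts \<alpha> \<and> fran f \<subseteq> X}"

definition seqs_below :: "'a hset \<Rightarrow> 'a hset set \<Rightarrow> 'a hset set" where
  "seqs_below \<alpha> X = (\<Union>\<beta>\<in>elts \<alpha>. seqs \<beta> X)"

text \<open>\<open>\<mu>\<^sup><\<^sup>\<chi>\<close> is taken as the cardinality of the set of all sequences of length below \<open>\<chi>\<close> in \<open>\<mu>\<close>.\<close>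

definition lt_closed :: "'a hset \<Rightarrow> 'a hset \<Rightarrow> bool" where
  "lt_closed \<chi> \<kappa> \<longleftrightarrow> (\<forall>\<mu>\<in>elts \<kappa>. |seqs_below \<chi> (elts \<mu>)| <o |elts \<kappa>| )"

section \<open>Hereditary cardinality and elementary submodels\<close>

definition trcl_set :: "'a hset \<Rightarrow> 'a hset set" where
  "trcl_set x = {y. (y, x) \<in> mem_rel\<^sup>+}"

definition hered_lt :: "'b rel \<Rightarrow> 'a hset set" where
  "hered_lt r = {x. |trcl_set x| <o r}"

abbreviation H :: "'a hset \<Rightarrow> 'a hset set" where
  "H \<kappa> \<equiv> hered_lt |elts \<kappa>|"

abbreviation Hplus :: "'a hset \<Rightarrow> 'a hset set" where
  "Hplus \<kappa> \<equiv> hered_lt (cardSuc |elts \<kappa>| )"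

text \<open>First-order formulas of the language of set theory, with variables named by naturals.\<close>

datatype fm = Mem nat nat | Eq nat nat | Neg fm | Conj fm fm | Exists nat fm

primrec sat :: "'a hset set \<Rightarrow> (nat \<Rightarrow> 'a hset) \<Rightarrow> fm \<Rightarrow> bool" where
  "sat M e (Mem i j) \<longleftrightarrow> e i \<in> elts (e j)"
| "sat M e (Eq i j) \<longleftrightarrow> e i = e j"
| "sat M e (Neg \<phi>) \<longleftrightarrow> \<not> sat M e \<phi>"
| "sat M e (Conj \<phi> \<psi>) \<longleftrightarrow> sat M e \<phi> \<and> sat M e \<psi>"
| "sat M e (Exists i \<phi>) \<longleftrightarrow> (\<exists>x\<in>M. sat M (e(i := x)) \<phi>)"

definition elem_submodel :: "'a hset set \<Rightarrow> 'a hset set \<Rightarrow> bool" (infix \<open>\<prec>\<close> 50) where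
  "M \<prec> N \<longleftrightarrow> M \<noteq> {} \<and> M \<subseteq> N \<and> (\<forall>\<phi> e. range e \<subseteq> M \<longrightarrow> (sat M e \<phi> \<longleftrightarrow> sat N e \<phi>))"

section \<open>The proxy principle\<close>

text \<open>\<open>fdom C\<close> is \<open>\<partial>C\<close>.\<close>

definition alpha_of :: "'a hset \<Rightarrow> 'a hset" where
  "alpha_of C = osup (fdom C)"

definition club_funs :: "'a hset \<Rightarrow> 'a hset set" where
  "club_funs \<kappa> = {C. is_fun C \<and> fdom C \<noteq> {} \<and> fdom C \<subseteq> elts \<kappa> \<and> club_in (alpha_of C) (fdom C) \<and>
     alpha_of C \<notin> fdom C \<and> fran C \<subseteq> H \<kappa>}"

definition sq_chi :: "'a hset \<Rightarrow> 'a hset \<Rightarrow> 'a hset \<Rightarrow> bool" where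
  "sq_chi \<chi> C D \<longleftrightarrow> C = restr D (elts (alpha_of C)) \<or> cf (alpha_of C) \<in> elts \<chi>"

text \<open>\<open>B(\<Omega>,p,C)\<close>; \<open>app C \<beta>\<close> is the value \<open>C(\<beta>)\<close> of the function \<open>C\<close>.\<close>

definition guess_set ::
  "'a hset \<Rightarrow> 'a hset set \<Rightarrow> 'a hset set \<Rightarrow> 'a hset \<Rightarrow> 'a hset \<Rightarrow> 'a hset set" where
  "guess_set \<kappa> B \<Omega> p C = {\<beta> \<in> B \<inter> fdom C.
     \<exists>M. M \<prec> Hplus \<kappa> \<and> p \<in> M \<and> M \<inter> elts \<kappa> = elts \<beta> \<and> M \<inter> \<Omega> = elts (app C \<beta>)}"

text \<open>The cells \<open>B\<^sub>\<iota>\<close> of the partition are not required to be nonempty; if \<open>\<theta> > 0\<close> and \<open>\<S>\<close> is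
  nonempty, this follows from the guessing clause.\<close>

definition P_bullet ::
  "'a hset \<Rightarrow> 'a hset \<Rightarrow> ('a hset \<Rightarrow> 'a hset \<Rightarrow> bool) \<Rightarrow> 'a hset \<Rightarrow> 'a hset set set \<Rightarrow> 'a hset \<Rightarrow> bool"
  where
  "P_bullet \<kappa> \<mu> R \<theta> \<S> \<nu> \<longleftrightarrow>
     (\<exists>(\<C> :: 'a hset \<Rightarrow> 'a hset set) (B :: 'a hset \<Rightarrow> 'a hset set).
        disjoint_family_on B (elts \<kappa>) \<and> (\<Union>\<iota>\<in>elts \<kappa>. B \<iota>) = elts \<kappa> \<and>
        (\<forall>\<alpha>\<in>acc_pts (elts \<kappa>).
           \<C> \<alpha> \<subseteq> {C \<in> club_funs \<kappa>. alpha_of C = \<alpha>} \<and>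
           \<C> \<alpha> \<noteq> {} \<and> |\<C> \<alpha>| <o |elts \<mu>| \<and>
           (\<forall>C\<in>\<C> \<alpha>. \<forall>\<alpha>'\<in>acc_pts (fdom C). \<exists>D\<in>\<C> \<alpha>'. R D C)) \<and>
        (\<forall>(\<Omega> :: 'a hset \<Rightarrow> 'a hset set) (p :: 'a hset \<Rightarrow> 'a hset) (\<iota> :: 'a hset \<Rightarrow> 'a hset).
           (\<forall>i\<in>elts \<theta>. \<Omega> i \<subseteq> H \<kappa> \<and> p i \<in> Hplus \<kappa> \<and> \<iota> i \<in> elts \<kappa>) \<longrightarrow>
           (\<forall>S\<in>\<S>. \<forall>n :: nat.
              stationary_in \<kappa> {\<alpha> \<in> S. |\<C> \<alpha>| <o |elts \<nu>| \<and>
                (\<forall>C\<in>\<C> \<alpha>. \<forall>i\<in>elts (omin \<alpha> \<theta>).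
                   osup {\<gamma> \<in> fdom C.
                     succ_n n (fdom C - elts \<gamma>) \<subseteq> guess_set \<kappa> (B (\<iota> i)) (\<Omega> i) (p i) C} = \<alpha>)})))"

section \<open>Streamlined trees\<close>

text \<open>The tree order \<open>s \<subset> t\<close> on functions is \<open>elts s \<subset> elts t\<close>.\<close>

definition streamlined_tree :: "'a hset \<Rightarrow> 'a hset set \<Rightarrow> bool" where
  "streamlined_tree \<kappa> T \<longleftrightarrow> T \<subseteq> seqs_below \<kappa> (H \<kappa>) \<and>
     (\<forall>t\<in>T. \<forall>\<alpha>\<in>elts \<kappa>. restr t (elts \<alpha>) \<in> T)"

definition level :: "'a hset \<Rightarrow> 'a hset set \<Rightarrow> 'a hset \<Rightarrow> 'a hset set" where
  "level \<kappa> T \<alpha> = T \<inter> seqs \<alpha> (H \<kappa>)"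

text \<open>The height is the least ordinal with empty level. Since \<open>T\<close> is closed under restrictions,
  the \<open>\<alpha>\<close>-th level of the tree order is \<open>T\<^sub>\<alpha>\<close>.\<close>

definition tree_height :: "'a hset \<Rightarrow> 'a hset set \<Rightarrow> 'a hset" where
  "tree_height \<kappa> T = (THE \<alpha>. Ord \<alpha> \<and> level \<kappa> T \<alpha> = {} \<and> (\<forall>\<beta>\<in>elts \<alpha>. level \<kappa> T \<beta> \<noteq> {}))"

definition tree_chain :: "'a hset set \<Rightarrow> 'a hset set \<Rightarrow> bool" where
  "tree_chain T b \<longleftrightarrow> b \<subseteq> T \<and> (\<forall>s\<in>b. \<forall>t\<in>b. s = t \<or> elts s \<subset> elts t \<or> elts t \<subset> elts s)"

definition tree_branch :: "'a hset set \<Rightarrow> 'a hset set \<Rightarrow> bool" where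
  "tree_branch T b \<longleftrightarrow> tree_chain T b \<and> (\<forall>c. tree_chain T c \<and> b \<subseteq> c \<longrightarrow> c = b)"

definition tree_antichain :: "'a hset set \<Rightarrow> 'a hset set \<Rightarrow> bool" where
  "tree_antichain T A \<longleftrightarrow> A \<subseteq> T \<and> (\<forall>s\<in>A. \<forall>t\<in>A. \<not> elts s \<subset> elts t)"

definition souslin_tree :: "'a hset \<Rightarrow> 'a hset set \<Rightarrow> bool" where
  "souslin_tree \<kappa> T \<longleftrightarrow> streamlined_tree \<kappa> T \<and> tree_height \<kappa> T = \<kappa> \<and>
     (\<forall>\<alpha>\<in>elts \<kappa>. |level \<kappa> T \<alpha>| <o |elts \<kappa>| ) \<and>
     \<not> (\<exists>b. tree_branch T b \<and> |b| =o |elts \<kappa>| ) \<and>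
     \<not> (\<exists>A. tree_antichain T A \<and> |A| =o |elts \<kappa>| )"

definition normal_tree :: "'a hset \<Rightarrow> 'a hset set \<Rightarrow> bool" where
  "normal_tree \<kappa> T \<longleftrightarrow> (\<forall>\<beta>\<in>elts \<kappa>. \<forall>\<alpha>\<in>elts \<beta>. level \<kappa> T \<beta> \<noteq> {} \<longrightarrow>
     (\<forall>s\<in>level \<kappa> T \<alpha>. \<exists>t\<in>level \<kappa> T \<beta>. elts s \<subset> elts t))"

text \<open>\<open>append_val \<alpha> t i\<close> is \<open>t\<^sup>\<frown>\<langle>i\<rangle>\<close> for \<open>t\<close> of length \<open>\<alpha>\<close>.\<close>

definition append_val :: "'a hset \<Rightarrow> 'a hset \<Rightarrow> 'a hset \<Rightarrow> 'a hset" where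
  "append_val \<alpha> t i = mk (insert (pair \<alpha> i) (elts t))"

definition prolific_tree :: "'a hset \<Rightarrow> 'a hset set \<Rightarrow> bool" where
  "prolific_tree \<kappa> T \<longleftrightarrow> (\<forall>\<alpha>\<in>elts \<kappa>. \<forall>t\<in>level \<kappa> T \<alpha>.
     {append_val \<alpha> t i | i. i \<in> elts (omax omega \<alpha>)} \<subseteq> level \<kappa> T (succ \<alpha>))"

definition immediate_succs :: "'a hset set \<Rightarrow> 'a hset \<Rightarrow> 'a hset set" where
  "immediate_succs T t =
     {s \<in> T. elts t \<subset> elts s \<and> \<not> (\<exists>r\<in>T. elts t \<subset> elts r \<and> elts r \<subset> elts s)}"

definition splitting_tree :: "'a hset \<Rightarrow> 'a hset set \<Rightarrow> bool" where
  "splitting_tree \<sigma> T \<longleftrightarrow> (\<forall>t\<in>T. |elts \<sigma>| \<le>o |immediate_succs T t| )"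

definition complete_tree :: "'a hset \<Rightarrow> 'a hset set \<Rightarrow> bool" where
  "complete_tree \<chi> T \<longleftrightarrow> (\<forall>\<eta>\<in>elts \<chi>. \<forall>f :: 'a hset \<Rightarrow> 'a hset.
     (\<forall>\<xi>\<in>elts \<eta>. f \<xi> \<in> T) \<and> (\<forall>\<xi>\<in>elts \<eta>. \<forall>\<xi>'\<in>elts \<xi>. elts (f \<xi>') \<subset> elts (f \<xi>)) \<longrightarrow>
     mk (\<Union>\<xi>\<in>elts \<eta>. elts (f \<xi>)) \<in> T)"

definition graft :: "'a hset \<Rightarrow> 'a hset \<Rightarrow> 'a hset" where
  "graft x y = mk (elts x \<union> elts (restr y (fdom y - fdom x)))"

text \<open>For functions on ordinals, \<open>fdom x \<subset> fdom y\<close> says \<open>dom(x) < dom(y)\<close>.\<close>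

definition uniformly_homogeneous :: "'a hset set \<Rightarrow> bool" where
  "uniformly_homogeneous T \<longleftrightarrow> (\<forall>y\<in>T. \<forall>x\<in>T. fdom x \<subset> fdom y \<longrightarrow> graft x y \<in> T)"

end

theory Submission
  imports Defs
begin

text \<open>
  The levels \<open>T\<^sub>\<alpha>\<close> are built by recursion. Successor levels split as widely as required. At a
  limit of cofinality below \<open>\<chi>\<close> all branches are kept; \<open>({<}\<chi>)\<close>-closedness keeps the level
  small. At any other limit, every \<open>C \<in> \<C>\<^sub>\<alpha>\<close> determines one branch \<open>b\<^sup>C\<close> of \<open>T \<restriction> \<alpha>\<close>, and
  \<open>T\<^sub>\<alpha>\<close> consists of the nodes \<open>x * b\<^sup>C\<close> with \<open>x \<in> T \<restriction> \<alpha>\<close>, which makes \<open>T\<close> uniformly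
  homogeneous, hence normal. The branch \<open>b\<^sup>C\<close> is built along \<open>\<partial>C\<close>: in passing from \<open>\<gamma>\<close> to the
  next point \<open>\<beta> \<in> B\<^sub>\<iota>\<close>, it is continued in such a way that \<open>x\<^sub>\<iota> * b\<^sup>C\<close> meets the set of nodes
  whose indices lie in \<open>C(\<beta>)\<close>, if possible, where \<open>x\<^sub>\<iota>\<close> is the \<open>\<iota>\<close>-th node of an
  enumeration of \<open>T\<close>. Coherence puts \<open>b\<^sup>C \<restriction> \<alpha>'\<close> into \<open>T\<^bsub>\<alpha>'\<^esub>\<close> at the accumulation points \<open>\<alpha>'\<close>
  of \<open>\<partial>C\<close>.

  Given an antichain \<open>A\<close>, the nodes that lie in \<open>A\<close> or are incomparable with all of \<open>A\<close> are
  predense. Let \<open>\<Omega> \<subseteq> \<kappa>\<close> be the set of their indices and let \<open>p\<close> be a club of points closed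
  under the relevant Skolem functions. If \<open>p \<in> \<M> \<prec> H\<^bsub>\<kappa>\<^sup>+\<^esub>\<close> and \<open>\<M> \<inter> \<kappa> = \<beta>\<close>, then \<open>\<beta> \<in> p\<close>
  and \<open>\<M> \<inter> \<Omega> = \<Omega> \<inter> \<beta>\<close>. So at a level \<open>\<alpha>\<close> provided by the guessing clause every search
  succeeds, every node of \<open>T\<^sub>\<alpha>\<close> extends a node of lower level with index in \<open>\<Omega>\<close>, and therefore
  \<open>A \<subseteq> T \<restriction> \<alpha>\<close>.
\<close>

section \<open>Well-ordered types\<close>

lemma ex_least_upper_bound:
  fixes f :: "'i \<Rightarrow> 'o::wellorder"
  assumes "\<And>x. x \<in> X \<Longrightarrow> f x \<le> b"
  obtains \<delta> where "\<delta> \<le> b" "\<And>x. x \<in> X \<Longrightarrow> f x \<le> \<delta>" "\<And>\<xi>. \<xi> < \<delta> \<Longrightarrow> \<exists>x\<in>X. \<xi> < f x"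
proof
  let ?upper = "\<lambda>\<delta>. \<forall>x\<in>X. f x \<le> \<delta>"
  show "(LEAST \<delta>. ?upper \<delta>) \<le> b"
    by (rule Least_le) (use assms in blast)
  show "f x \<le> (LEAST \<delta>. ?upper \<delta>)" if "x \<in> X" for x
    using LeastI[of ?upper b] assms that by blast
  show "\<exists>x\<in>X. \<xi> < f x" if "\<xi> < (LEAST \<delta>. ?upper \<delta>)" for \<xi>
    using not_less_Least[OF that] by (auto simp: not_le)
qed

definition order_below :: "'o::wellorder \<Rightarrow> 'o rel" where
  "order_below \<alpha> = {(x, y). x \<le> y \<and> y < \<alpha>}"

lemma Field_order_below: "Field (order_below \<alpha>) = {..<\<alpha>}"
  unfolding order_below_def Field_def by force

lemma Well_order_order_below: "Well_order (order_below (\<alpha> :: 'o::wellorder))"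
proof -
  have "wf (order_below \<alpha> - Id)"
    by (rule wf_subset[OF wf]) (auto simp: order_below_def)
  then show ?thesis
    unfolding well_order_on_def linear_order_on_def partial_order_on_def preorder_on_def
      Field_order_below
    by (auto simp: order_below_def refl_on_def trans_def antisym_def total_on_def)
qed

lemma card_less_lessThanE:
  fixes \<alpha> :: "'o::wellorder"
  assumes "|X| <o |{..<\<alpha>}|"
  obtains \<delta> where "\<delta> < \<alpha>" "|X| =o |{..<\<delta>}|"
proof -
  have "|{..<\<alpha>}| \<le>o order_below \<alpha>"
    using card_of_least Well_order_order_below Field_order_below by metis
  with assms have "|X| <o order_below \<alpha>" by (rule ordLess_ordLeq_trans)
  then obtain \<delta> where \<delta>: "\<delta> < \<alpha>"
      and iso: "|X| =o Restr (order_below \<alpha>) (underS (order_below \<alpha>) \<delta>)"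
    using ordLess_iff_ordIso_Restr[OF Well_order_order_below card_of_Well_order]
    by (auto simp: Field_order_below)
  have "underS (order_below \<alpha>) \<delta> = {..<\<delta>}"
    using \<delta> unfolding order_below_def underS_def by auto
  then have "Field (Restr (order_below \<alpha>) (underS (order_below \<alpha>) \<delta>)) = {..<\<delta>}"
    using \<delta> by (force simp: order_below_def Field_def)
  then have "|X| =o |{..<\<delta>}|"
    using card_of_cong[OF iso] by (simp add: Field_card_of)
  with \<delta> show ?thesis by (rule that)
qed

definition is_succ :: "'o::linorder \<Rightarrow> 'o \<Rightarrow> bool" where
  "is_succ \<beta> \<alpha> \<longleftrightarrow> {..<\<alpha>} = {..\<beta>}"

lemma is_succ_iff: "is_succ \<beta> \<alpha> \<Longrightarrow> \<xi> < \<alpha> \<longleftrightarrow> \<xi> \<le> \<beta>"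
  unfolding is_succ_def by blast

lemma is_succ_less: "is_succ \<beta> \<alpha> \<Longrightarrow> \<beta> < \<alpha>"
  by (simp add: is_succ_iff)

lemma is_succ_lessThan: "is_succ \<beta> \<alpha> \<Longrightarrow> {..<\<alpha>} = insert \<beta> {..<\<beta>}"
  by (auto simp: is_succ_iff order.order_iff_strict)

lemma is_succ_unique: "is_succ \<beta> \<alpha> \<Longrightarrow> is_succ \<gamma> \<alpha> \<Longrightarrow> \<beta> = \<gamma>"
  unfolding is_succ_def by simp

lemma ex_is_succ:
  fixes \<beta> :: "'o::wellorder"
  assumes "\<beta> < \<delta>"
  shows "\<exists>\<alpha>\<le>\<delta>. is_succ \<beta> \<alpha>"
proof (intro exI conjI)
  show "(LEAST \<alpha>. \<beta> < \<alpha>) \<le> \<delta>" using assms by (rule Least_le)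
  have "\<beta> < (LEAST \<alpha>. \<beta> < \<alpha>)" using assms by (rule LeastI)
  then show "is_succ \<beta> (LEAST \<alpha>. \<beta> < \<alpha>)"
    unfolding is_succ_def by (auto dest: not_less_Least simp: not_less)
qed

definition unbounded_in :: "'o::linorder \<Rightarrow> 'o set \<Rightarrow> bool" where
  "unbounded_in \<alpha> E \<longleftrightarrow> (\<exists>\<xi>. \<xi> < \<alpha>) \<and> (\<forall>\<xi><\<alpha>. \<exists>\<eta>\<in>E. \<xi> < \<eta> \<and> \<eta> < \<alpha>)"

lemma unbounded_inD: "unbounded_in \<alpha> E \<Longrightarrow> \<xi> < \<alpha> \<Longrightarrow> \<exists>\<eta>\<in>E. \<xi> < \<eta> \<and> \<eta> < \<alpha>"
  unfolding unbounded_in_def by blast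

lemma unbounded_in_mono: "unbounded_in \<alpha> E \<Longrightarrow> E \<inter> {..<\<alpha>} \<subseteq> F \<Longrightarrow> unbounded_in \<alpha> F"
  unfolding unbounded_in_def by blast

abbreviation is_limit :: "'o::linorder \<Rightarrow> bool" where
  "is_limit \<alpha> \<equiv> unbounded_in \<alpha> {..<\<alpha>}"

lemma unbounded_in_imp_is_limit: "unbounded_in \<alpha> E \<Longrightarrow> is_limit \<alpha>"
  by (erule unbounded_in_mono) blast

lemma is_limit_not_is_succ: "is_limit \<alpha> \<Longrightarrow> \<not> is_succ \<beta> \<alpha>"
  unfolding unbounded_in_def using is_succ_iff[of \<beta> \<alpha>] by (auto simp: not_less)

lemma zero_succ_limit_cases:
  obtains (zero) "{..<\<alpha>} = {}" | (succ) \<beta> where "is_succ \<beta> \<alpha>" | (limit) "is_limit \<alpha>"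
proof (cases "{..<\<alpha>} = {} \<or> is_limit \<alpha>")
  case False
  then obtain \<beta> where "\<beta> < \<alpha>" "\<And>\<eta>. \<eta> < \<alpha> \<Longrightarrow> \<eta> \<le> \<beta>"
    unfolding unbounded_in_def by (metis emptyE equals0I lessThan_iff not_less)
  then have "is_succ \<beta> \<alpha>" unfolding is_succ_def by auto
  then show ?thesis by (rule succ)
qed (use zero limit in blast)

lemma not_is_succ_iff: "(\<nexists>\<beta>. is_succ \<beta> \<alpha>) \<longleftrightarrow> (\<forall>\<xi><\<alpha>. \<exists>\<eta><\<alpha>. \<xi> < \<eta>)"
proof (cases \<alpha> rule: zero_succ_limit_cases)
  case zero
  then have "\<not> is_succ \<beta> \<alpha>" for \<beta> using is_succ_less by blast
  with zero show ?thesis by blast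
next
  case (succ \<beta>)
  then have "\<not> (\<exists>\<eta><\<alpha>. \<beta> < \<eta>)" by (simp add: is_succ_iff not_less)
  with succ show ?thesis using is_succ_less by blast
next
  case limit
  then show ?thesis using is_limit_not_is_succ[OF limit] by (auto dest: unbounded_inD)
qed

definition closed_below :: "'o::linorder \<Rightarrow> 'o set \<Rightarrow> bool" where
  "closed_below \<alpha> E \<longleftrightarrow> (\<forall>\<delta><\<alpha>. unbounded_in \<delta> E \<longrightarrow> \<delta> \<in> E)"

definition club_below :: "'o::linorder \<Rightarrow> 'o set \<Rightarrow> bool" where
  "club_below \<alpha> E \<longleftrightarrow> E \<subseteq> {..<\<alpha>} \<and> unbounded_in \<alpha> E \<and> closed_below \<alpha> E"

lemma club_belowD:
  assumes "club_below \<alpha> E"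
  shows "E \<subseteq> {..<\<alpha>}" "unbounded_in \<alpha> E" "closed_below \<alpha> E"
  using assms unfolding club_below_def by auto

definition consecutive_in :: "'o::linorder set \<Rightarrow> 'o \<Rightarrow> 'o \<Rightarrow> bool" where
  "consecutive_in E \<gamma> \<beta> \<longleftrightarrow> \<gamma> \<in> E \<and> \<beta> \<in> E \<and> \<gamma> < \<beta> \<and> (\<forall>\<eta>\<in>E. \<eta> < \<beta> \<longrightarrow> \<eta> \<le> \<gamma>)"

lemma consecutive_inD:
  assumes "consecutive_in E \<gamma> \<beta>"
  shows "\<gamma> \<in> E" "\<beta> \<in> E" "\<gamma> < \<beta>" "\<And>\<eta>. \<lbrakk>\<eta> \<in> E; \<eta> < \<beta>\<rbrakk> \<Longrightarrow> \<eta> \<le> \<gamma>"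
  using assms unfolding consecutive_in_def by auto

lemma ex_consecutive_successor:
  fixes E :: "'o::wellorder set"
  assumes "\<gamma> \<in> E" "\<eta> \<in> E" "\<gamma> < \<eta>"
  shows "\<exists>\<beta>. consecutive_in E \<gamma> \<beta>"
proof
  let ?next = "\<lambda>\<beta>. \<beta> \<in> E \<and> \<gamma> < \<beta>"
  have "?next (LEAST \<beta>. ?next \<beta>)" by (rule LeastI) (use assms in blast)
  moreover have "\<zeta> \<le> \<gamma>" if "\<zeta> \<in> E" "\<zeta> < (LEAST \<beta>. ?next \<beta>)" for \<zeta>
    using not_less_Least[OF that(2)] that(1) by simp
  ultimately show "consecutive_in E \<gamma> (LEAST \<beta>. ?next \<beta>)"
    unfolding consecutive_in_def using assms(1) by blast
qed

lemma ex_consecutive_predecessor: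
  fixes E :: "'o::wellorder set"
  assumes closed: "closed_below \<beta> E" and "\<beta> \<in> E" and bounded: "\<not> unbounded_in \<beta> E"
    and nonempty: "E \<inter> {..<\<beta>} \<noteq> {}"
  shows "\<exists>\<gamma>. consecutive_in E \<gamma> \<beta>"
proof -
  obtain \<xi> where \<xi>: "\<xi> < \<beta>" "\<And>\<eta>. \<eta> \<in> E \<inter> {..<\<beta>} \<Longrightarrow> \<eta> \<le> \<xi>"
    using bounded nonempty unfolding unbounded_in_def
    by (metis IntE equals0I lessThan_iff not_less)
  obtain \<delta> where "\<delta> \<le> \<xi>" and upper: "\<And>\<eta>. \<eta> \<in> E \<inter> {..<\<beta>} \<Longrightarrow> \<eta> \<le> \<delta>"
      and least: "\<And>\<zeta>. \<zeta> < \<delta> \<Longrightarrow> \<exists>\<eta>\<in>E \<inter> {..<\<beta>}. \<zeta> < \<eta>"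
    using ex_least_upper_bound[of "E \<inter> {..<\<beta>}" "\<lambda>\<eta>. \<eta>" \<xi>] \<xi>(2) by blast
  have "\<delta> < \<beta>" using \<open>\<delta> \<le> \<xi>\<close> \<xi>(1) by simp
  have "\<delta> \<in> E"
  proof (rule ccontr)
    assume "\<delta> \<notin> E"
    then have "\<eta> < \<delta>" if "\<eta> \<in> E \<inter> {..<\<beta>}" for \<eta>
      using upper[OF that] that by (auto simp: order.order_iff_strict)
    then have "unbounded_in \<delta> E"
      unfolding unbounded_in_def using least nonempty by blast
    then show False
      using closed \<open>\<delta> < \<beta>\<close> \<open>\<delta> \<notin> E\<close> unfolding closed_below_def by blast
  qed
  then show ?thesis
    unfolding consecutive_in_def using \<open>\<beta> \<in> E\<close> \<open>\<delta> < \<beta>\<close> upper by auto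
qed

lemma consecutive_in_iff_singleton:
  assumes consec: "consecutive_in E \<gamma> \<beta>" and "b \<in> E" "\<gamma> \<le> b"
  shows "(\<exists>c. {\<eta> \<in> E. \<gamma> \<le> \<eta> \<and> \<eta> < b} = {c}) \<longleftrightarrow> b = \<beta>"
proof
  note \<gamma>\<beta> = consecutive_inD[OF consec]
  assume "\<exists>c. {\<eta> \<in> E. \<gamma> \<le> \<eta> \<and> \<eta> < b} = {c}"
  then obtain c where singleton: "{\<eta> \<in> E. \<gamma> \<le> \<eta> \<and> \<eta> < b} = {c}" by blast
  then have "\<gamma> \<le> c" "c < b" by blast+
  then have "\<gamma> < b" by simp
  then have "\<not> b < \<beta>" using \<gamma>\<beta>(4)[OF \<open>b \<in> E\<close>] by auto
  moreover have "\<not> \<beta> < b"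
  proof
    assume "\<beta> < b"
    then have "\<gamma> \<in> {\<eta> \<in> E. \<gamma> \<le> \<eta> \<and> \<eta> < b}" "\<beta> \<in> {\<eta> \<in> E. \<gamma> \<le> \<eta> \<and> \<eta> < b}"
      using \<gamma>\<beta>(1-3) by auto
    then have "\<gamma> = c" "\<beta> = c" unfolding singleton by simp_all
    then show False using \<gamma>\<beta>(3) by simp
  qed
  ultimately show "b = \<beta>" by simp
next
  note \<gamma>\<beta> = consecutive_inD[OF consec]
  assume "b = \<beta>"
  then have "{\<eta> \<in> E. \<gamma> \<le> \<eta> \<and> \<eta> < b} = {\<gamma>}" using \<gamma>\<beta> by (auto intro: order.antisym)
  then show "\<exists>c. {\<eta> \<in> E. \<gamma> \<le> \<eta> \<and> \<eta> < b} = {c}" by blast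
qed

definition cofinal_map :: "'o::linorder \<Rightarrow> 'o \<Rightarrow> ('o \<Rightarrow> 'o) \<Rightarrow> bool" where
  "cofinal_map \<eta> \<alpha> f \<longleftrightarrow> f ` {..<\<eta>} \<subseteq> {..<\<alpha>} \<and> (\<forall>\<xi><\<alpha>. \<exists>\<zeta><\<eta>. \<xi> \<le> f \<zeta>)"

definition cof_less :: "'o::linorder \<Rightarrow> 'o \<Rightarrow> bool" where
  "cof_less \<chi> \<alpha> \<longleftrightarrow> (\<exists>\<eta><\<chi>. \<exists>f. cofinal_map \<eta> \<alpha> f)"

lemma not_cof_less_imp_is_limit:
  assumes "\<not> cof_less \<chi> \<alpha>" and "\<xi> < \<eta>" "\<eta> < \<chi>"
  shows "is_limit \<alpha>"
proof (cases \<alpha> rule: zero_succ_limit_cases)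
  case zero
  then have "\<alpha> \<le> \<xi>" by (auto simp: lessThan_def not_less)
  then have "\<alpha> < \<chi>" using assms(2,3) by simp
  moreover have "cofinal_map \<alpha> \<alpha> id" unfolding cofinal_map_def by auto
  ultimately show ?thesis using assms(1) unfolding cof_less_def by blast
next
  case (succ \<beta>)
  then have "cofinal_map \<eta> \<alpha> (\<lambda>_. \<beta>)"
    unfolding cofinal_map_def using assms(2) by (auto simp: is_succ_iff)
  then show ?thesis using assms(1,3) unfolding cof_less_def by blast
qed

section \<open>Regular uncountable cardinals\<close>

locale regular_uncountable =
  fixes \<kappa> :: "'o::wellorder"
  assumes initial: "\<alpha> < \<kappa> \<Longrightarrow> |{..<\<alpha>}| <o |{..<\<kappa>}|"
    and regular: "\<alpha> < \<kappa> \<Longrightarrow> \<not> cofinal_map \<alpha> \<kappa> f"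
    and uncountable: "|UNIV :: nat set| <o |{..<\<kappa>}|"
begin

lemma ex_upper_bound:
  assumes "|X| <o |{..<\<kappa>}|" and "\<And>x. x \<in> X \<Longrightarrow> f x < \<kappa>"
  shows "\<exists>\<delta><\<kappa>. \<forall>x\<in>X. f x < \<delta>"
proof -
  obtain \<alpha> where "\<alpha> < \<kappa>" "|X| =o |{..<\<alpha>}|"
    using assms(1) by (rule card_less_lessThanE)
  then obtain e where e: "bij_betw e {..<\<alpha>} X"
    using card_of_ordIso ordIso_symmetric by blast
  have "(f \<circ> e) ` {..<\<alpha>} \<subseteq> {..<\<kappa>}"
    using e assms(2) unfolding bij_betw_def by auto
  then obtain \<delta> where "\<delta> < \<kappa>" "\<And>\<zeta>. \<zeta> < \<alpha> \<Longrightarrow> f (e \<zeta>) < \<delta>"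
    using regular[OF \<open>\<alpha> < \<kappa>\<close>, of "f \<circ> e"] unfolding cofinal_map_def by (auto simp: not_le)
  then show ?thesis
    using e unfolding bij_betw_def by blast
qed

lemma ex_supremum:
  assumes "|X| <o |{..<\<kappa>}|" and "\<And>x. x \<in> X \<Longrightarrow> f x < \<kappa>"
  obtains \<delta> where "\<delta> < \<kappa>" "\<And>x. x \<in> X \<Longrightarrow> f x \<le> \<delta>" "\<And>\<xi>. \<xi> < \<delta> \<Longrightarrow> \<exists>x\<in>X. \<xi> < f x"
proof -
  obtain b where "b < \<kappa>" "\<And>x. x \<in> X \<Longrightarrow> f x \<le> b"
    using ex_upper_bound[of X f] assms order.strict_implies_order by meson
  then show ?thesis
    using ex_least_upper_bound[of X f b] that by (metis order.strict_trans1)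
qed

lemma infinite_lessThan: "infinite {..<\<kappa>}"
  using uncountable ordLess_imp_ordLeq infinite_iff_card_of_nat by blast

lemma ex_greater: "\<beta> < \<kappa> \<Longrightarrow> \<exists>\<delta><\<kappa>. \<beta> < \<delta>"
  using ex_upper_bound[OF uncountable, of "\<lambda>_. \<beta>"] by blast

lemma ex_is_succ_below: "\<beta> < \<kappa> \<Longrightarrow> \<exists>\<alpha><\<kappa>. is_succ \<beta> \<alpha>"
  using ex_greater ex_is_succ order.strict_trans1 by metis

lemma stable: "stable |{..<\<kappa>}|"
  unfolding stable_def
proof (intro allI impI, elim conjE)
  fix I :: "'o set" and A :: "'o \<Rightarrow> 'o set"
  assume I: "|I| <o |{..<\<kappa>}|" and A: "\<forall>i\<in>I. |A i| <o |{..<\<kappa>}|"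
  obtain d where d: "\<And>i. i \<in> I \<Longrightarrow> d i < \<kappa>" "\<And>i. i \<in> I \<Longrightarrow> |A i| =o |{..<d i}|"
  proof -
    have "\<exists>\<delta><\<kappa>. |A i| =o |{..<\<delta>}|" if "i \<in> I" for i
      using A that card_less_lessThanE[of "A i" \<kappa>] by metis
    then show ?thesis using that by metis
  qed
  obtain \<alpha> where \<alpha>: "\<alpha> < \<kappa>" "|I| =o |{..<\<alpha>}|" using I by (rule card_less_lessThanE)
  obtain \<delta> where \<delta>: "\<delta> < \<kappa>" "\<forall>i\<in>I. d i < \<delta>" using ex_upper_bound[OF I, of d] d(1) by blast
  obtain \<omega> where \<omega>: "\<omega> < \<kappa>" "|UNIV :: nat set| =o |{..<\<omega>}|"
    using uncountable by (rule card_less_lessThanE)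
  define \<epsilon> where "\<epsilon> = max \<omega> (max \<alpha> \<delta>)"
  have mono: "|{..<\<xi>}| \<le>o |{..<\<epsilon>}|" if "\<xi> \<le> \<epsilon>" for \<xi>
    using that by (intro card_of_mono1) auto
  have "|UNIV :: nat set| \<le>o |{..<\<epsilon>}|"
    by (rule ordIso_ordLeq_trans[OF \<omega>(2) mono]) (simp add: \<epsilon>_def)
  then have "infinite {..<\<epsilon>}" unfolding infinite_iff_card_of_nat .
  moreover have "|I| \<le>o |{..<\<epsilon>}|"
    by (rule ordIso_ordLeq_trans[OF \<alpha>(2) mono]) (simp add: \<epsilon>_def le_max_iff_disj)
  moreover have "\<forall>i\<in>I. |A i| \<le>o |{..<\<epsilon>}|"
  proof
    fix i assume "i \<in> I"
    then have "d i \<le> \<epsilon>" using \<delta>(2) by (auto simp: \<epsilon>_def le_max_iff_disj)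
    then show "|A i| \<le>o |{..<\<epsilon>}|" by (rule ordIso_ordLeq_trans[OF d(2)[OF \<open>i \<in> I\<close>] mono])
  qed
  ultimately have "|SIGMA i : I. A i| \<le>o |{..<\<epsilon>}|"
    by (rule card_of_Sigma_ordLeq_infinite)
  moreover have "|{..<\<epsilon>}| <o |{..<\<kappa>}|"
    by (rule initial) (simp add: \<epsilon>_def \<alpha>(1) \<delta>(1) \<omega>(1))
  ultimately show "|SIGMA i : I. A i| <o |{..<\<kappa>}|" by (rule ordLeq_ordLess_trans)
qed

lemma card_image2_less:
  assumes "|A| <o |{..<\<kappa>}|" and "|B| <o |{..<\<kappa>}|"
  shows "|{f a b |a b. a \<in> A \<and> b \<in> B}| <o |{..<\<kappa>}|"
proof -
  have "|\<Union>a\<in>A. f a ` B| <o |{..<\<kappa>}|"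
    using assms by (intro stable_UNION[OF stable] ordLeq_ordLess_trans[OF card_of_image])
  moreover have "(\<Union>a\<in>A. f a ` B) = {f a b |a b. a \<in> A \<and> b \<in> B}" by auto
  ultimately show ?thesis by simp
qed

lemma club_below_lessThan: "club_below \<kappa> {..<\<kappa>}"
proof -
  have "\<exists>\<xi>. \<xi> < \<kappa>" using infinite_lessThan infinite_imp_nonempty by fast
  then show ?thesis
    unfolding club_below_def unbounded_in_def closed_below_def using ex_greater by blast
qed

definition closure_points :: "('o \<Rightarrow> 'o \<Rightarrow> bool) \<Rightarrow> 'o set" where
  "closure_points R = {\<delta>. \<delta> < \<kappa> \<and> (\<forall>\<xi><\<delta>. \<exists>\<epsilon><\<delta>. R \<xi> \<epsilon>)}"

lemma closure_pointsD: "\<delta> \<in> closure_points R \<Longrightarrow> \<xi> < \<delta> \<Longrightarrow> \<exists>\<epsilon><\<delta>. R \<xi> \<epsilon>"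
  unfolding closure_points_def by blast

lemma ex_closure_step:
  assumes "\<And>\<xi>. \<xi> < \<kappa> \<Longrightarrow> \<exists>\<epsilon><\<kappa>. R \<xi> \<epsilon>" and "\<delta> < \<kappa>"
  shows "\<exists>\<epsilon><\<kappa>. \<delta> < \<epsilon> \<and> (\<forall>\<xi><\<delta>. \<exists>\<epsilon>'<\<epsilon>. R \<xi> \<epsilon>')"
proof -
  obtain G where G: "\<And>\<xi>. \<xi> < \<delta> \<Longrightarrow> G \<xi> < \<kappa> \<and> R \<xi> (G \<xi>)"
    using assms order.strict_trans by metis
  then obtain \<epsilon>\<^sub>0 where \<epsilon>\<^sub>0: "\<epsilon>\<^sub>0 < \<kappa>" "\<forall>\<xi>\<in>{..<\<delta>}. G \<xi> < \<epsilon>\<^sub>0"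
    using ex_upper_bound[OF initial[OF assms(2)], of G] by auto
  obtain \<epsilon>\<^sub>1 where "\<epsilon>\<^sub>1 < \<kappa>" "\<delta> < \<epsilon>\<^sub>1" using ex_greater[OF assms(2)] by blast
  then show ?thesis
    using \<epsilon>\<^sub>0 G by (intro exI[of _ "max \<epsilon>\<^sub>0 \<epsilon>\<^sub>1"]) (auto simp: less_max_iff_disj)
qed

lemma club_closure_points:
  assumes "\<And>\<xi>. \<xi> < \<kappa> \<Longrightarrow> \<exists>\<epsilon><\<kappa>. R \<xi> \<epsilon>"
  shows "club_below \<kappa> (closure_points R)"
  unfolding club_below_def unbounded_in_def closed_below_def
proof (intro conjI allI impI)
  show "\<exists>\<xi>. \<xi> < \<kappa>" using infinite_lessThan infinite_imp_nonempty by fast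
  fix \<xi>\<^sub>0 assume "\<xi>\<^sub>0 < \<kappa>"
  obtain F where F: "\<And>\<delta>. \<delta> < \<kappa> \<Longrightarrow> F \<delta> < \<kappa> \<and> \<delta> < F \<delta> \<and> (\<forall>\<xi><\<delta>. \<exists>\<epsilon><F \<delta>. R \<xi> \<epsilon>)"
    using ex_closure_step[of R] assms by metis
  define s where "s n = (F ^^ n) \<xi>\<^sub>0" for n :: nat
  have s_Suc: "s (Suc n) = F (s n)" for n by (simp add: s_def)
  have s: "s n < \<kappa>" for n by (induction n) (simp_all add: s_def \<open>\<xi>\<^sub>0 < \<kappa>\<close> F)
  obtain \<delta> where "\<delta> < \<kappa>" and upper: "\<And>n. s n \<le> \<delta>" and least: "\<And>\<xi>. \<xi> < \<delta> \<Longrightarrow> \<exists>n. \<xi> < s n"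
    using ex_supremum[OF uncountable, of s] s by auto
  have s_less: "s n < \<delta>" for n
    using F[OF s[of n]] upper[of "Suc n"] unfolding s_Suc by (meson order.strict_trans2)
  have "\<exists>\<epsilon><\<delta>. R \<xi> \<epsilon>" if \<xi>: "\<xi> < \<delta>" for \<xi>
  proof -
    obtain n where "\<xi> < s n" using least[OF \<xi>] by blast
    then obtain \<epsilon> where "\<epsilon> < s (Suc n)" "R \<xi> \<epsilon>" using F[OF s[of n]] by (auto simp: s_Suc)
    then show ?thesis using upper[of "Suc n"] by (meson order.strict_trans2)
  qed
  with \<open>\<delta> < \<kappa>\<close> have "\<delta> \<in> closure_points R" unfolding closure_points_def by simp
  moreover have "\<xi>\<^sub>0 < \<delta>" using s_less[of 0] by (simp add: s_def)
  ultimately show "\<exists>\<delta>\<in>closure_points R. \<xi>\<^sub>0 < \<delta> \<and> \<delta> < \<kappa>" using \<open>\<delta> < \<kappa>\<close> by blast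
next
  fix \<delta> assume "\<delta> < \<kappa>"
    and limit: "(\<exists>\<xi>. \<xi> < \<delta>) \<and> (\<forall>\<xi><\<delta>. \<exists>\<eta>\<in>closure_points R. \<xi> < \<eta> \<and> \<eta> < \<delta>)"
  have "\<exists>\<epsilon><\<delta>. R \<xi> \<epsilon>" if "\<xi> < \<delta>" for \<xi>
    using limit that closure_pointsD order.strict_trans by metis
  with \<open>\<delta> < \<kappa>\<close> show "\<delta> \<in> closure_points R" unfolding closure_points_def by simp
qed (auto simp: closure_points_def)

end

section \<open>Partial maps\<close>

lemma map_le_restrict_eq:
  assumes "t \<subseteq>\<^sub>m s" "X \<subseteq> dom t" shows "s |` X = t |` X"
proof
  fix x show "(s |` X) x = (t |` X) x"
    using assms by (cases "x \<in> X") (simp_all add: map_le_def subset_iff)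
qed

lemma restrict_map_dom_subset: "dom t \<subseteq> X \<Longrightarrow> t |` X = t"
  by (rule ext) (metis domIff restrict_map_def subsetD)

lemma restrict_map_le: "t |` X \<subseteq>\<^sub>m t"
  by (auto simp: map_le_def)

lemma map_le_restrict: "s \<subseteq>\<^sub>m t \<Longrightarrow> t |` dom s = s"
  by (simp add: map_le_restrict_eq restrict_map_dom_subset)

lemma map_le_dom_eq: "s \<subseteq>\<^sub>m t \<Longrightarrow> dom s = dom t \<Longrightarrow> s = t"
  using map_le_restrict[of s t] by (simp add: restrict_map_dom_subset)

lemma map_le_fun_updD: "s \<subseteq>\<^sub>m t(a \<mapsto> b) \<Longrightarrow> a \<notin> dom s \<Longrightarrow> s \<subseteq>\<^sub>m t"
  unfolding map_le_def by (metis fun_upd_other)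

lemma map_le_fun_upd_cases:
  assumes "t \<subseteq>\<^sub>m s" "s \<subseteq>\<^sub>m t(a \<mapsto> b)"
  shows "s = t \<or> s = t(a \<mapsto> b)"
proof (cases "a \<in> dom s")
  case True
  then have "dom s = dom (t(a \<mapsto> b))" using assms[THEN map_le_implies_dom_le] by auto
  then show ?thesis using map_le_dom_eq[OF assms(2)] by blast
next
  case False
  with assms(2) have "s \<subseteq>\<^sub>m t" by (rule map_le_fun_updD)
  then show ?thesis using map_le_antisym[OF _ assms(1)] by blast
qed

lemma map_add_dom_subset: "dom s \<subseteq> dom t \<Longrightarrow> s ++ t = t"
  by (rule ext) (auto simp: map_add_def split: option.split)

lemma map_add_mono_left: "s \<subseteq>\<^sub>m t \<Longrightarrow> s ++ x \<subseteq>\<^sub>m t ++ x"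
  by (auto simp: map_le_def map_add_def split: option.split)

lemma restrict_map_add_right: "X \<subseteq> dom x \<Longrightarrow> (t ++ x) |` X = x |` X"
  by (rule ext) (auto simp: restrict_map_def map_add_def split: option.split)

lemma restrict_map_add_left: "dom x \<subseteq> X \<Longrightarrow> (t ++ x) |` X = (t |` X) ++ x"
  by (rule ext) (auto simp: restrict_map_def map_add_def split: option.split)

abbreviation map_chain :: "('a \<rightharpoonup> 'b) set \<Rightarrow> bool" where
  "map_chain \<equiv> Complete_Partial_Order.chain (\<subseteq>\<^sub>m)"

lemma map_chain_image:
  fixes F :: "'a::linorder set"
  assumes "monotone_on F (\<le>) (\<subseteq>\<^sub>m) f"
  shows "map_chain (f ` F)"
proof (rule chainI)
  fix s t assume "s \<in> f ` F" "t \<in> f ` F"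
  then obtain \<eta> \<zeta> where "\<eta> \<in> F" "s = f \<eta>" "\<zeta> \<in> F" "t = f \<zeta>" by blast
  then show "s \<subseteq>\<^sub>m t \<or> t \<subseteq>\<^sub>m s"
    using linear[of \<eta> \<zeta>] monotone_onD[OF assms] by blast
qed

lemma map_chain_dom_subset:
  assumes "map_chain M" "s \<in> M" "t \<in> M" "dom s \<subseteq> dom t"
  shows "s \<subseteq>\<^sub>m t"
proof -
  have "s = t" if "t \<subseteq>\<^sub>m s"
    using map_le_dom_eq[OF that] map_le_implies_dom_le[OF that] assms(4) by simp
  then show ?thesis using chainD[OF assms(1-3)] by auto
qed

definition glue :: "('a \<rightharpoonup> 'b) set \<Rightarrow> ('a \<rightharpoonup> 'b)" where
  "glue M x = (if \<exists>t\<in>M. x \<in> dom t then (SOME t. t \<in> M \<and> x \<in> dom t) x else None)"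

lemma glue_empty [simp]: "glue {} = Map.empty"
  by (simp add: glue_def fun_eq_iff)

lemma dom_glue: "dom (glue M) = (\<Union>t\<in>M. dom t)"
proof -
  have "(SOME t. t \<in> M \<and> x \<in> dom t) x \<noteq> None" if "\<exists>t\<in>M. x \<in> dom t" for x
    using someI_ex[of "\<lambda>t. t \<in> M \<and> x \<in> dom t"] that by auto
  then show ?thesis unfolding glue_def dom_def by auto
qed

lemma map_le_glue:
  assumes "map_chain M" and "t \<in> M"
  shows "t \<subseteq>\<^sub>m glue M"
  unfolding map_le_def
proof
  fix x assume x: "x \<in> dom t"
  define s where "s = (SOME s. s \<in> M \<and> x \<in> dom s)"
  have "s \<in> M \<and> x \<in> dom s" unfolding s_def by (rule someI[of _ t]) (use x assms in blast)
  then have "s x = t x"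
    using chainD[OF assms(1), of s t] assms(2) x unfolding map_le_def by metis
  then show "t x = glue M x" using x assms(2) by (auto simp: glue_def s_def)
qed

lemma glue_greatest:
  assumes "map_chain M" "u \<in> M" "\<And>t. t \<in> M \<Longrightarrow> t \<subseteq>\<^sub>m u"
  shows "glue M = u"
proof (rule map_le_dom_eq[symmetric])
  show "u \<subseteq>\<^sub>m glue M" using assms(1,2) by (rule map_le_glue)
  show "dom u = dom (glue M)"
    using assms(2) assms(3)[THEN map_le_implies_dom_le] unfolding dom_glue by blast
qed

lemma glue_consecutive:
  fixes E :: "'a::linorder set"
  assumes mono: "monotone_on (E \<inter> {..<\<beta>}) (\<le>) (\<subseteq>\<^sub>m) f" and "consecutive_in E \<gamma> \<beta>"
  shows "glue (f ` (E \<inter> {..<\<beta>})) = f \<gamma>"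
proof (rule glue_greatest[OF map_chain_image[OF mono]])
  note consec = consecutive_inD[OF assms(2)]
  show "f \<gamma> \<in> f ` (E \<inter> {..<\<beta>})" using consec(1,3) by blast
  show "t \<subseteq>\<^sub>m f \<gamma>" if "t \<in> f ` (E \<inter> {..<\<beta>})" for t
    using that consec(1,3,4) monotone_onD[OF mono] by blast
qed

section \<open>Cofinal branches\<close>

definition cofinal_branches :: "('o::linorder \<Rightarrow> ('o \<rightharpoonup> 'b) set) \<Rightarrow> 'o \<Rightarrow> ('o \<rightharpoonup> 'b) set" where
  "cofinal_branches L \<alpha> = {t. dom t = {..<\<alpha>} \<and> (\<forall>\<xi><\<alpha>. t |` {..<\<xi>} \<in> L \<xi>)}"

lemma cofinal_branchesI:
  "dom t = {..<\<alpha>} \<Longrightarrow> (\<And>\<xi>. \<xi> < \<alpha> \<Longrightarrow> t |` {..<\<xi>} \<in> L \<xi>) \<Longrightarrow> t \<in> cofinal_branches L \<alpha>"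
  unfolding cofinal_branches_def by blast

lemma cofinal_branchesD:
  assumes "t \<in> cofinal_branches L \<alpha>"
  shows "dom t = {..<\<alpha>}" "\<xi> < \<alpha> \<Longrightarrow> t |` {..<\<xi>} \<in> L \<xi>"
  using assms unfolding cofinal_branches_def by blast+

lemma inj_on_cofinal_branches:
  assumes not_succ: "\<nexists>\<beta>. is_succ \<beta> \<alpha>" and f: "cofinal_map \<eta> \<alpha> f"
  shows "inj_on (\<lambda>t. \<lambda>\<zeta>\<in>{..<\<eta>}. t |` {..<f \<zeta>}) (cofinal_branches L \<alpha>)"
proof (rule inj_onI)
  fix s t
  assume s: "s \<in> cofinal_branches L \<alpha>" and t: "t \<in> cofinal_branches L \<alpha>"
    and restrictions_eq: "(\<lambda>\<zeta>\<in>{..<\<eta>}. s |` {..<f \<zeta>}) = (\<lambda>\<zeta>\<in>{..<\<eta>}. t |` {..<f \<zeta>})"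
  show "s = t"
  proof
    fix x
    show "s x = t x"
    proof (cases "x < \<alpha>")
      case True
      then obtain \<xi> where "\<xi> < \<alpha>" "x < \<xi>" using not_succ unfolding not_is_succ_iff by blast
      then obtain \<zeta> where "\<zeta> < \<eta>" "\<xi> \<le> f \<zeta>" using f unfolding cofinal_map_def by blast
      then have "(s |` {..<f \<zeta>}) x = (t |` {..<f \<zeta>}) x"
        using fun_cong[OF restrictions_eq, of \<zeta>] by simp
      then show ?thesis using \<open>x < \<xi>\<close> \<open>\<xi> \<le> f \<zeta>\<close> by simp
    next
      case False
      then show ?thesis
        using cofinal_branchesD(1)[OF s] cofinal_branchesD(1)[OF t] by (metis domIff lessThan_iff)
    qed
  qed
qed

lemma card_cofinal_branches:
  fixes L :: "'o::linorder \<Rightarrow> ('o \<rightharpoonup> 'b) set"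
  assumes "\<nexists>\<beta>. is_succ \<beta> \<alpha>" and f: "cofinal_map \<eta> \<alpha> f"
  shows "|cofinal_branches L \<alpha>| \<le>o |\<Union>\<xi>\<in>{..<\<alpha>}. L \<xi>| ^c |{..<\<eta>}|"
proof -
  have "(\<lambda>\<zeta>\<in>{..<\<eta>}. t |` {..<f \<zeta>}) \<in> Func {..<\<eta>} (\<Union>\<xi>\<in>{..<\<alpha>}. L \<xi>)"
    if t: "t \<in> cofinal_branches L \<alpha>" for t
    using cofinal_branchesD(2)[OF t] f unfolding Func_def cofinal_map_def by auto
  then have "|cofinal_branches L \<alpha>| \<le>o |Func {..<\<eta>} (\<Union>\<xi>\<in>{..<\<alpha>}. L \<xi>)|"
    using inj_on_cofinal_branches[OF assms] by (rule card_of_ordLeqI[rotated])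
  then show ?thesis by (simp add: cexp_def Field_card_of)
qed

section \<open>The tree\<close>

text \<open>The data of a proxy sequence: \<open>Cs \<alpha>\<close> lists the pairs \<open>(\<partial>C, C)\<close>, and \<open>idx \<beta>\<close> is the \<open>\<iota>\<close> with
  \<open>\<beta> \<in> B\<^sub>\<iota>\<close>. A node of level \<open>\<alpha>\<close> will get \<open>w \<alpha>\<close> many immediate successors.\<close>

locale proxy = regular_uncountable \<kappa> for \<kappa> :: "'o::wellorder" +
  fixes \<chi> :: 'o and w :: "'o \<Rightarrow> 'o" and Cs :: "'o \<Rightarrow> ('o set \<times> ('o \<Rightarrow> 'o set)) set"
    and idx :: "'o \<Rightarrow> 'o"
  assumes \<chi>_less: "\<chi> < \<kappa>" and two_less_\<chi>: "\<exists>a b. a < b \<and> b < \<chi>"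
    and cexp_less: "\<lbrakk>\<eta> < \<chi>; \<mu> < \<kappa>\<rbrakk> \<Longrightarrow> |{..<\<mu>}| ^c |{..<\<eta>}| <o |{..<\<kappa>}|"
    and w_less: "\<alpha> < \<kappa> \<Longrightarrow> w \<alpha> < \<kappa>"
    and two_less_w: "\<alpha> < \<kappa> \<Longrightarrow> \<exists>a b. a < b \<and> b < w \<alpha>"
    and Cs_nonempty: "\<lbrakk>\<alpha> < \<kappa>; is_limit \<alpha>\<rbrakk> \<Longrightarrow> Cs \<alpha> \<noteq> {}"
    and card_Cs_less: "\<lbrakk>\<alpha> < \<kappa>; is_limit \<alpha>\<rbrakk> \<Longrightarrow> |Cs \<alpha>| <o |{..<\<kappa>}|"
    and Cs_club: "\<lbrakk>\<alpha> < \<kappa>; is_limit \<alpha>; (E, g) \<in> Cs \<alpha>\<rbrakk> \<Longrightarrow> club_below \<alpha> E"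
    and Cs_coherent: "\<lbrakk>\<alpha> < \<kappa>; is_limit \<alpha>; (E, g) \<in> Cs \<alpha>; \<delta> \<in> E; unbounded_in \<delta> E;
      \<not> cof_less \<chi> \<delta>\<rbrakk> \<Longrightarrow> \<exists>g'. (E \<inter> {..<\<delta>}, g') \<in> Cs \<delta> \<and> (\<forall>\<xi>\<in>E \<inter> {..<\<delta>}. g' \<xi> = g \<xi>)"
    and guess: "\<lbrakk>club_below \<kappa> D; \<Omega> \<subseteq> {..<\<kappa>}\<rbrakk> \<Longrightarrow> \<exists>\<alpha><\<kappa>. \<not> cof_less \<chi> \<alpha> \<and>
      (\<forall>(E, g)\<in>Cs \<alpha>. \<forall>i<\<alpha>. \<forall>\<xi><\<alpha>. \<exists>\<gamma> \<beta>. consecutive_in E \<gamma> \<beta> \<and> \<xi> < \<gamma> \<and>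
        idx \<beta> = i \<and> \<beta> \<in> D \<and> g \<beta> = \<Omega> \<inter> {..<\<beta>})"
begin

lemma large_cof_is_limit: "\<not> cof_less \<chi> \<alpha> \<Longrightarrow> is_limit \<alpha>"
  using not_cof_less_imp_is_limit two_less_\<chi> by blast

lemma level_cases:
  obtains (succ) \<beta> where "is_succ \<beta> \<alpha>"
    | (small_cof) "\<nexists>\<beta>. is_succ \<beta> \<alpha>" "cof_less \<chi> \<alpha>"
    | (large_cof) "\<nexists>\<beta>. is_succ \<beta> \<alpha>" "\<not> cof_less \<chi> \<alpha>"
  by blast

lemma cexp_card_less:
  assumes "\<eta> < \<chi>" "|X| <o |{..<\<kappa>}|"
  shows "|X| ^c |{..<\<eta>}| <o |{..<\<kappa>}|"
proof -
  obtain \<mu> where "\<mu> < \<kappa>" "|X| =o |{..<\<mu>}|" using assms(2) by (rule card_less_lessThanE)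
  then show ?thesis
    using cexp_less[OF assms(1)] cexp_cong1[OF _ card_of_Card_order] ordIso_ordLess_trans by blast
qed

definition pairing :: "'o \<Rightarrow> 'o \<times> 'o" where
  "pairing = (SOME h. bij_betw h {..<\<kappa>} ({..<\<kappa>} \<times> {..<\<kappa>}))"

abbreviation height :: "'o \<Rightarrow> 'o" where
  "height i \<equiv> fst (pairing i)"

definition node :: "('o \<Rightarrow> ('o \<rightharpoonup> 'o) set) \<Rightarrow> 'o \<Rightarrow> ('o \<rightharpoonup> 'o)" where
  "node L i = (SOME e. e ` {..<\<kappa>} = L (height i)) (snd (pairing i))"

text \<open>The conditions on heights keep the construction recursive: nodes are looked up only in levels
  below \<open>\<beta>\<close>.\<close>

definition seals ::
  "('o \<Rightarrow> ('o \<rightharpoonup> 'o) set) \<Rightarrow> ('o \<Rightarrow> 'o set) \<Rightarrow> ('o \<rightharpoonup> 'o) \<Rightarrow> 'o \<Rightarrow> ('o \<rightharpoonup> 'o) \<Rightarrow> bool" where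
  "seals L g u \<beta> t \<longleftrightarrow> (\<exists>j\<in>g \<beta>. height j < \<beta> \<and> height (idx \<beta>) < \<beta> \<and>
     node L j \<subseteq>\<^sub>m t \<and> u ++ node L (idx \<beta>) \<subseteq>\<^sub>m t)"

definition pick ::
  "('o \<Rightarrow> ('o \<rightharpoonup> 'o) set) \<Rightarrow> ('o \<Rightarrow> 'o set) \<Rightarrow> ('o \<rightharpoonup> 'o) \<Rightarrow> 'o \<Rightarrow> ('o \<rightharpoonup> 'o)" where
  "pick L g u \<beta> = (SOME t. t \<in> L \<beta> \<and> ((\<exists>t\<in>L \<beta>. seals L g u \<beta> t) \<longrightarrow> seals L g u \<beta> t))"

text \<open>\<open>y ++ x\<close> is the paper's \<open>x * y\<close>.\<close>

function branch ::
  "('o \<Rightarrow> ('o \<rightharpoonup> 'o) set) \<Rightarrow> 'o set \<Rightarrow> ('o \<Rightarrow> 'o set) \<Rightarrow> 'o \<Rightarrow> ('o \<rightharpoonup> 'o)" where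
  "branch L E g \<beta> = pick L g (glue (branch L E g ` (E \<inter> {..<\<beta>}))) \<beta> ++
     glue (branch L E g ` (E \<inter> {..<\<beta>}))"
  by pat_completeness auto
termination
  by (relation "inv_image {(x, y). x < y} (\<lambda>(L, E, g, \<beta>). \<beta>)") (auto simp: wf)

declare branch.simps [simp del]

definition limit_branch ::
  "('o \<Rightarrow> ('o \<rightharpoonup> 'o) set) \<Rightarrow> 'o set \<Rightarrow> ('o \<Rightarrow> 'o set) \<Rightarrow> ('o \<rightharpoonup> 'o)" where
  "limit_branch L E g = glue (branch L E g ` E)"

text \<open>The ordinal \<open>0\<close> falls under the second clause, which then yields the level containing only the
  empty map.\<close>

definition level_step :: "('o \<Rightarrow> ('o \<rightharpoonup> 'o) set) \<Rightarrow> 'o \<Rightarrow> ('o \<rightharpoonup> 'o) set" where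
  "level_step L \<alpha> =
    (if \<exists>\<beta>. is_succ \<beta> \<alpha> then {t(\<beta> \<mapsto> i) |t \<beta> i. is_succ \<beta> \<alpha> \<and> t \<in> L \<beta> \<and> i < w \<beta>}
     else if cof_less \<chi> \<alpha> then cofinal_branches L \<alpha>
     else {limit_branch L E g ++ x |E g x. (E, g) \<in> Cs \<alpha> \<and> x \<in> (\<Union>\<xi>\<in>{..<\<alpha>}. L \<xi>)})"

definition Lev :: "'o \<Rightarrow> ('o \<rightharpoonup> 'o) set" where
  "Lev = wfrec {(x, y). x < y} level_step"

lemma seals_cong:
  assumes "\<And>\<xi>. \<xi> < \<beta> \<Longrightarrow> L \<xi> = L' \<xi>" "g \<beta> = g' \<beta>"
  shows "seals L g u \<beta> t = seals L' g' u \<beta> t"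
proof -
  have "node L i = node L' i" if "height i < \<beta>" for i
    using assms(1)[OF that] by (simp add: node_def)
  then show ?thesis unfolding seals_def assms(2) by (intro bex_cong conj_cong refl) simp_all
qed

lemma pick_cong:
  assumes "\<And>\<xi>. \<xi> \<le> \<beta> \<Longrightarrow> L \<xi> = L' \<xi>" "g \<beta> = g' \<beta>"
  shows "pick L g u \<beta> = pick L' g' u \<beta>"
proof -
  have "seals L g u \<beta> = seals L' g' u \<beta>"
    using assms by (intro ext seals_cong) auto
  then show ?thesis unfolding pick_def using assms(1)[of \<beta>] by simp
qed

lemma branch_cong:
  assumes "\<beta> \<in> E" "\<And>\<xi>. \<xi> \<le> \<beta> \<Longrightarrow> L \<xi> = L' \<xi>" "E \<inter> {..\<beta>} = E' \<inter> {..\<beta>}"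
    "\<And>\<xi>. \<lbrakk>\<xi> \<in> E; \<xi> \<le> \<beta>\<rbrakk> \<Longrightarrow> g \<xi> = g' \<xi>"
  shows "branch L E g \<beta> = branch L' E' g' \<beta>"
  using assms
proof (induction \<beta> rule: less_induct)
  case (less \<beta>)
  have E_iff: "\<xi> \<in> E \<longleftrightarrow> \<xi> \<in> E'" if "\<xi> \<le> \<beta>" for \<xi>
    using less.prems(3) that by blast
  have "branch L E g \<gamma> = branch L' E' g' \<gamma>" if "\<gamma> \<in> E \<inter> {..<\<beta>}" for \<gamma>
  proof (rule less.IH)
    show "E \<inter> {..\<gamma>} = E' \<inter> {..\<gamma>}" using E_iff that by auto
  qed (use that less.prems(2,4) in auto)
  moreover have "E \<inter> {..<\<beta>} = E' \<inter> {..<\<beta>}" using E_iff by auto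
  ultimately have "branch L E g ` (E \<inter> {..<\<beta>}) = branch L' E' g' ` (E' \<inter> {..<\<beta>})"
    by (intro image_cong) auto
  moreover have "pick L g u \<beta> = pick L' g' u \<beta>" for u
    using less.prems by (intro pick_cong) auto
  ultimately show ?case
    unfolding branch.simps[of L E g \<beta>] branch.simps[of L' E' g' \<beta>] by simp
qed

lemma limit_branch_cong:
  assumes "E \<subseteq> {..<\<alpha>}" "\<And>\<xi>. \<xi> < \<alpha> \<Longrightarrow> L \<xi> = L' \<xi>"
  shows "limit_branch L E g = limit_branch L' E g"
proof -
  have "branch L E g \<beta> = branch L' E g \<beta>" if "\<beta> \<in> E" for \<beta>
    using assms that by (intro branch_cong) (auto intro: order.strict_trans1)
  then show ?thesis unfolding limit_branch_def by (metis image_cong)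
qed

lemma level_step_cong:
  assumes "\<alpha> < \<kappa>" and L: "\<And>\<xi>. \<xi> < \<alpha> \<Longrightarrow> L \<xi> = L' \<xi>"
  shows "level_step L \<alpha> = level_step L' \<alpha>"
proof (cases \<alpha> rule: level_cases)
  case succ
  then have "is_succ \<beta> \<alpha> \<and> t \<in> L \<beta> \<and> i < w \<beta> \<longleftrightarrow> is_succ \<beta> \<alpha> \<and> t \<in> L' \<beta> \<and> i < w \<beta>" for \<beta> t i
    using L is_succ_less by blast
  with succ show ?thesis by (auto simp: level_step_def)
next
  case small_cof
  then show ?thesis using L by (simp add: level_step_def cofinal_branches_def)
next
  case large_cof
  have "limit_branch L E g = limit_branch L' E g" if "(E, g) \<in> Cs \<alpha>" for E g
    using club_belowD(1)[OF Cs_club[OF \<open>\<alpha> < \<kappa>\<close> large_cof_is_limit[OF large_cof(2)] that]] L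
    by (rule limit_branch_cong)
  moreover have "(\<Union>\<xi>\<in>{..<\<alpha>}. L \<xi>) = (\<Union>\<xi>\<in>{..<\<alpha>}. L' \<xi>)" using L by simp
  ultimately have "{limit_branch L E g ++ x |E g x. (E, g) \<in> Cs \<alpha> \<and> x \<in> (\<Union>\<xi>\<in>{..<\<alpha>}. L \<xi>)} =
      {limit_branch L' E g ++ x |E g x. (E, g) \<in> Cs \<alpha> \<and> x \<in> (\<Union>\<xi>\<in>{..<\<alpha>}. L' \<xi>)}"
    by (metis (no_types, lifting))
  with large_cof show ?thesis by (simp add: level_step_def)
qed

lemma Lev_unfold:
  assumes "\<alpha> < \<kappa>" shows "Lev \<alpha> = level_step Lev \<alpha>"
proof -
  have "Lev \<alpha> = level_step (cut Lev {(x, y). x < y} \<alpha>) \<alpha>"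
    unfolding Lev_def by (rule wfrec[OF wf])
  also have "\<dots> = level_step Lev \<alpha>"
    using assms by (rule level_step_cong) (simp add: cut_def)
  finally show ?thesis .
qed

lemma Lev_succ:
  assumes "\<alpha> < \<kappa>" "is_succ \<beta> \<alpha>"
  shows "Lev \<alpha> = {t(\<beta> \<mapsto> i) |t i. t \<in> Lev \<beta> \<and> i < w \<beta>}"
proof -
  have "is_succ \<gamma> \<alpha> \<longleftrightarrow> \<gamma> = \<beta>" for \<gamma> using assms(2) is_succ_unique by blast
  then show ?thesis unfolding Lev_unfold[OF assms(1)] level_step_def by auto
qed

lemma Lev_small_cof:
  assumes "\<alpha> < \<kappa>" "\<nexists>\<beta>. is_succ \<beta> \<alpha>" "cof_less \<chi> \<alpha>"
  shows "Lev \<alpha> = cofinal_branches Lev \<alpha>"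
  unfolding Lev_unfold[OF assms(1)] level_step_def using assms(2,3) by simp

lemma Lev_large_cof:
  assumes "\<alpha> < \<kappa>" "\<not> cof_less \<chi> \<alpha>"
  shows "Lev \<alpha> = {limit_branch Lev E g ++ x |E g x. (E, g) \<in> Cs \<alpha> \<and> x \<in> (\<Union>\<xi>\<in>{..<\<alpha>}. Lev \<xi>)}"
  unfolding Lev_unfold[OF assms(1)] level_step_def
  using assms(2) is_limit_not_is_succ[OF large_cof_is_limit[OF assms(2)]] by simp

subsection \<open>Coherence of the levels\<close>

definition coherent_level :: "'o \<Rightarrow> bool" where
  "coherent_level \<alpha> \<longleftrightarrow> Lev \<alpha> \<noteq> {} \<and> Lev \<alpha> \<subseteq> cofinal_branches Lev \<alpha> \<and>
     (\<forall>t\<in>Lev \<alpha>. \<forall>\<xi><\<alpha>. \<forall>x\<in>Lev \<xi>. t ++ x \<in> Lev \<alpha>)"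

lemma coherent_levelD:
  assumes "coherent_level \<alpha>"
  shows "Lev \<alpha> \<noteq> {}" "t \<in> Lev \<alpha> \<Longrightarrow> dom t = {..<\<alpha>}"
    "\<lbrakk>t \<in> Lev \<alpha>; \<xi> \<le> \<alpha>\<rbrakk> \<Longrightarrow> t |` {..<\<xi>} \<in> Lev \<xi>"
    "\<lbrakk>t \<in> Lev \<alpha>; \<xi> < \<alpha>; x \<in> Lev \<xi>\<rbrakk> \<Longrightarrow> t ++ x \<in> Lev \<alpha>"
proof -
  have branch: "t \<in> cofinal_branches Lev \<alpha>" if "t \<in> Lev \<alpha>" for t
    using assms that unfolding coherent_level_def by blast
  show dom: "dom t = {..<\<alpha>}" if "t \<in> Lev \<alpha>" for t
    using cofinal_branchesD(1)[OF branch[OF that]] .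
  show "t |` {..<\<xi>} \<in> Lev \<xi>" if "t \<in> Lev \<alpha>" "\<xi> \<le> \<alpha>"
    using cofinal_branchesD(2)[OF branch[OF that(1)]] that dom[OF that(1)]
    by (cases "\<xi> = \<alpha>") (auto simp: restrict_map_dom_subset)
qed (use assms in \<open>auto simp: coherent_level_def\<close>)

lemma cofinal_branches_graft:
  assumes below: "\<And>\<gamma>. \<gamma> < \<alpha> \<Longrightarrow> coherent_level \<gamma>"
    and t: "t \<in> cofinal_branches Lev \<alpha>" and x: "\<xi> < \<alpha>" "x \<in> Lev \<xi>"
  shows "t ++ x \<in> cofinal_branches Lev \<alpha>"
proof (rule cofinal_branchesI)
  note dom_x = coherent_levelD(2)[OF below[OF x(1)] x(2)]
  show "dom (t ++ x) = {..<\<alpha>}" using x(1) by (auto simp: cofinal_branchesD(1)[OF t] dom_x)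
  fix \<zeta> assume \<zeta>: "\<zeta> < \<alpha>"
  show "(t ++ x) |` {..<\<zeta>} \<in> Lev \<zeta>"
  proof (cases "\<zeta> \<le> \<xi>")
    case True
    then show ?thesis
      using coherent_levelD(3)[OF below[OF x(1)] x(2)] by (simp add: restrict_map_add_right dom_x)
  next
    case False
    then have "(t ++ x) |` {..<\<zeta>} = (t |` {..<\<zeta>}) ++ x"
      by (intro restrict_map_add_left) (auto simp: dom_x)
    then show ?thesis
      using coherent_levelD(4)[OF below[OF \<zeta>] cofinal_branchesD(2)[OF t \<zeta>] _ x(2)] False by simp
  qed
qed

lemma glue_in_cofinal_branches:
  assumes below: "\<And>\<gamma>. \<gamma> < \<beta> \<Longrightarrow> coherent_level \<gamma>"
    and f: "\<And>i. i \<in> I \<Longrightarrow> l i < \<beta>" "\<And>i. i \<in> I \<Longrightarrow> f i \<in> Lev (l i)" "map_chain (f ` I)"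
    and cofinal: "\<And>\<xi>. \<xi> < \<beta> \<Longrightarrow> \<exists>i\<in>I. \<xi> < l i"
  shows "glue (f ` I) \<in> cofinal_branches Lev \<beta>"
proof (rule cofinal_branchesI)
  have dom_f: "dom (f i) = {..<l i}" if "i \<in> I" for i
    using coherent_levelD(2)[OF below f(2)] f(1) that by blast
  have "(\<Union>i\<in>I. {..<l i}) = {..<\<beta>}"
    using f(1) cofinal by (auto intro: order.strict_trans)
  then show "dom (glue (f ` I)) = {..<\<beta>}" by (simp add: dom_glue dom_f)
  fix \<xi> assume "\<xi> < \<beta>"
  then obtain i where i: "i \<in> I" "\<xi> < l i" using cofinal by blast
  have "f i \<subseteq>\<^sub>m glue (f ` I)" using f(3) i(1) by (simp add: map_le_glue)
  then have "glue (f ` I) |` {..<\<xi>} = f i |` {..<\<xi>}"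
    by (rule map_le_restrict_eq) (use i dom_f in auto)
  then show "glue (f ` I) |` {..<\<xi>} \<in> Lev \<xi>"
    using coherent_levelD(3)[OF below[OF f(1)[OF i(1)]] f(2)[OF i(1)], of \<xi>] i(2) by simp
qed

lemma pick_in_level:
  assumes "Lev \<beta> \<noteq> {}"
  shows "pick Lev g u \<beta> \<in> Lev \<beta>"
    and "\<lbrakk>t \<in> Lev \<beta>; seals Lev g u \<beta> t\<rbrakk> \<Longrightarrow> seals Lev g u \<beta> (pick Lev g u \<beta>)"
proof -
  have "\<exists>t. t \<in> Lev \<beta> \<and> ((\<exists>t\<in>Lev \<beta>. seals Lev g u \<beta> t) \<longrightarrow> seals Lev g u \<beta> t)"
    using assms by blast
  from someI_ex[OF this]
  show "pick Lev g u \<beta> \<in> Lev \<beta>"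
    and "\<lbrakk>t \<in> Lev \<beta>; seals Lev g u \<beta> t\<rbrakk> \<Longrightarrow> seals Lev g u \<beta> (pick Lev g u \<beta>)"
    unfolding pick_def by blast+
qed

lemma monotone_branch: "monotone_on E (\<le>) (\<subseteq>\<^sub>m) (branch L E g)"
proof -
  have "branch L E g \<gamma> \<subseteq>\<^sub>m branch L E g \<beta>" if "\<gamma> \<in> E" "\<gamma> < \<beta>" for \<gamma> \<beta>
    using that
  proof (induction \<beta> arbitrary: \<gamma> rule: less_induct)
    case (less \<beta>)
    have "monotone_on (E \<inter> {..<\<beta>}) (\<le>) (\<subseteq>\<^sub>m) (branch L E g)"
      using less.IH by (auto simp: monotone_on_def order.order_iff_strict)
    then have "branch L E g \<gamma> \<subseteq>\<^sub>m glue (branch L E g ` (E \<inter> {..<\<beta>}))"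
      using less.prems by (intro map_le_glue map_chain_image) auto
    then show ?case
      unfolding branch.simps[of L E g \<beta>] using map_le_map_add map_le_trans by blast
  qed
  then show ?thesis by (auto simp: monotone_on_def order.order_iff_strict)
qed

lemma branch_le_limit_branch: "\<beta> \<in> E \<Longrightarrow> branch L E g \<beta> \<subseteq>\<^sub>m limit_branch L E g"
  unfolding limit_branch_def by (intro map_le_glue map_chain_image monotone_branch imageI)

lemma branch_consecutive:
  assumes "consecutive_in E \<gamma> \<beta>"
  shows "branch L E g \<beta> = pick L g (branch L E g \<gamma>) \<beta> ++ branch L E g \<gamma>"
  using glue_consecutive[OF monotone_on_subset[OF monotone_branch] assms]
  by (simp add: branch.simps[of L E g \<beta>])

lemma glue_branch_in_level:
  assumes \<alpha>: "\<alpha> < \<kappa>" "is_limit \<alpha>" and C: "(E, g) \<in> Cs \<alpha>"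
    and below: "\<And>\<gamma>. \<gamma> < \<alpha> \<Longrightarrow> coherent_level \<gamma>"
    and \<beta>: "\<beta> \<in> E" "unbounded_in \<beta> E"
    and IH: "\<And>\<gamma>. \<gamma> \<in> E \<inter> {..<\<beta>} \<Longrightarrow> branch Lev E g \<gamma> \<in> Lev \<gamma>"
  shows "glue (branch Lev E g ` (E \<inter> {..<\<beta>})) \<in> Lev \<beta>" (is "?u \<in> _")
proof -
  have \<beta>_less: "\<beta> < \<alpha>" "\<beta> < \<kappa>"
    using club_belowD(1)[OF Cs_club[OF \<alpha> C]] \<beta>(1) \<alpha>(1) by auto
  have u: "?u \<in> cofinal_branches Lev \<beta>"
  proof (rule glue_in_cofinal_branches[where l = "\<lambda>\<gamma>. \<gamma>"])
    show "coherent_level \<gamma>" if "\<gamma> < \<beta>" for \<gamma> using that \<beta>_less(1) by (intro below) simp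
    show "map_chain (branch Lev E g ` (E \<inter> {..<\<beta>}))"
      by (rule map_chain_image[OF monotone_on_subset[OF monotone_branch Int_lower1]])
    show "\<exists>\<gamma>\<in>E \<inter> {..<\<beta>}. \<xi> < \<gamma>" if "\<xi> < \<beta>" for \<xi> using unbounded_inD[OF \<beta>(2) that] by blast
  qed (use IH in auto)
  show ?thesis
  proof (cases "cof_less \<chi> \<beta>")
    case True
    then show ?thesis
      using u Lev_small_cof[OF \<beta>_less(2)] is_limit_not_is_succ unbounded_in_imp_is_limit[OF \<beta>(2)]
      by blast
  next
    case False
    then obtain g' where g': "(E \<inter> {..<\<beta>}, g') \<in> Cs \<beta>" "\<forall>\<xi>\<in>E \<inter> {..<\<beta>}. g' \<xi> = g \<xi>"
      using Cs_coherent[OF \<alpha> C \<beta>] by blast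
    have "branch Lev (E \<inter> {..<\<beta>}) g' \<gamma> = branch Lev E g \<gamma>" if "\<gamma> \<in> E \<inter> {..<\<beta>}" for \<gamma>
      using that g'(2) by (intro branch_cong) auto
    then have limit: "limit_branch Lev (E \<inter> {..<\<beta>}) g' = ?u"
      unfolding limit_branch_def by (metis image_cong)
    obtain \<xi> where \<xi>: "\<xi> < \<beta>" using \<beta>(2) unfolding unbounded_in_def by blast
    have "?u = limit_branch Lev (E \<inter> {..<\<beta>}) g' ++ (?u |` {..<\<xi>})"
      unfolding limit by (rule map_add_subsumed2[OF restrict_map_le, symmetric])
    moreover have "?u |` {..<\<xi>} \<in> (\<Union>\<xi>\<in>{..<\<beta>}. Lev \<xi>)"
      using cofinal_branchesD(2)[OF u \<xi>] \<xi> by blast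
    ultimately show ?thesis
      unfolding Lev_large_cof[OF \<beta>_less(2) False] using g'(1) by blast
  qed
qed

lemma branch_in_level:
  assumes \<alpha>: "\<alpha> < \<kappa>" "is_limit \<alpha>" and C: "(E, g) \<in> Cs \<alpha>"
    and below: "\<And>\<gamma>. \<gamma> < \<alpha> \<Longrightarrow> coherent_level \<gamma>" and "\<beta> \<in> E"
  shows "branch Lev E g \<beta> \<in> Lev \<beta>"
  using \<open>\<beta> \<in> E\<close>
proof (induction \<beta> rule: less_induct)
  case (less \<beta>)
  note E = club_belowD[OF Cs_club[OF \<alpha> C]]
  have \<beta>: "\<beta> < \<alpha>" using E(1) less.prems by blast
  note coherent = coherent_levelD[OF below[OF \<beta>]]
  have pick: "pick Lev g u \<beta> \<in> Lev \<beta>" for u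
    by (rule pick_in_level(1)[OF coherent(1)])
  consider (first) "E \<inter> {..<\<beta>} = {}" | (consecutive) \<gamma> where "consecutive_in E \<gamma> \<beta>"
    | (limit) "unbounded_in \<beta> E"
    using ex_consecutive_predecessor[of \<beta> E] E(3) less.prems \<beta>
    unfolding closed_below_def by (meson order.strict_trans)
  then show ?case
  proof cases
    case first
    then show ?thesis using pick by (simp add: branch.simps[of Lev E g \<beta>])
  next
    case consecutive
    then show ?thesis
      using coherent(4)[OF pick] less.IH consecutive_inD(1,3)[OF consecutive]
      by (simp add: branch_consecutive)
  next
    case limit
    have "glue (branch Lev E g ` (E \<inter> {..<\<beta>})) \<in> Lev \<beta>" (is "?u \<in> _")
      using less.IH by (intro glue_branch_in_level[OF \<alpha> C below less.prems limit]) auto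
    then have "pick Lev g ?u \<beta> ++ ?u = ?u"
      by (intro map_add_dom_subset) (simp add: coherent(2) pick)
    then show ?thesis using \<open>?u \<in> Lev \<beta>\<close> by (simp add: branch.simps[of Lev E g \<beta>])
  qed
qed

lemma limit_branch_cofinal:
  assumes \<alpha>: "\<alpha> < \<kappa>" "is_limit \<alpha>" and C: "(E, g) \<in> Cs \<alpha>"
    and below: "\<And>\<gamma>. \<gamma> < \<alpha> \<Longrightarrow> coherent_level \<gamma>"
  shows "limit_branch Lev E g \<in> cofinal_branches Lev \<alpha>"
  unfolding limit_branch_def
proof (rule glue_in_cofinal_branches[where l = "\<lambda>\<gamma>. \<gamma>"])
  note E = club_belowD[OF Cs_club[OF \<alpha> C]]
  show "\<gamma> < \<alpha>" if "\<gamma> \<in> E" for \<gamma> using E(1) that by blast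
  show "\<exists>\<gamma>\<in>E. \<xi> < \<gamma>" if "\<xi> < \<alpha>" for \<xi> using unbounded_inD[OF E(2) that] by blast
qed (auto intro: below branch_in_level[OF \<alpha> C below] map_chain_image[OF monotone_branch])

lemma coherent_level_succ:
  assumes \<alpha>: "\<alpha> < \<kappa>" "is_succ \<beta> \<alpha>" and below: "\<And>\<gamma>. \<gamma> < \<alpha> \<Longrightarrow> coherent_level \<gamma>"
  shows "coherent_level \<alpha>"
  unfolding coherent_level_def
proof (intro conjI subsetI ballI allI impI)
  note Lev_\<alpha> = Lev_succ[OF \<alpha>] and coherent = coherent_levelD[OF below[OF is_succ_less[OF \<alpha>(2)]]]
  have "\<beta> < \<kappa>" using is_succ_less[OF \<alpha>(2)] \<alpha>(1) by simp
  then obtain i where "i < w \<beta>" using two_less_w by blast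
  with coherent(1) show "Lev \<alpha> \<noteq> {}" unfolding Lev_\<alpha> by blast
  fix s assume "s \<in> Lev \<alpha>"
  then obtain t i where s: "s = t(\<beta> \<mapsto> i)" and t: "t \<in> Lev \<beta>" "i < w \<beta>" unfolding Lev_\<alpha> by blast
  show "s \<in> cofinal_branches Lev \<alpha>"
  proof (rule cofinal_branchesI)
    show "dom s = {..<\<alpha>}" using coherent(2)[OF t(1)] by (simp add: s is_succ_lessThan[OF \<alpha>(2)])
    fix \<xi> assume "\<xi> < \<alpha>"
    then have "\<xi> \<le> \<beta>" by (simp add: is_succ_iff[OF \<alpha>(2)])
    then have "\<beta> \<notin> {..<\<xi>}" by simp
    then have "s |` {..<\<xi>} = t |` {..<\<xi>}" unfolding s by (simp only: restrict_fun_upd if_False)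
    then show "s |` {..<\<xi>} \<in> Lev \<xi>" using coherent(3)[OF t(1) \<open>\<xi> \<le> \<beta>\<close>] by simp
  qed
  fix \<xi> x assume \<xi>: "\<xi> < \<alpha>" and x: "x \<in> Lev \<xi>"
  then have "\<xi> \<le> \<beta>" by (simp add: is_succ_iff[OF \<alpha>(2)])
  have dom_x: "dom x = {..<\<xi>}" by (rule coherent_levelD(2)[OF below[OF \<xi>] x])
  have "t ++ x \<in> Lev \<beta>"
  proof (cases "\<xi> = \<beta>")
    case True
    then show ?thesis using map_add_dom_subset[of t x] coherent(2)[OF t(1)] dom_x x by simp
  next
    case False
    then show ?thesis using coherent(4)[OF t(1) _ x] \<open>\<xi> \<le> \<beta>\<close> by simp
  qed
  moreover have "s ++ x = (t ++ x)(\<beta> \<mapsto> i)"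
    unfolding s using \<open>\<xi> \<le> \<beta>\<close> dom_x by (intro map_add_upd_left) auto
  ultimately show "s ++ x \<in> Lev \<alpha>" unfolding Lev_\<alpha> using t(2) by blast
qed

lemma coherent_level_small_cof:
  assumes \<alpha>: "\<alpha> < \<kappa>" "\<nexists>\<beta>. is_succ \<beta> \<alpha>" "cof_less \<chi> \<alpha>"
    and below: "\<And>\<gamma>. \<gamma> < \<alpha> \<Longrightarrow> coherent_level \<gamma>"
  shows "coherent_level \<alpha>"
proof -
  have "cofinal_branches Lev \<alpha> \<noteq> {}"
  proof (cases \<alpha> rule: zero_succ_limit_cases)
    case zero
    then have "Map.empty \<in> cofinal_branches Lev \<alpha>" by (intro cofinal_branchesI) auto
    then show ?thesis by blast
  next
    case limit
    then obtain E g where "(E, g) \<in> Cs \<alpha>" using Cs_nonempty[OF \<alpha>(1)] by fast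
    then show ?thesis using limit_branch_cofinal[OF \<alpha>(1) limit _ below] by blast
  qed (use \<alpha>(2) in blast)
  then show ?thesis
    unfolding coherent_level_def Lev_small_cof[OF \<alpha>]
    using cofinal_branches_graft[OF below] by blast
qed

lemma coherent_level_large_cof:
  assumes \<alpha>: "\<alpha> < \<kappa>" "\<not> cof_less \<chi> \<alpha>" and below: "\<And>\<gamma>. \<gamma> < \<alpha> \<Longrightarrow> coherent_level \<gamma>"
  shows "coherent_level \<alpha>"
  unfolding coherent_level_def
proof (intro conjI subsetI ballI allI impI)
  note Lev_\<alpha> = Lev_large_cof[OF \<alpha>] and limit = large_cof_is_limit[OF \<alpha>(2)]
  obtain \<xi> where "\<xi> < \<alpha>" using limit unfolding unbounded_in_def by blast
  moreover have "Lev \<xi> \<noteq> {}" by (rule coherent_levelD(1)[OF below[OF \<open>\<xi> < \<alpha>\<close>]])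
  moreover obtain E g where "(E, g) \<in> Cs \<alpha>" using Cs_nonempty[OF \<alpha>(1) limit] by fast
  ultimately show "Lev \<alpha> \<noteq> {}" unfolding Lev_\<alpha> by blast
  fix s assume "s \<in> Lev \<alpha>"
  then obtain E g x \<xi> where s: "s = limit_branch Lev E g ++ x" and C: "(E, g) \<in> Cs \<alpha>"
      and x: "\<xi> < \<alpha>" "x \<in> Lev \<xi>"
    unfolding Lev_\<alpha> by blast
  show "s \<in> cofinal_branches Lev \<alpha>"
    unfolding s
    by (rule cofinal_branches_graft[OF below limit_branch_cofinal[OF \<alpha>(1) limit C below] x])
  fix \<eta> y assume y: "\<eta> < \<alpha>" "y \<in> Lev \<eta>"
  have "x ++ y \<in> (\<Union>\<zeta>\<in>{..<\<alpha>}. Lev \<zeta>)"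
  proof (cases "\<xi> \<le> \<eta>")
    case True
    then have "x ++ y = y"
      using coherent_levelD(2)[OF below[OF x(1)] x(2)] coherent_levelD(2)[OF below[OF y(1)] y(2)]
      by (intro map_add_dom_subset) simp
    then show ?thesis using y by auto
  next
    case False
    then show ?thesis using coherent_levelD(4)[OF below[OF x(1)] x(2) _ y(2)] x(1) by fastforce
  qed
  moreover have "s ++ y = limit_branch Lev E g ++ (x ++ y)" by (simp add: s)
  ultimately show "s ++ y \<in> Lev \<alpha>" unfolding Lev_\<alpha> using C by blast
qed

lemma coherent_level: "\<alpha> < \<kappa> \<Longrightarrow> coherent_level \<alpha>"
proof (induction \<alpha> rule: less_induct)
  case (less \<alpha>)
  have below: "coherent_level \<gamma>" if "\<gamma> < \<alpha>" for \<gamma> using less that by auto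
  show ?case
  proof (cases \<alpha> rule: level_cases)
    case succ
    then show ?thesis by (rule coherent_level_succ[OF less.prems _ below])
  next
    case small_cof
    then show ?thesis by (rule coherent_level_small_cof[OF less.prems _ _ below])
  next
    case large_cof
    show ?thesis using large_cof(2) by (rule coherent_level_large_cof[OF less.prems _ below])
  qed
qed

lemmas Lev_nonempty = coherent_levelD(1)[OF coherent_level]
  and Lev_dom = coherent_levelD(2)[OF coherent_level]
  and Lev_restrict = coherent_levelD(3)[OF coherent_level]
  and Lev_graft = coherent_levelD(4)[OF coherent_level]

lemma Lev_extend:
  assumes "x \<in> Lev \<xi>" "\<xi> \<le> \<alpha>" "\<alpha> < \<kappa>"
  shows "\<exists>y\<in>Lev \<alpha>. x \<subseteq>\<^sub>m y"
proof (cases "\<xi> = \<alpha>")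
  case True
  then show ?thesis using assms(1) by (intro bexI[of _ x]) simp_all
next
  case False
  obtain y where "y \<in> Lev \<alpha>" using Lev_nonempty[OF assms(3)] by blast
  moreover have "\<xi> < \<alpha>" using assms(2) False by simp
  ultimately have "y ++ x \<in> Lev \<alpha>" using Lev_graft assms(1,3) by blast
  then show ?thesis using map_le_map_add by blast
qed

lemma Lev_map_leD:
  assumes "x \<in> Lev \<xi>" "y \<in> Lev \<alpha>" "\<xi> < \<kappa>" "\<alpha> < \<kappa>" "x \<subseteq>\<^sub>m y"
  shows "\<xi> \<le> \<alpha>" "y |` {..<\<xi>} = x"
proof -
  have "dom x = {..<\<xi>}" "dom y = {..<\<alpha>}" using Lev_dom assms(1-4) by blast+
  then show "\<xi> \<le> \<alpha>" "y |` {..<\<xi>} = x"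
    using map_le_implies_dom_le[OF assms(5)] map_le_restrict[OF assms(5)] by simp_all
qed

lemma Lev_disjoint: "\<lbrakk>t \<in> Lev \<alpha>; t \<in> Lev \<beta>; \<alpha> < \<kappa>; \<beta> < \<kappa>\<rbrakk> \<Longrightarrow> \<alpha> = \<beta>"
  using Lev_map_leD(1)[of t \<alpha> t \<beta>] Lev_map_leD(1)[of t \<beta> t \<alpha>] by simp

lemma Lev_succI:
  assumes "\<alpha> < \<kappa>" "t \<in> Lev \<alpha>" "i < w \<alpha>"
  shows "\<exists>\<beta><\<kappa>. is_succ \<alpha> \<beta> \<and> t(\<alpha> \<mapsto> i) \<in> Lev \<beta>"
  using ex_is_succ_below[OF assms(1)] assms(2,3) Lev_succ by blast

lemma Lev_value_less:
  assumes "\<alpha> < \<kappa>" "t \<in> Lev \<alpha>" "t x = Some y"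
  shows "y < w x"
proof -
  have "x < \<alpha>" using Lev_dom[OF assms(1,2)] assms(3) by blast
  then obtain \<gamma> where \<gamma>: "\<gamma> \<le> \<alpha>" "is_succ x \<gamma>" using ex_is_succ by blast
  then have "\<gamma> < \<kappa>" using assms(1) by simp
  have "t |` {..<\<gamma>} \<in> Lev \<gamma>" by (rule Lev_restrict[OF assms(1,2) \<gamma>(1)])
  then obtain s i where "t |` {..<\<gamma>} = s(x \<mapsto> i)" "i < w x"
    unfolding Lev_succ[OF \<open>\<gamma> < \<kappa>\<close> \<gamma>(2)] by blast
  moreover have "(t |` {..<\<gamma>}) x = Some y" using assms(3) is_succ_less[OF \<gamma>(2)] by simp
  ultimately show ?thesis by simp
qed

lemma card_Lev_less: "\<alpha> < \<kappa> \<Longrightarrow> |Lev \<alpha>| <o |{..<\<kappa>}|"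
proof (induction \<alpha> rule: less_induct)
  case (less \<alpha>)
  have below: "|\<Union>\<xi>\<in>{..<\<alpha>}. Lev \<xi>| <o |{..<\<kappa>}|"
    using less by (intro stable_UNION[OF stable] initial) auto
  show ?case
  proof (cases \<alpha> rule: level_cases)
    case (succ \<beta>)
    then have \<beta>: "\<beta> < \<alpha>" "\<beta> < \<kappa>" using is_succ_less[OF succ] less.prems by auto
    show ?thesis
      using card_image2_less[OF less.IH[OF \<beta>] initial[OF w_less[OF \<beta>(2)]]]
      unfolding Lev_succ[OF less.prems succ] by simp
  next
    case small_cof
    then obtain \<eta> f where "\<eta> < \<chi>" "cofinal_map \<eta> \<alpha> f" unfolding cof_less_def by blast
    then show ?thesis
      unfolding Lev_small_cof[OF less.prems small_cof]
      using card_cofinal_branches[OF small_cof(1)] cexp_card_less[OF _ below] ordLeq_ordLess_trans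
      by blast
  next
    case large_cof
    have "|{limit_branch Lev (fst C) (snd C) ++ x |C x. C \<in> Cs \<alpha> \<and> x \<in> (\<Union>\<xi>\<in>{..<\<alpha>}. Lev \<xi>)}|
       <o |{..<\<kappa>}|"
      using card_Cs_less[OF less.prems large_cof_is_limit[OF large_cof(2)]] below
      by (rule card_image2_less)
    moreover have "Lev \<alpha> \<subseteq>
        {limit_branch Lev (fst C) (snd C) ++ x |C x. C \<in> Cs \<alpha> \<and> x \<in> (\<Union>\<xi>\<in>{..<\<alpha>}. Lev \<xi>)}"
      unfolding Lev_large_cof[OF less.prems large_cof(2)] by force
    ultimately show ?thesis using card_of_mono1 ordLeq_ordLess_trans by blast
  qed
qed

lemma card_Union_Lev_less: "\<alpha> < \<kappa> \<Longrightarrow> |\<Union>\<xi>\<in>{..<\<alpha>}. Lev \<xi>| <o |{..<\<kappa>}|"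
  by (intro stable_UNION[OF stable] initial card_Lev_less) auto

definition tree :: "('o \<rightharpoonup> 'o) set" where
  "tree = (\<Union>\<xi>\<in>{..<\<kappa>}. Lev \<xi>)"

lemma tree_iff: "t \<in> tree \<longleftrightarrow> (\<exists>\<xi><\<kappa>. t \<in> Lev \<xi>)"
  unfolding tree_def by blast

subsection \<open>Sealing predense sets of nodes\<close>

lemma bij_betw_pairing: "bij_betw pairing {..<\<kappa>} ({..<\<kappa>} \<times> {..<\<kappa>})"
proof -
  have "|{..<\<kappa>}| =o |{..<\<kappa>} \<times> {..<\<kappa>}|"
    by (rule ordIso_symmetric[OF card_of_Times_same_infinite[OF infinite_lessThan]])
  then show ?thesis unfolding pairing_def card_of_ordIso[symmetric] by (rule someI_ex)
qed

lemma pairing_less: "i < \<kappa> \<Longrightarrow> height i < \<kappa> \<and> snd (pairing i) < \<kappa>"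
  using bij_betwE[OF bij_betw_pairing] by (auto simp: mem_Times_iff)

lemma enumeration_Lev:
  assumes "\<xi> < \<kappa>"
  shows "(SOME e. e ` {..<\<kappa>} = Lev \<xi>) ` {..<\<kappa>} = Lev \<xi>"
proof -
  have "\<exists>e. e ` {..<\<kappa>} = Lev \<xi>"
    using card_of_ordLeq2[OF Lev_nonempty] ordLess_imp_ordLeq[OF card_Lev_less] assms by blast
  then show ?thesis by (rule someI_ex)
qed

lemma node_in_level: "i < \<kappa> \<Longrightarrow> node Lev i \<in> Lev (height i)"
  unfolding node_def using enumeration_Lev[of "height i"] pairing_less[of i] by blast

lemma node_height: "\<lbrakk>i < \<kappa>; \<xi> < \<kappa>; node Lev i \<in> Lev \<xi>\<rbrakk> \<Longrightarrow> height i = \<xi>"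
  using Lev_disjoint node_in_level pairing_less by blast

lemma ex_node:
  assumes "x \<in> tree" shows "\<exists>i<\<kappa>. node Lev i = x"
proof -
  obtain \<xi> where \<xi>: "\<xi> < \<kappa>" "x \<in> Lev \<xi>" using assms unfolding tree_iff by blast
  then have "x \<in> (SOME e. e ` {..<\<kappa>} = Lev \<xi>) ` {..<\<kappa>}" by (simp only: enumeration_Lev)
  then obtain \<zeta> where \<zeta>: "\<zeta> < \<kappa>" "(SOME e. e ` {..<\<kappa>} = Lev \<xi>) \<zeta> = x" by auto
  obtain i where "i < \<kappa>" "pairing i = (\<xi>, \<zeta>)"
    using bij_betw_imp_surj_on[OF bij_betw_pairing] \<xi>(1) \<zeta>(1)
    by (metis (no_types, lifting) imageE lessThan_iff mem_Sigma_iff)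
  then show ?thesis using \<zeta>(2) by (intro exI[of _ i]) (simp add: node_def)
qed

definition predense :: "('o \<rightharpoonup> 'o) set \<Rightarrow> bool" where
  "predense X \<longleftrightarrow> (\<forall>x\<in>tree. \<exists>y\<in>tree. x \<subseteq>\<^sub>m y \<and> (\<exists>z\<in>X. z \<subseteq>\<^sub>m y))"

definition indices :: "('o \<rightharpoonup> 'o) set \<Rightarrow> 'o set" where
  "indices X = {j. j < \<kappa> \<and> node Lev j \<in> X}"

definition captures :: "('o \<rightharpoonup> 'o) set \<Rightarrow> 'o \<Rightarrow> 'o \<Rightarrow> bool" where
  "captures X \<xi> \<epsilon> \<longleftrightarrow> (\<forall>x\<in>Lev \<xi>. (\<exists>i<\<epsilon>. node Lev i = x) \<and>
    (\<exists>\<zeta><\<epsilon>. \<exists>y\<in>Lev \<zeta>. x \<subseteq>\<^sub>m y \<and> (\<exists>j\<in>indices X \<inter> {..<\<epsilon>}. node Lev j \<subseteq>\<^sub>m y)))"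

lemma ex_captures:
  assumes X: "X \<subseteq> tree" "predense X" and "\<xi> < \<kappa>"
  shows "\<exists>\<epsilon><\<kappa>. captures X \<xi> \<epsilon>"
proof -
  have "\<exists>i \<zeta> y j. i < \<kappa> \<and> \<zeta> < \<kappa> \<and> node Lev i = x \<and> y \<in> Lev \<zeta> \<and> x \<subseteq>\<^sub>m y \<and>
      j \<in> indices X \<and> node Lev j \<subseteq>\<^sub>m y" if x: "x \<in> Lev \<xi>" for x
  proof -
    have "x \<in> tree" using \<open>\<xi> < \<kappa>\<close> x unfolding tree_iff by blast
    then obtain y z where y: "y \<in> tree" "x \<subseteq>\<^sub>m y" and z: "z \<in> X" "z \<subseteq>\<^sub>m y"
      using X(2) unfolding predense_def by blast
    obtain i where "i < \<kappa>" "node Lev i = x" using ex_node[OF \<open>x \<in> tree\<close>] by blast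
    moreover obtain j where "j < \<kappa>" "node Lev j = z" using ex_node z(1) X(1) by blast
    moreover obtain \<zeta> where "\<zeta> < \<kappa>" "y \<in> Lev \<zeta>" using y(1) unfolding tree_iff by blast
    ultimately show ?thesis using y(2) z unfolding indices_def by blast
  qed
  then obtain i \<zeta> y j where witness: "\<And>x. x \<in> Lev \<xi> \<Longrightarrow> i x < \<kappa> \<and> \<zeta> x < \<kappa> \<and> node Lev (i x) = x \<and>
      y x \<in> Lev (\<zeta> x) \<and> x \<subseteq>\<^sub>m y x \<and> j x \<in> indices X \<and> node Lev (j x) \<subseteq>\<^sub>m y x"
    by metis
  then have "max (i x) (max (\<zeta> x) (j x)) < \<kappa>" if "x \<in> Lev \<xi>" for x
    using that by (simp add: indices_def)
  then obtain \<epsilon> where \<epsilon>: "\<epsilon> < \<kappa>" "\<And>x. x \<in> Lev \<xi> \<Longrightarrow> max (i x) (max (\<zeta> x) (j x)) < \<epsilon>"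
    using ex_upper_bound[OF card_Lev_less[OF \<open>\<xi> < \<kappa>\<close>], of "\<lambda>x. max (i x) (max (\<zeta> x) (j x))"]
    by blast
  have "captures X \<xi> \<epsilon>" unfolding captures_def
  proof
    fix x assume "x \<in> Lev \<xi>"
    then show "(\<exists>i<\<epsilon>. node Lev i = x) \<and>
        (\<exists>\<zeta><\<epsilon>. \<exists>y\<in>Lev \<zeta>. x \<subseteq>\<^sub>m y \<and> (\<exists>j\<in>indices X \<inter> {..<\<epsilon>}. node Lev j \<subseteq>\<^sub>m y))"
      using witness[of x] \<epsilon>(2)[of x] by (metis IntI lessThan_iff max_less_iff_conj)
  qed
  with \<epsilon>(1) show ?thesis by blast
qed

lemma pick_seals:
  assumes \<beta>: "\<beta> \<in> closure_points (captures X)" "\<beta> < \<kappa>" "\<xi> < \<gamma>" "\<gamma> < \<beta>"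
    and u: "u \<in> Lev \<gamma>" and x: "idx \<beta> < \<kappa>" "node Lev (idx \<beta>) \<in> Lev \<xi>"
    and g: "g \<beta> = indices X \<inter> {..<\<beta>}"
  shows "seals Lev g u \<beta> (pick Lev g u \<beta>)"
proof -
  have "\<gamma> < \<kappa>" "\<xi> < \<kappa>" using \<beta> by simp_all
  have "u ++ node Lev (idx \<beta>) \<in> Lev \<gamma>" using \<open>\<gamma> < \<kappa>\<close> u \<beta>(3) x(2) by (rule Lev_graft)
  moreover obtain \<epsilon> where \<epsilon>: "\<epsilon> < \<beta>" "captures X \<gamma> \<epsilon>" using closure_pointsD[OF \<beta>(1,4)] by blast
  ultimately obtain \<zeta> y j where y: "\<zeta> < \<epsilon>" "y \<in> Lev \<zeta>" "u ++ node Lev (idx \<beta>) \<subseteq>\<^sub>m y"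
      and j: "j \<in> indices X" "j < \<epsilon>" "node Lev j \<subseteq>\<^sub>m y"
    unfolding captures_def by blast
  have \<zeta>: "\<zeta> < \<beta>" "\<zeta> < \<kappa>" and "j < \<kappa>" using y(1) \<epsilon>(1) j(2) \<beta>(2) by simp_all
  obtain t where t: "t \<in> Lev \<beta>" "y \<subseteq>\<^sub>m t"
    using Lev_extend[OF y(2) order.strict_implies_order[OF \<zeta>(1)] \<beta>(2)] by blast
  have "height j \<le> \<zeta>"
    using Lev_map_leD(1)[OF node_in_level y(2) _ \<zeta>(2) j(3)] pairing_less \<open>j < \<kappa>\<close> by blast
  then have "height j < \<beta>" using \<zeta>(1) by simp
  moreover have "height (idx \<beta>) < \<beta>"
    using node_height[OF x(1) \<open>\<xi> < \<kappa>\<close> x(2)] \<beta>(3,4) by simp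
  moreover have "j \<in> g \<beta>" using j(1,2) \<epsilon>(1) g by simp
  moreover have "node Lev j \<subseteq>\<^sub>m t" "u ++ node Lev (idx \<beta>) \<subseteq>\<^sub>m t"
    using j(3) y(3) t(2) map_le_trans by blast+
  ultimately have "seals Lev g u \<beta> t" unfolding seals_def by blast
  then show ?thesis by (rule pick_in_level(2)[OF Lev_nonempty[OF \<beta>(2)] t(1)])
qed

lemma seals_limit_branch:
  assumes "consecutive_in E \<gamma> \<beta>" "u = branch Lev E g \<gamma>" "seals Lev g u \<beta> (pick Lev g u \<beta>)"
  shows "\<exists>j\<in>g \<beta>. height j < \<beta> \<and> node Lev j \<subseteq>\<^sub>m limit_branch Lev E g ++ node Lev (idx \<beta>)"
proof -
  let ?p = "pick Lev g u \<beta>" and ?x = "node Lev (idx \<beta>)"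
  obtain j where j: "j \<in> g \<beta>" "height j < \<beta>" "node Lev j \<subseteq>\<^sub>m ?p" and x: "u ++ ?x \<subseteq>\<^sub>m ?p"
    using assms(3) unfolding seals_def by blast
  have "?p ++ u \<subseteq>\<^sub>m limit_branch Lev E g"
    using branch_le_limit_branch[OF consecutive_inD(2)[OF assms(1)], of Lev g]
    by (simp add: branch_consecutive[OF assms(1)] assms(2))
  then have "(?p ++ u) ++ ?x \<subseteq>\<^sub>m limit_branch Lev E g ++ ?x" by (rule map_add_mono_left)
  moreover have "(?p ++ u) ++ ?x = ?p" using map_add_subsumed2[OF x] by simp
  ultimately have "node Lev j \<subseteq>\<^sub>m limit_branch Lev E g ++ ?x"
    using map_le_trans[OF j(3)] by simp
  then show ?thesis using j(1,2) by blast
qed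

lemma limit_branch_meets:
  assumes \<alpha>: "\<alpha> < \<kappa>" "is_limit \<alpha>" and C: "(E, g) \<in> Cs \<alpha>" and consec: "consecutive_in E \<gamma> \<beta>"
    and \<beta>: "\<beta> \<in> closure_points (captures X)" "g \<beta> = indices X \<inter> {..<\<beta>}"
    and x: "idx \<beta> < \<kappa>" "node Lev (idx \<beta>) \<in> Lev \<xi>" "\<xi> < \<gamma>"
    and t: "t = limit_branch Lev E g ++ node Lev (idx \<beta>)" "t \<in> Lev \<alpha>"
  shows "\<exists>\<zeta><\<alpha>. t |` {..<\<zeta>} \<in> X"
proof -
  have "\<beta> < \<alpha>" using club_belowD(1)[OF Cs_club[OF \<alpha> C]] consecutive_inD(2)[OF consec] by blast
  then have "\<beta> < \<kappa>" using \<alpha>(1) by simp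
  have "branch Lev E g \<gamma> \<in> Lev \<gamma>"
    using branch_in_level[OF \<alpha> C _ consecutive_inD(1)[OF consec]] coherent_level \<alpha>(1)
    by (meson order.strict_trans)
  then have "seals Lev g (branch Lev E g \<gamma>) \<beta> (pick Lev g (branch Lev E g \<gamma>) \<beta>)"
    using pick_seals[OF \<beta>(1) \<open>\<beta> < \<kappa>\<close> x(3) consecutive_inD(3)[OF consec]] x(1,2) \<beta>(2) by blast
  then obtain j where j: "j \<in> indices X" "height j < \<beta>" "node Lev j \<subseteq>\<^sub>m t"
    using seals_limit_branch[OF consec refl] \<beta>(2) t(1) by blast
  then have "t |` {..<height j} = node Lev j" and "node Lev j \<in> X"
    using Lev_map_leD(2)[OF node_in_level t(2) _ \<alpha>(1)] pairing_less by (auto simp: indices_def)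
  moreover have "height j < \<alpha>" using j(2) \<open>\<beta> < \<alpha>\<close> by simp
  ultimately show ?thesis by metis
qed

lemma ex_sealed_level:
  assumes X: "X \<subseteq> tree" "predense X"
  shows "\<exists>\<alpha><\<kappa>. \<forall>t\<in>Lev \<alpha>. \<exists>\<zeta><\<alpha>. t |` {..<\<zeta>} \<in> X"
proof -
  let ?D = "closure_points (captures X)"
  have "club_below \<kappa> ?D" by (rule club_closure_points[OF ex_captures[OF X]])
  then obtain \<alpha> where \<alpha>: "\<alpha> < \<kappa>" "\<not> cof_less \<chi> \<alpha>"
    and guess_\<alpha>: "\<And>E g i \<xi>. \<lbrakk>(E, g) \<in> Cs \<alpha>; i < \<alpha>; \<xi> < \<alpha>\<rbrakk> \<Longrightarrow> \<exists>\<gamma> \<beta>. consecutive_in E \<gamma> \<beta> \<and>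
      \<xi> < \<gamma> \<and> idx \<beta> = i \<and> \<beta> \<in> ?D \<and> g \<beta> = indices X \<inter> {..<\<beta>}"
    using guess[of ?D "indices X"] unfolding indices_def by fast
  note limit = large_cof_is_limit[OF \<alpha>(2)]
  have "\<exists>\<zeta><\<alpha>. t |` {..<\<zeta>} \<in> X" if t: "t \<in> Lev \<alpha>" for t
  proof -
    obtain E g x \<xi> where t_eq: "t = limit_branch Lev E g ++ x" and C: "(E, g) \<in> Cs \<alpha>"
        and x: "\<xi> < \<alpha>" "x \<in> Lev \<xi>"
      using t unfolding Lev_large_cof[OF \<alpha>] by blast
    have E: "\<beta> < \<alpha>" if "\<beta> \<in> E" for \<beta>
      using club_belowD(1)[OF Cs_club[OF \<alpha>(1) limit C]] that by blast
    obtain \<gamma>\<^sub>0 \<beta>\<^sub>0 where "consecutive_in E \<gamma>\<^sub>0 \<beta>\<^sub>0" "\<xi> < \<gamma>\<^sub>0" "\<beta>\<^sub>0 \<in> ?D"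
      using guess_\<alpha>[OF C x(1) x(1)] by blast
    then have \<beta>\<^sub>0: "\<xi> < \<beta>\<^sub>0" "\<beta>\<^sub>0 < \<alpha>" using E by (auto dest: consecutive_inD(2,3))
    obtain i where i: "i < \<beta>\<^sub>0" "node Lev i = x"
      using closure_pointsD[OF \<open>\<beta>\<^sub>0 \<in> ?D\<close> \<beta>\<^sub>0(1)] x(2) unfolding captures_def
      by (meson order.strict_trans)
    have "i < \<alpha>" "i < \<kappa>" using i(1) \<beta>\<^sub>0(2) \<alpha>(1) by simp_all
    obtain \<gamma> \<beta> where "consecutive_in E \<gamma> \<beta>" "\<xi> < \<gamma>" "idx \<beta> = i" "\<beta> \<in> ?D"
        "g \<beta> = indices X \<inter> {..<\<beta>}"
      using guess_\<alpha>[OF C \<open>i < \<alpha>\<close> x(1)] by blast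
    then show ?thesis
      using limit_branch_meets[OF \<alpha>(1) limit C] i(2) x(2) t_eq t \<open>i < \<kappa>\<close> by blast
  qed
  with \<alpha>(1) show ?thesis by blast
qed

subsection \<open>Antichains and chains\<close>

definition predense_completion :: "('o \<rightharpoonup> 'o) set \<Rightarrow> ('o \<rightharpoonup> 'o) set" where
  "predense_completion A = {x \<in> tree. x \<in> A \<or> (\<forall>a\<in>A. \<not> x \<subseteq>\<^sub>m a \<and> \<not> a \<subseteq>\<^sub>m x)}"

lemma predense_predense_completion:
  assumes "A \<subseteq> tree"
  shows "predense (predense_completion A)"
  unfolding predense_def
proof
  fix x assume "x \<in> tree"
  then consider (decided) "x \<in> predense_completion A"
    | (comparable) a where "a \<in> A" "x \<subseteq>\<^sub>m a \<or> a \<subseteq>\<^sub>m x"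
    unfolding predense_completion_def by blast
  then show "\<exists>y\<in>tree. x \<subseteq>\<^sub>m y \<and> (\<exists>z\<in>predense_completion A. z \<subseteq>\<^sub>m y)"
  proof cases
    case decided
    then show ?thesis using \<open>x \<in> tree\<close> map_le_refl by blast
  next
    case (comparable a)
    then have "a \<in> tree" "a \<in> predense_completion A"
      using assms unfolding predense_completion_def by auto
    then show ?thesis using comparable(2) \<open>x \<in> tree\<close> map_le_refl by blast
  qed
qed

theorem card_antichain_less:
  assumes "A \<subseteq> tree" and antichain: "\<And>s t. \<lbrakk>s \<in> A; t \<in> A; s \<subseteq>\<^sub>m t\<rbrakk> \<Longrightarrow> s = t"
  shows "|A| <o |{..<\<kappa>}|"
proof -
  have "predense_completion A \<subseteq> tree" unfolding predense_completion_def by blast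
  from ex_sealed_level[OF this predense_predense_completion[OF assms(1)]]
  obtain \<alpha> where \<alpha>: "\<alpha> < \<kappa>"
      and sealed: "\<And>t. t \<in> Lev \<alpha> \<Longrightarrow> \<exists>\<zeta><\<alpha>. t |` {..<\<zeta>} \<in> predense_completion A"
    by blast
  have "A \<subseteq> (\<Union>\<xi>\<in>{..<\<alpha>}. Lev \<xi>)"
  proof
    fix a assume "a \<in> A"
    then obtain \<xi> where a: "\<xi> < \<kappa>" "a \<in> Lev \<xi>" using assms(1) unfolding tree_def by blast
    have "\<xi> < \<alpha>"
    proof (rule ccontr)
      assume "\<not> \<xi> < \<alpha>"
      then have "a |` {..<\<alpha>} \<in> Lev \<alpha>" using Lev_restrict[OF a] by simp
      from sealed[OF this] obtain \<zeta> where "\<zeta> < \<alpha>"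
          and z: "a |` {..<\<alpha>} |` {..<\<zeta>} \<in> predense_completion A" (is "?z \<in> _")
        by blast
      have "?z \<subseteq>\<^sub>m a" by (rule map_le_trans[OF restrict_map_le restrict_map_le])
      then have "?z \<in> A" using z \<open>a \<in> A\<close> unfolding predense_completion_def by blast
      then have "?z = a" using \<open>a \<in> A\<close> \<open>?z \<subseteq>\<^sub>m a\<close> by (rule antichain)
      then have "dom a \<subseteq> {..<\<zeta>}" using dom_restrict[of "a |` {..<\<alpha>}" "{..<\<zeta>}"] by auto
      moreover have "\<zeta> \<in> dom a" using Lev_dom[OF a] \<open>\<zeta> < \<alpha>\<close> \<open>\<not> \<xi> < \<alpha>\<close> by simp
      ultimately show False by auto
    qed
    then show "a \<in> (\<Union>\<xi>\<in>{..<\<alpha>}. Lev \<xi>)" using a(2) by blast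
  qed
  then show ?thesis by (rule ordLeq_ordLess_trans[OF card_of_mono1 card_Union_Lev_less[OF \<alpha>]])
qed

lemma ex_succ_off_chain:
  assumes chain: "map_chain c" and s: "s \<in> Lev \<xi>" "\<xi> < \<kappa>"
  shows "\<exists>i. s(\<xi> \<mapsto> i) \<in> tree \<and> (\<forall>t\<in>c. \<not> s(\<xi> \<mapsto> i) \<subseteq>\<^sub>m t)"
proof -
  obtain a b where "a < b" "b < w \<xi>" using two_less_w[OF s(2)] by blast
  then have "a < w \<xi>" by simp
  then have "s(\<xi> \<mapsto> a) \<in> tree" "s(\<xi> \<mapsto> b) \<in> tree"
    unfolding tree_iff using Lev_succI[OF s(2,1)] \<open>b < w \<xi>\<close> by blast+
  moreover have False if t: "t \<in> c" "t' \<in> c" "s(\<xi> \<mapsto> a) \<subseteq>\<^sub>m t" "s(\<xi> \<mapsto> b) \<subseteq>\<^sub>m t'" for t t'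
  proof -
    have "t \<xi> = Some a" "t' \<xi> = Some b" using t(3,4) by (auto simp: map_le_def)
    then show False
      using chainD[OF chain t(1,2)] \<open>a < b\<close> unfolding map_le_def
      by (metis domI option.inject order.irrefl)
  qed
  ultimately show ?thesis by blast
qed

text \<open>A chain becomes an antichain of the same size when each of its nodes is replaced by an
  immediate successor off the chain.\<close>

theorem card_chain_less:
  assumes "c \<subseteq> tree" and chain: "map_chain c"
  shows "|c| <o |{..<\<kappa>}|"
proof -
  have "\<exists>\<xi> i. \<xi> < \<kappa> \<and> s \<in> Lev \<xi> \<and> s(\<xi> \<mapsto> i) \<in> tree \<and> (\<forall>t\<in>c. \<not> s(\<xi> \<mapsto> i) \<subseteq>\<^sub>m t)" if "s \<in> c" for s
    using ex_succ_off_chain[OF chain] that assms(1) by (meson subsetD tree_iff)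
  then obtain l i where l: "\<And>s. s \<in> c \<Longrightarrow> l s < \<kappa> \<and> s \<in> Lev (l s)"
      and off: "\<And>s. s \<in> c \<Longrightarrow> s(l s \<mapsto> i s) \<in> tree \<and> (\<forall>t\<in>c. \<not> s(l s \<mapsto> i s) \<subseteq>\<^sub>m t)"
    by metis
  define e where "e s = s(l s \<mapsto> i s)" for s
  have dom: "dom s = {..<l s}" if "s \<in> c" for s using Lev_dom l[OF that] by blast
  have e_le_imp_eq: "s = t" if st: "s \<in> c" "t \<in> c" and e_le: "e s \<subseteq>\<^sub>m e t" for s t
  proof -
    have "l s \<in> dom (e t)" using map_le_implies_dom_le[OF e_le] by (auto simp: e_def)
    then have "l s \<le> l t" by (auto simp: e_def dom[OF st(2)])
    have "l t \<in> dom (e s)"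
    proof (rule ccontr)
      assume "l t \<notin> dom (e s)"
      then have "e s \<subseteq>\<^sub>m t" using e_le map_le_fun_updD by (metis e_def)
      then show False using off[OF st(1)] st(2) unfolding e_def by blast
    qed
    then have "l t \<le> l s" by (auto simp: e_def dom[OF st(1)])
    with \<open>l s \<le> l t\<close> have "dom s = dom t" by (simp add: dom st)
    then show ?thesis using map_le_dom_eq map_chain_dom_subset[OF chain st] by blast
  qed
  then have "inj_on e c" by (intro inj_onI) simp
  then have "|c| \<le>o |e ` c|" using card_of_ordLeq by blast
  moreover have "|e ` c| <o |{..<\<kappa>}|"
    by (rule card_antichain_less) (use off e_le_imp_eq in \<open>auto simp: e_def\<close>)
  ultimately show ?thesis by (rule ordLeq_ordLess_trans)
qed

theorem glue_short_chain_in_tree: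
  assumes "\<eta> < \<chi>" and F: "\<And>\<zeta>. \<zeta> < \<eta> \<Longrightarrow> F \<zeta> \<in> tree" and mono: "monotone_on {..<\<eta>} (\<le>) (\<subseteq>\<^sub>m) F"
  shows "glue (F ` {..<\<eta>}) \<in> tree" (is "?u \<in> _")
proof -
  obtain l where l: "\<And>\<zeta>. \<zeta> < \<eta> \<Longrightarrow> l \<zeta> < \<kappa> \<and> F \<zeta> \<in> Lev (l \<zeta>)"
    using F unfolding tree_iff by metis
  have "\<eta> < \<kappa>" using assms(1) \<chi>_less by simp
  then obtain \<delta> where \<delta>: "\<delta> < \<kappa>" and upper: "\<And>\<zeta>. \<zeta> < \<eta> \<Longrightarrow> l \<zeta> \<le> \<delta>"
      and least: "\<And>\<xi>. \<xi> < \<delta> \<Longrightarrow> \<exists>\<zeta><\<eta>. \<xi> < l \<zeta>"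
    using ex_supremum[OF initial, of \<eta> l] l by (metis lessThan_iff)
  show ?thesis
  proof (cases "\<exists>\<zeta><\<eta>. l \<zeta> = \<delta>")
    case True
    then obtain \<zeta> where "\<zeta> < \<eta>" "l \<zeta> = \<delta>" by blast
    have dom: "dom (F \<xi>) = {..<l \<xi>}" if "\<xi> < \<eta>" for \<xi> using Lev_dom l[OF that] by blast
    have "?u = F \<zeta>"
    proof (rule glue_greatest[OF map_chain_image[OF mono]])
      fix t assume t: "t \<in> F ` {..<\<eta>}"
      then obtain \<xi> where "\<xi> < \<eta>" "t = F \<xi>" by blast
      then have "dom t \<subseteq> dom (F \<zeta>)" using upper \<open>l \<zeta> = \<delta>\<close> \<open>\<zeta> < \<eta>\<close> by (simp add: dom)
      then show "t \<subseteq>\<^sub>m F \<zeta>"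
        using t \<open>\<zeta> < \<eta>\<close> by (intro map_chain_dom_subset[OF map_chain_image[OF mono]]) auto
    qed (use \<open>\<zeta> < \<eta>\<close> in simp)
    then show ?thesis using F[OF \<open>\<zeta> < \<eta>\<close>] by simp
  next
    case False
    then have less: "l \<zeta> < \<delta>" if "\<zeta> < \<eta>" for \<zeta>
      using upper[OF that] that by (auto simp: order.order_iff_strict)
    have "cofinal_map \<eta> \<delta> l"
      unfolding cofinal_map_def using less by (auto dest!: least intro: order.strict_implies_order)
    then have "cof_less \<chi> \<delta>" unfolding cof_less_def using assms(1) by blast
    moreover have "\<nexists>\<beta>. is_succ \<beta> \<delta>" unfolding not_is_succ_iff using less least by blast
    moreover have "?u \<in> cofinal_branches Lev \<delta>"
    proof (rule glue_in_cofinal_branches[OF _ _ _ map_chain_image[OF mono]])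
      show "coherent_level \<gamma>" if "\<gamma> < \<delta>" for \<gamma> using that \<delta> by (intro coherent_level) simp
      show "\<exists>\<zeta>\<in>{..<\<eta>}. \<xi> < l \<zeta>" if "\<xi> < \<delta>" for \<xi> using least[OF that] by auto
    qed (use less l in auto)
    ultimately show ?thesis using Lev_small_cof[OF \<delta>] \<delta> tree_iff by blast
  qed
qed

end

section \<open>Sets, pairs and ordinals\<close>

abbreviation small :: "'a hset set \<Rightarrow> bool" where
  "small (A :: 'a hset set) \<equiv> |A| \<le>o |UNIV :: (nat + 'a) set|"

lemma infinite_bound: "infinite (UNIV :: (nat + 'a) set)"
  by (simp add: finite_Plus_UNIV_iff)

lemma small_subset: "A \<subseteq> B \<Longrightarrow> small B \<Longrightarrow> small A"
  using card_of_mono1 ordLeq_transitive by blast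

lemma small_elts: "small (elts x)"
  by (rule elts_bound)

lemma small_image: "|A| \<le>o |UNIV :: (nat + 'a) set| \<Longrightarrow> small (f ` A :: 'a hset set)"
  using card_of_image ordLeq_transitive by blast

lemma card_of_finite_bound: "finite A \<Longrightarrow> |A| \<le>o |UNIV :: (nat + 'a) set|"
  by (rule ordLess_imp_ordLeq[OF finite_ordLess_infinite[OF card_of_Well_order card_of_Well_order]])
    (simp_all add: Field_card_of infinite_bound)

lemma small_finite: "finite A \<Longrightarrow> small A"
  by (rule card_of_finite_bound)

lemma small_UN:
  fixes f :: "'b \<Rightarrow> 'a hset"
  assumes "|A| \<le>o |UNIV :: (nat + 'a) set|" shows "small (\<Union>x\<in>A. elts (f x))"
  by (rule card_of_UNION_ordLeq_infinite[OF infinite_bound assms]) (simp add: elts_bound)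

lemma elts_eqI: "elts x = elts y \<Longrightarrow> x = y"
  by (simp add: elts_inject)

lemma mk_elts: "mk (elts x) = x"
  by (rule elts_eqI) (simp add: elts_mk small_elts)

lemma mem_irrefl: "x \<notin> elts x"
  using wf_not_refl[OF wf_mem] by (auto simp: mem_rel_def)

lemma mem_asym: "x \<in> elts y \<Longrightarrow> y \<notin> elts x"
  using wf_not_sym[OF wf_mem] by (auto simp: mem_rel_def)

lemma mem_induct [case_names mem]: "(\<And>x. (\<And>y. y \<in> elts x \<Longrightarrow> P y) \<Longrightarrow> P x) \<Longrightarrow> P a"
  using wf_induct_rule[OF wf_mem, of P a] by (simp add: mem_rel_def)

lemma elts_zero: "elts zero = {}"
  unfolding zero_def by (simp add: elts_mk small_finite)

lemma elts_succ: "elts (succ x) = insert x (elts x)"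
  unfolding succ_def
proof (rule elts_mk)
  have "insert x (elts x) = (\<Union>y\<in>{x, mk {x}}. elts y)" by (auto simp: elts_mk small_finite)
  then show "small (insert x (elts x))"
    using small_UN[OF small_finite, of "{x, mk {x}}" "\<lambda>x. x"] by simp
qed

lemma pair_inject: "pair x y = pair x' y' \<longleftrightarrow> x = x' \<and> y = y'"
proof
  have elts_singleton: "elts (mk {a}) = {a}" and elts_doubleton: "elts (mk {a, b}) = {a, b}"
    for a b :: "'a hset"
    by (simp_all add: elts_mk small_finite)
  have mk_eq_iff: "mk {a} = mk {b, c} \<longleftrightarrow> b = a \<and> c = a" "mk {a} = mk {b} \<longleftrightarrow> a = b"
      "mk {a, d} = mk {b, c} \<longleftrightarrow> {a, d} = {b, c}" for a b c d :: "'a hset"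
    by (auto simp flip: elts_inject simp: elts_singleton elts_doubleton)
  assume "pair x y = pair x' y'"
  then have "{mk {x}, mk {x, y}} = {mk {x'}, mk {x', y'}}"
    unfolding pair_def by (simp flip: elts_inject add: elts_doubleton)
  then show "x = x' \<and> y = y'"
    by (auto simp: doubleton_eq_iff mk_eq_iff eq_commute[of "mk {_, _}" "mk {_}"])
qed simp

lemma Ord_mem: "Ord \<alpha> \<Longrightarrow> x \<in> elts \<alpha> \<Longrightarrow> Ord x"
  unfolding Ord_def by blast

lemma Ord_trans: "Ord \<alpha> \<Longrightarrow> x \<in> elts \<alpha> \<Longrightarrow> y \<in> elts x \<Longrightarrow> y \<in> elts \<alpha>"
  unfolding Ord_def by blast

lemma Ord_zero: "Ord zero"
  by (simp add: Ord_def elts_zero)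

lemma Ord_linear: "Ord \<alpha> \<Longrightarrow> Ord \<beta> \<Longrightarrow> \<alpha> \<in> elts \<beta> \<or> \<alpha> = \<beta> \<or> \<beta> \<in> elts \<alpha>"
proof (induction \<alpha> arbitrary: \<beta> rule: mem_induct)
  case \<alpha>: (mem \<alpha>)
  from \<open>Ord \<beta>\<close> show ?case
  proof (induction \<beta> rule: mem_induct)
    case \<beta>: (mem \<beta>)
    show ?case
    proof (rule ccontr)
      assume incomparable: "\<not> ?case"
      have "x \<in> elts \<beta>" if "x \<in> elts \<alpha>" for x
        using \<alpha>.IH[OF that Ord_mem[OF \<alpha>.prems(1) that] \<beta>.prems] incomparable that
          Ord_trans[OF \<alpha>.prems(1) that] by blast
      moreover have "x \<in> elts \<alpha>" if "x \<in> elts \<beta>" for x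
        using \<beta>.IH[OF that Ord_mem[OF \<beta>.prems that]] incomparable that
          Ord_trans[OF \<beta>.prems that] by blast
      ultimately have "\<alpha> = \<beta>" by (intro elts_eqI) blast
      with incomparable show False by blast
    qed
  qed
qed

lemma Ord_subset_iff: "Ord \<alpha> \<Longrightarrow> Ord \<beta> \<Longrightarrow> elts \<alpha> \<subseteq> elts \<beta> \<longleftrightarrow> \<alpha> \<in> elts \<beta> \<or> \<alpha> = \<beta>"
  using Ord_linear[of \<alpha> \<beta>] mem_irrefl Ord_trans[of \<beta> \<alpha>] by blast

typedef 'a ordinal = "{x :: 'a hset. Ord x}" morphisms hset_of Abs_ordinal
  using Ord_zero by blast

lemma Ord_hset_of: "Ord (hset_of a)"
  using hset_of by simp

lemma OrdE:
  assumes "Ord x" obtains a where "x = hset_of a"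
  using assms Abs_ordinal_inverse by (metis mem_Collect_eq)

instantiation ordinal :: (type) wellorder
begin

definition less_eq_ordinal :: "'a ordinal \<Rightarrow> 'a ordinal \<Rightarrow> bool" where
  "a \<le> b \<longleftrightarrow> elts (hset_of a) \<subseteq> elts (hset_of b)"

definition less_ordinal :: "'a ordinal \<Rightarrow> 'a ordinal \<Rightarrow> bool" where
  "a < b \<longleftrightarrow> hset_of a \<in> elts (hset_of b)"

instance
proof
  fix a b c :: "'a ordinal"
  have le_iff: "a \<le> b \<longleftrightarrow> a < b \<or> a = b" for a b :: "'a ordinal"
    unfolding less_eq_ordinal_def less_ordinal_def
    by (simp add: Ord_subset_iff[OF Ord_hset_of Ord_hset_of] hset_of_inject)
  show "a < b \<longleftrightarrow> a \<le> b \<and> \<not> b \<le> a"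
    unfolding le_iff using mem_irrefl mem_asym by (auto simp: less_ordinal_def)
  show "a \<le> a" by (simp add: less_eq_ordinal_def)
  show "a \<le> b \<Longrightarrow> b \<le> c \<Longrightarrow> a \<le> c" by (simp add: less_eq_ordinal_def)
  show "a \<le> b \<Longrightarrow> b \<le> a \<Longrightarrow> a = b"
    by (simp add: less_eq_ordinal_def set_eq_subset[symmetric] elts_inject hset_of_inject)
  show "a \<le> b \<or> b \<le> a"
    unfolding le_iff less_ordinal_def
    using Ord_linear[OF Ord_hset_of Ord_hset_of] hset_of_inject by blast
  fix P :: "'a ordinal \<Rightarrow> bool"
  assume step: "\<And>x. (\<And>y. y < x \<Longrightarrow> P y) \<Longrightarrow> P x"
  have "\<forall>a. hset_of a = x \<longrightarrow> P a" for x :: "'a hset"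
  proof (induction x rule: mem_induct)
    case (mem x)
    then show ?case using step unfolding less_ordinal_def by blast
  qed
  then show "P a" by blast
qed

end

lemma hset_of_image: "hset_of ` {..<a} = elts (hset_of a)"
proof
  show "elts (hset_of a) \<subseteq> hset_of ` {..<a}"
  proof
    fix x assume x: "x \<in> elts (hset_of a)"
    then obtain b where "x = hset_of b" using OrdE[OF Ord_mem[OF Ord_hset_of x]] by blast
    with x show "x \<in> hset_of ` {..<a}" unfolding less_ordinal_def lessThan_def by blast
  qed
qed (auto simp: less_ordinal_def)

lemma mem_hset_ofE:
  assumes "x \<in> elts (hset_of a)" obtains b where "b < a" "x = hset_of b"
  using assms unfolding hset_of_image[symmetric] by auto

lemma hset_of_mem [simp]: "hset_of b \<in> elts (hset_of a) \<longleftrightarrow> b < a"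
  by (simp add: less_ordinal_def)

lemma hset_of_subset [simp]: "elts (hset_of b) \<subseteq> elts (hset_of a) \<longleftrightarrow> b \<le> a"
  by (simp add: less_eq_ordinal_def)

lemma hset_of_eq [simp]: "hset_of b = hset_of a \<longleftrightarrow> b = a"
  by (rule hset_of_inject)

lemma hset_of_mem_image [simp]: "hset_of b \<in> hset_of ` E \<longleftrightarrow> b \<in> E"
  by (auto simp: hset_of_inject)

lemma inj_hset_of: "inj_on hset_of A"
  by (simp add: inj_on_def)

lemma hset_of_is_succ: "is_succ \<alpha> \<beta> \<Longrightarrow> hset_of \<beta> = succ (hset_of \<alpha>)"
  by (intro elts_eqI) (simp add: elts_succ is_succ_lessThan flip: hset_of_image)

lemma card_lessThan: "|{..<a}| =o |elts (hset_of a)|"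
proof -
  have "bij_betw hset_of {..<a} (elts (hset_of a))"
    unfolding bij_betw_def using inj_hset_of hset_of_image by blast
  then show ?thesis by (rule card_of_ordIsoI)
qed

lemma card_less_lessThan_iff: "|X| <o |{..<a}| \<longleftrightarrow> |X| <o |elts (hset_of a)|"
  using ordLess_ordIso_trans[OF _ card_lessThan]
    ordLess_ordIso_trans[OF _ ordIso_symmetric[OF card_lessThan]] by blast

lemma card_lessThan_bound: "|{..<a :: 'a ordinal}| \<le>o |UNIV :: (nat + 'a) set|"
  using card_lessThan small_elts ordIso_ordLeq_trans by blast

lemma zero_mem_iff: "zero \<in> elts (hset_of (a :: 'a ordinal)) \<longleftrightarrow> (\<exists>b. b < a)"
proof -
  obtain z :: "'a ordinal" where z: "zero = hset_of z" using Ord_zero by (rule OrdE)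
  have "z \<le> b" for b by (simp add: less_eq_ordinal_def elts_zero flip: z)
  then have "z < a \<longleftrightarrow> (\<exists>b. b < a)" using order.strict_trans1 by blast
  then show ?thesis by (simp add: z)
qed

lemma osup_eq_iff:
  assumes "E \<subseteq> {..<a}"
  shows "osup (hset_of ` E) = hset_of a \<longleftrightarrow> (\<forall>b<a. \<exists>c\<in>E. b < c)"
proof -
  have "hset_of ` E \<subseteq> elts (hset_of a)" using assms by auto
  then have "small (hset_of ` E)" by (rule small_subset[OF _ small_elts])
  then have "elts (osup (hset_of ` E)) = (\<Union>c\<in>E. elts (hset_of c))"
    unfolding osup_def using elts_mk[OF small_UN, of "hset_of ` E" "\<lambda>x. x"] by simp
  also have "\<dots> = hset_of ` (\<Union>c\<in>E. {..<c})" by (simp add: image_UN hset_of_image)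
  finally have "osup (hset_of ` E) = hset_of a \<longleftrightarrow> (\<Union>c\<in>E. {..<c}) = {..<a}"
    unfolding elts_inject[symmetric] hset_of_image[symmetric]
    by (simp add: inj_image_eq_iff[OF inj_hset_of])
  also have "\<dots> \<longleftrightarrow> {..<a} \<subseteq> (\<Union>c\<in>E. {..<c})"
    using assms by (auto intro: order.strict_trans)
  also have "\<dots> \<longleftrightarrow> (\<forall>b<a. \<exists>c\<in>E. b < c)" by auto
  finally show ?thesis .
qed

lemma ord_of_nat_less: "m < n \<Longrightarrow> ord_of_nat m \<in> elts (ord_of_nat n)"
  by (induction n) (auto simp: elts_succ less_Suc_eq)

lemma inj_ord_of_nat: "inj ord_of_nat"
  by (rule linorder_injI) (metis ord_of_nat_less mem_irrefl)

lemma elts_omega: "elts (omega :: 'a hset) = range ord_of_nat"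
  unfolding omega_def
proof (rule elts_mk, rule small_image)
  show "|UNIV :: nat set| \<le>o |UNIV :: (nat + 'a) set|"
    using infinite_bound infinite_iff_card_of_nat by blast
qed

lemma two_less_of_omega_subset:
  assumes "elts omega \<subseteq> elts (hset_of c)"
  shows "\<exists>a b. a < b \<and> b < c"
proof -
  have mem: "ord_of_nat n \<in> elts (hset_of c)" for n using assms elts_omega by blast
  obtain a where "a < c" "ord_of_nat 0 = hset_of a" using mem by (rule mem_hset_ofE)
  moreover obtain b where "b < c" "ord_of_nat 1 = hset_of b" using mem by (rule mem_hset_ofE)
  ultimately show ?thesis using ord_of_nat_less[of 0 1] by (metis hset_of_mem zero_less_one)
qed

section \<open>Order types\<close>

definition order_iso :: "'a hset \<Rightarrow> 'a hset set \<Rightarrow> ('a hset \<Rightarrow> 'a hset) \<Rightarrow> bool" where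
  "order_iso \<alpha> X f \<longleftrightarrow> bij_betw f (elts \<alpha>) X \<and>
     (\<forall>\<xi>\<in>elts \<alpha>. \<forall>\<eta>\<in>elts \<alpha>. \<xi> \<in> elts \<eta> \<longleftrightarrow> f \<xi> \<in> elts (f \<eta>))"

function collapse :: "'a hset set \<Rightarrow> 'a hset \<Rightarrow> 'a hset" where
  "collapse X x = mk (collapse X ` (X \<inter> elts x))"
  by pat_completeness auto
termination
  by (relation "inv_image mem_rel snd") (simp_all add: wf_mem, simp add: mem_rel_def)

declare collapse.simps [simp del]

lemma elts_collapse: "elts (collapse X x) = collapse X ` (X \<inter> elts x)"
  unfolding collapse.simps[of X x]
  by (rule elts_mk[OF small_image[OF small_subset[OF Int_lower2 small_elts]]])

lemma collapse_order_iso: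
  assumes "Ord \<alpha>" and f: "order_iso \<alpha> X f" and "\<xi> \<in> elts \<alpha>"
  shows "collapse X (f \<xi>) = \<xi>"
  using \<open>\<xi> \<in> elts \<alpha>\<close>
proof (induction \<xi> rule: mem_induct)
  case (mem \<xi>)
  note below = Ord_trans[OF \<open>Ord \<alpha>\<close> mem.prems]
  have "X \<inter> elts (f \<xi>) = f ` elts \<xi>"
  proof (intro set_eqI iffI)
    fix x assume x: "x \<in> X \<inter> elts (f \<xi>)"
    then obtain \<eta> where "\<eta> \<in> elts \<alpha>" "x = f \<eta>"
      using f unfolding order_iso_def bij_betw_def by blast
    then show "x \<in> f ` elts \<xi>" using x f mem.prems unfolding order_iso_def by blast
  next
    fix x assume "x \<in> f ` elts \<xi>"
    then obtain \<eta> where "\<eta> \<in> elts \<xi>" "\<eta> \<in> elts \<alpha>" "x = f \<eta>" using below by blast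
    then show "x \<in> X \<inter> elts (f \<xi>)"
      using f mem.prems unfolding order_iso_def bij_betw_def by blast
  qed
  then have "elts (collapse X (f \<xi>)) = (\<lambda>\<eta>. collapse X (f \<eta>)) ` elts \<xi>"
    by (simp add: elts_collapse image_image)
  also have "\<dots> = elts \<xi>" using mem.IH below by simp
  finally show ?case by (rule elts_eqI)
qed

lemma elts_order_iso:
  assumes "Ord \<alpha>" "order_iso \<alpha> X f"
  shows "elts \<alpha> = collapse X ` X"
proof -
  have "X = f ` elts \<alpha>" using assms(2) unfolding order_iso_def bij_betw_def by blast
  then show ?thesis using collapse_order_iso[OF assms] by (simp add: image_image)
qed

lemma otp_eqI:
  assumes "Ord \<alpha>" "order_iso \<alpha> X f"
  shows "otp X = \<alpha>"
  unfolding otp_def order_iso_def[symmetric]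
proof (rule the_equality)
  show "\<beta> = \<alpha>" if "Ord \<beta> \<and> (\<exists>f. order_iso \<beta> X f)" for \<beta>
    using that elts_order_iso[of \<beta> X] elts_order_iso[OF assms] by (auto intro: elts_eqI)
qed (use assms in blast)

lemma collapse_mem_iff:
  assumes Ord: "\<And>x. x \<in> X \<Longrightarrow> Ord x" and "x \<in> X" "y \<in> X"
  shows "collapse X x \<in> elts (collapse X y) \<longleftrightarrow> x \<in> elts y"
    and "collapse X x = collapse X y \<longleftrightarrow> x = y"
proof -
  have mono: "collapse X u \<in> elts (collapse X v)" if "u \<in> X" "u \<in> elts v" for u v
    using that by (auto simp: elts_collapse)
  consider "x \<in> elts y" | "x = y" | "y \<in> elts x"
    using Ord_linear[OF Ord Ord, OF assms(2,3)] by blast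
  then have "(collapse X x \<in> elts (collapse X y) \<longleftrightarrow> x \<in> elts y) \<and>
      (collapse X x = collapse X y \<longleftrightarrow> x = y)"
    using mono[OF assms(2), of y] mono[OF assms(3), of x] mem_asym[of x y] mem_irrefl
      mem_asym[of "collapse X x" "collapse X y"] by cases auto
  then show "collapse X x \<in> elts (collapse X y) \<longleftrightarrow> x \<in> elts y"
    and "collapse X x = collapse X y \<longleftrightarrow> x = y" by simp_all
qed

lemma otp_order_iso:
  fixes X :: "'a hset set"
  assumes Ord: "\<And>x. x \<in> X \<Longrightarrow> Ord x" and "small X"
  shows "Ord (otp X)" and "\<exists>f. order_iso (otp X) X f"
proof -
  define \<delta> where "\<delta> = mk (collapse X ` X)"
  have elts_\<delta>: "elts \<delta> = collapse X ` X"
    unfolding \<delta>_def by (rule elts_mk[OF small_image[OF \<open>small X\<close>]])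
  have "Ord \<delta>"
    unfolding Ord_def elts_\<delta>
  proof (intro conjI ballI)
    fix u assume "u \<in> collapse X ` X"
    then obtain x where x: "x \<in> X" "u = collapse X x" by blast
    show "elts u \<subseteq> collapse X ` X" unfolding x(2) elts_collapse by blast
    fix v assume "v \<in> elts u"
    then obtain y where y: "y \<in> X" "y \<in> elts x" "v = collapse X y"
      unfolding x(2) elts_collapse by blast
    show "elts v \<subseteq> elts u"
      unfolding x(2) y(3) elts_collapse using Ord_trans[OF Ord[OF x(1)] y(2)] by blast
  qed
  have bij: "bij_betw (collapse X) X (elts \<delta>)"
    unfolding bij_betw_def inj_on_def elts_\<delta> using collapse_mem_iff(2)[OF Ord] by blast
  have "order_iso \<delta> X (the_inv_into X (collapse X))"
    unfolding order_iso_def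
  proof (intro conjI ballI)
    show "bij_betw (the_inv_into X (collapse X)) (elts \<delta>) X"
      using bij by (rule bij_betw_the_inv_into)
    fix \<xi> \<eta> assume "\<xi> \<in> elts \<delta>" "\<eta> \<in> elts \<delta>"
    then obtain x y where "x \<in> X" "\<xi> = collapse X x" "y \<in> X" "\<eta> = collapse X y"
      unfolding elts_\<delta> by blast
    then show "\<xi> \<in> elts \<eta> \<longleftrightarrow>
        the_inv_into X (collapse X) \<xi> \<in> elts (the_inv_into X (collapse X) \<eta>)"
      using collapse_mem_iff(1)[OF Ord]
      by (simp add: the_inv_into_f_f[OF bij_betw_imp_inj_on[OF bij]])
  qed
  moreover from this have "otp X = \<delta>" by (rule otp_eqI[OF \<open>Ord \<delta>\<close>])
  ultimately show "Ord (otp X)" and "\<exists>f. order_iso (otp X) X f" using \<open>Ord \<delta>\<close> by blast+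
qed

lemma elts_one: "elts (ord_of_nat (Suc 0)) = {zero}"
  by (simp add: elts_succ elts_zero)

declare ord_of_nat.simps [simp del]

lemma Ord_one: "Ord (ord_of_nat (Suc 0))"
  by (simp add: Ord_def elts_one elts_zero)

lemma otp_eq_one_iff:
  fixes X :: "'a hset set"
  assumes "\<And>x. x \<in> X \<Longrightarrow> Ord x" and "small X"
  shows "otp X = ord_of_nat (Suc 0) \<longleftrightarrow> (\<exists>x. X = {x})"
proof
  assume "otp X = ord_of_nat (Suc 0)"
  then obtain f where "X = f ` {zero}"
    using otp_order_iso(2)[OF assms] unfolding order_iso_def bij_betw_def by (auto simp: elts_one)
  then show "\<exists>x. X = {x}" by blast
next
  assume "\<exists>x. X = {x}"
  then obtain x where "X = {x}" by blast
  then have "order_iso (ord_of_nat (Suc 0)) X (\<lambda>_. x)"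
    by (simp add: order_iso_def elts_one mem_irrefl)
  then show "otp X = ord_of_nat (Suc 0)"
    by (rule otp_eqI[OF Ord_one])
qed

lemma one_mem_otp:
  fixes X :: "'a hset set"
  assumes X: "\<And>x. x \<in> X \<Longrightarrow> Ord x" "small X" and xy: "x \<in> X" "y \<in> X" "x \<noteq> y"
  shows "ord_of_nat (Suc 0) \<in> elts (otp X)"
proof -
  have "otp X \<noteq> ord_of_nat (Suc 0)" using otp_eq_one_iff[OF X] xy by auto
  moreover have "otp X \<noteq> zero"
    using otp_order_iso(2)[OF X] xy(1) elts_zero unfolding order_iso_def bij_betw_def by force
  ultimately show ?thesis
    using Ord_linear[OF otp_order_iso(1)[OF X] Ord_one] by (auto simp: elts_one)
qed

lemma otp_image_eq_one_iff:
  assumes "E \<subseteq> {..<a}"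
  shows "otp (hset_of ` E) = ord_of_nat (Suc 0) \<longleftrightarrow> (\<exists>c. E = {c})"
proof -
  have "hset_of ` E \<subseteq> elts (hset_of a)" using assms by auto
  then have "otp (hset_of ` E) = ord_of_nat (Suc 0) \<longleftrightarrow> (\<exists>x. hset_of ` E = {x})"
    using Ord_hset_of by (intro otp_eq_one_iff small_subset[OF _ small_elts]) auto
  also have "\<dots> \<longleftrightarrow> (\<exists>c. E = {c})"
    using card_image[OF inj_hset_of, of E] by (simp flip: card_1_singleton_iff)
  finally show ?thesis .
qed

lemma hset_of_image_Int: "hset_of ` E \<inter> elts (hset_of a) = hset_of ` (E \<inter> {..<a})"
  by auto

lemma succ_n_one_consecutive:
  fixes E :: "'a ordinal set"
  assumes E: "E \<subseteq> {..<a}" and consec: "consecutive_in E \<gamma> \<beta>"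
  shows "succ_n 1 (hset_of ` E - elts (hset_of \<gamma>)) = {hset_of \<beta>}"
proof -
  note \<gamma>\<beta> = consecutive_inD[OF consec]
  define F where "F = {c \<in> E. \<gamma> \<le> c}"
  have F: "hset_of ` E - elts (hset_of \<gamma>) = hset_of ` F"
    unfolding F_def by (auto simp: not_less)
  have F_sub: "F \<subseteq> {..<a}" using E unfolding F_def by blast
  have otp_iff: "otp (hset_of ` F \<inter> elts (hset_of b)) = ord_of_nat (Suc 0) \<longleftrightarrow> b = \<beta>"
    if "b \<in> F" for b
  proof -
    have "F \<inter> {..<b} = {\<eta> \<in> E. \<gamma> \<le> \<eta> \<and> \<eta> < b}" unfolding F_def by auto
    then show ?thesis
      unfolding hset_of_image_Int otp_image_eq_one_iff[OF order.trans[OF Int_lower1 F_sub]]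
      using consecutive_in_iff_singleton[OF consec] that by (simp add: F_def)
  qed
  have "nth_elt (hset_of ` F) (ord_of_nat (Suc 0)) = hset_of \<beta>"
    unfolding nth_elt_def
  proof (rule the_equality)
    show "hset_of \<beta> \<in> hset_of ` F \<and> otp (hset_of ` F \<inter> elts (hset_of \<beta>)) = ord_of_nat (Suc 0)"
      using otp_iff[of \<beta>] \<gamma>\<beta>(2,3) by (simp add: F_def)
    fix x assume x: "x \<in> hset_of ` F \<and> otp (hset_of ` F \<inter> elts x) = ord_of_nat (Suc 0)"
    then obtain b where "b \<in> F" "x = hset_of b" by blast
    then show "x = hset_of \<beta>" using x otp_iff[of b] by simp
  qed
  moreover have "ord_of_nat (Suc 0) \<in> elts (otp (hset_of ` F))"
  proof (rule one_mem_otp)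
    show "small (hset_of ` F)"
      using F_sub by (intro small_subset[OF _ small_elts[of "hset_of a"]]) auto
    show "hset_of \<gamma> \<in> hset_of ` F" "hset_of \<beta> \<in> hset_of ` F" "hset_of \<gamma> \<noteq> hset_of \<beta>"
      using \<gamma>\<beta> by (auto simp: F_def)
  qed (use Ord_hset_of in blast)
  ultimately show ?thesis
    unfolding F succ_n_def by (auto simp: less_Suc_eq)
qed

section \<open>Cofinality\<close>

lemma cf_props:
  assumes "Ord \<alpha>"
  shows "Ord (cf \<alpha>)" "has_cofinal_map (cf \<alpha>) \<alpha>" "\<gamma> \<in> elts (cf \<alpha>) \<Longrightarrow> \<not> has_cofinal_map \<gamma> \<alpha>"
proof -
  let ?least = "\<lambda>\<beta>. Ord \<beta> \<and> has_cofinal_map \<beta> \<alpha> \<and> (\<forall>\<gamma>\<in>elts \<beta>. \<not> has_cofinal_map \<gamma> \<alpha>)"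
  have "\<exists>\<beta>. ?least \<beta>" if "has_cofinal_map \<beta> \<alpha>" "Ord \<beta>" for \<beta>
    using that
  proof (induction \<beta> rule: mem_induct)
    case (mem \<beta>)
    then show ?case using Ord_mem by blast
  qed
  moreover have "has_cofinal_map \<alpha> \<alpha>"
    unfolding has_cofinal_map_def by (rule exI[of _ "\<lambda>x. x"]) auto
  ultimately obtain \<beta> where \<beta>: "?least \<beta>" using assms by blast
  have "cf \<alpha> = \<beta>" unfolding cf_def
  proof (rule the_equality[of ?least, OF \<beta>])
    show "\<gamma> = \<beta>" if "?least \<gamma>" for \<gamma> using that \<beta> Ord_linear[of \<beta> \<gamma>] by blast
  qed
  with \<beta> show "Ord (cf \<alpha>)" "has_cofinal_map (cf \<alpha>) \<alpha>" "\<gamma> \<in> elts (cf \<alpha>) \<Longrightarrow> \<not> has_cofinal_map \<gamma> \<alpha>"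
    by blast+
qed

lemma has_cofinal_map_iff: "has_cofinal_map (hset_of b) (hset_of a) \<longleftrightarrow> (\<exists>f. cofinal_map b a f)"
proof
  assume "has_cofinal_map (hset_of b) (hset_of a)"
  then obtain F where F: "F ` elts (hset_of b) \<subseteq> elts (hset_of a)"
    "\<forall>x\<in>elts (hset_of a). \<exists>y\<in>elts (hset_of b). elts x \<subseteq> elts (F y)"
    unfolding has_cofinal_map_def by blast
  have "\<exists>c<a. F (hset_of \<zeta>) = hset_of c" if "\<zeta> < b" for \<zeta>
    using F(1) that by (metis hset_of_mem image_subset_iff mem_hset_ofE)
  then obtain f where f: "\<And>\<zeta>. \<zeta> < b \<Longrightarrow> f \<zeta> < a \<and> F (hset_of \<zeta>) = hset_of (f \<zeta>)" by metis
  have "\<exists>\<zeta><b. \<xi> \<le> f \<zeta>" if "\<xi> < a" for \<xi>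
  proof -
    obtain y where y: "y \<in> elts (hset_of b)" "elts (hset_of \<xi>) \<subseteq> elts (F y)"
      using F(2) \<open>\<xi> < a\<close> by (metis hset_of_mem)
    then obtain \<zeta> where "\<zeta> < b" "y = hset_of \<zeta>" by (auto elim: mem_hset_ofE)
    then show ?thesis using f y(2) by auto
  qed
  then show "\<exists>f. cofinal_map b a f"
    using f unfolding cofinal_map_def by (intro exI[of _ f]) auto
next
  assume "\<exists>f. cofinal_map b a f"
  then obtain f where f: "f ` {..<b} \<subseteq> {..<a}" "\<forall>\<xi><a. \<exists>\<zeta><b. \<xi> \<le> f \<zeta>"
    unfolding cofinal_map_def by blast
  define F where "F x = hset_of (f (Abs_ordinal x))" for x
  have F: "F (hset_of \<zeta>) = hset_of (f \<zeta>)" for \<zeta> by (simp add: F_def hset_of_inverse)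
  show "has_cofinal_map (hset_of b) (hset_of a)"
    unfolding has_cofinal_map_def hset_of_image[symmetric]
  proof (intro exI[of _ F] conjI ballI)
    show "F ` hset_of ` {..<b} \<subseteq> hset_of ` {..<a}" using f(1) by (auto simp: F)
    fix x assume "x \<in> hset_of ` {..<a}"
    then obtain \<xi> where "\<xi> < a" "x = hset_of \<xi>" by blast
    then obtain \<zeta> where "\<zeta> < b" "elts x \<subseteq> elts (F (hset_of \<zeta>))" using f(2) by (auto simp: F)
    then show "\<exists>y\<in>hset_of ` {..<b}. elts x \<subseteq> elts (F y)" by blast
  qed
qed

lemma cf_mem_iff:
  fixes a :: "'a ordinal"
  shows "cf (hset_of a) \<in> elts (hset_of x) \<longleftrightarrow> cof_less x a"
proof -
  note cf = cf_props[OF Ord_hset_of[of a]]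
  obtain c where cf_eq: "cf (hset_of a) = hset_of c" using cf(1) by (rule OrdE)
  obtain f where f: "cofinal_map c a f"
    using cf(2) unfolding cf_eq has_cofinal_map_iff by (rule exE)
  have least: "c \<le> b" if "cofinal_map b a h" for b h
  proof -
    have "has_cofinal_map (hset_of b) (hset_of a)" unfolding has_cofinal_map_iff using that by blast
    then have "hset_of b \<notin> elts (cf (hset_of a))" using cf(3) by blast
    then show ?thesis by (simp add: cf_eq not_less)
  qed
  have "cof_less x a \<longleftrightarrow> c < x"
  proof
    assume "cof_less x a"
    then obtain b h where "b < x" "cofinal_map b a h" unfolding cof_less_def by blast
    then show "c < x" using least by (meson order.strict_trans1)
  qed (use f in \<open>auto simp: cof_less_def\<close>)
  then show ?thesis by (simp add: cf_eq)
qed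

lemma cf_superset_iff: "elts (hset_of x) \<subseteq> elts (cf (hset_of a)) \<longleftrightarrow> \<not> cof_less x a"
proof -
  obtain c where cf_eq: "cf (hset_of a) = hset_of c"
    using cf_props(1)[OF Ord_hset_of[of a]] by (rule OrdE)
  have "cof_less x a \<longleftrightarrow> c < x" using cf_mem_iff[of a x] unfolding cf_eq hset_of_mem by blast
  then show ?thesis by (simp add: cf_eq not_less)
qed

lemma regular_uncountableI:
  assumes regular: "regular_cardinal (hset_of k)" and omega: "omega \<in> elts (hset_of k)"
  shows "regular_uncountable k"
proof
  have card: "|elts \<alpha>| <o |elts (hset_of k)|" if "\<alpha> \<in> elts (hset_of k)" for \<alpha>
    using regular that unfolding regular_cardinal_def Cardinal_def by blast
  show "|{..<a}| <o |{..<k}|" if "a < k" for a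
    unfolding card_less_lessThan_iff using that
    by (intro ordIso_ordLess_trans[OF card_lessThan] card) simp
  show "\<not> cofinal_map a k f" if "a < k" for a f
    using cf_props(3)[OF Ord_hset_of, of "hset_of a" k] regular that
    unfolding regular_cardinal_def by (auto simp: has_cofinal_map_iff)
  have "|UNIV :: nat set| =o |elts (omega :: 'a hset)|"
    by (rule card_of_ordIsoI[of ord_of_nat]) (simp add: bij_betw_def inj_ord_of_nat elts_omega)
  then show "|UNIV :: nat set| <o |{..<k}|"
    unfolding card_less_lessThan_iff using card[OF omega] by (rule ordIso_ordLess_trans)
qed

section \<open>Coding maps on ordinals as sets\<close>

definition enc :: "('a ordinal \<rightharpoonup> 'a ordinal) \<Rightarrow> 'a hset" where
  "enc m = mk {pair (hset_of x) (hset_of y) |x y. m x = Some y}"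

abbreviation small_dom :: "('a ordinal \<rightharpoonup> 'a ordinal) \<Rightarrow> bool" where
  "small_dom (m :: 'a ordinal \<rightharpoonup> 'a ordinal) \<equiv> |dom m| \<le>o |UNIV :: (nat + 'a) set|"

lemma small_dom_lessThan: "dom m = {..<a} \<Longrightarrow> small_dom m"
  by (simp add: card_lessThan_bound)

lemma small_dom_subset: "small_dom t \<Longrightarrow> dom s \<subseteq> dom t \<Longrightarrow> small_dom s"
  using card_of_mono1 ordLeq_transitive by blast

lemma small_dom_map_add: "small_dom s \<Longrightarrow> small_dom t \<Longrightarrow> small_dom (s ++ t)"
  unfolding dom_map_add
  by (rule card_of_Un_ordLeq_infinite_Field)
    (simp_all only: Field_card_of infinite_bound card_of_card_order_on not_False_eq_True)

lemma elts_enc: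
  assumes "small_dom m"
  shows "elts (enc m) = {pair (hset_of x) (hset_of y) |x y. m x = Some y}"
proof -
  have "{pair (hset_of x) (hset_of y) |x y. m x = Some y} =
    (\<lambda>x. pair (hset_of x) (hset_of (the (m x)))) ` dom m" by force
  then show ?thesis unfolding enc_def using small_image[OF assms] by (intro elts_mk) simp
qed

lemma pair_mem_enc:
  assumes "small_dom m"
  shows "pair x y \<in> elts (enc m) \<longleftrightarrow> (\<exists>a b. x = hset_of a \<and> y = hset_of b \<and> m a = Some b)"
  unfolding elts_enc[OF assms] by (auto simp: pair_inject)

lemma enc_subset:
  assumes "small_dom s" "small_dom t"
  shows "elts (enc s) \<subseteq> elts (enc t) \<longleftrightarrow> s \<subseteq>\<^sub>m t"
proof
  assume sub: "elts (enc s) \<subseteq> elts (enc t)"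
  show "s \<subseteq>\<^sub>m t" unfolding map_le_def
  proof
    fix a assume "a \<in> dom s"
    then obtain b where b: "s a = Some b" by blast
    then have "pair (hset_of a) (hset_of b) \<in> elts (enc t)"
      using sub pair_mem_enc[OF assms(1)] by blast
    then show "s a = t a" using b pair_mem_enc[OF assms(2)] by auto
  qed
next
  assume "s \<subseteq>\<^sub>m t"
  then have "t x = Some y" if "s x = Some y" for x y
    using that unfolding map_le_def by (metis domI)
  then show "elts (enc s) \<subseteq> elts (enc t)"
    unfolding elts_enc[OF assms(1)] elts_enc[OF assms(2)] by blast
qed

lemma enc_inject:
  assumes "small_dom s" "small_dom t" shows "enc s = enc t \<longleftrightarrow> s = t"
  using enc_subset[OF assms] enc_subset[OF assms(2,1)] map_le_antisym by (metis order.refl)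

lemma enc_psubset:
  assumes "small_dom s" "small_dom t"
  shows "elts (enc s) \<subset> elts (enc t) \<longleftrightarrow> s \<subseteq>\<^sub>m t \<and> s \<noteq> t"
  using enc_subset[OF assms] enc_inject[OF assms] by (simp add: psubset_eq elts_inject)

lemma is_fun_enc: "small_dom m \<Longrightarrow> is_fun (enc m)"
  unfolding is_fun_def pair_mem_enc by (auto simp: elts_enc)

lemma fdom_enc: "small_dom m \<Longrightarrow> fdom (enc m) = hset_of ` dom m"
  unfolding fdom_def by (auto simp: pair_mem_enc)

lemma fran_enc: "small_dom m \<Longrightarrow> fran (enc m) = hset_of ` ran m"
  unfolding fran_def ran_def by (auto simp: pair_mem_enc)

lemma enc_in_seqs_iff:
  "small_dom m \<Longrightarrow> enc m \<in> seqs (hset_of \<alpha>) X \<longleftrightarrow> dom m = {..<\<alpha>} \<and> hset_of ` ran m \<subseteq> X"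
  unfolding seqs_def hset_of_image[symmetric]
  by (simp add: is_fun_enc fdom_enc fran_enc inj_image_eq_iff[OF inj_hset_of])

lemma restr_enc:
  assumes "small_dom m" shows "restr (enc m) (hset_of ` X) = enc (m |` X)"
proof -
  have "small_dom (m |` X)" by (rule small_dom_subset[OF assms]) auto
  then have "{z \<in> elts (enc m). \<exists>x\<in>hset_of ` X. \<exists>y. z = pair x y} = elts (enc (m |` X))"
    using assms by (auto simp: elts_enc pair_inject restrict_map_def split: if_splits)
  then show ?thesis unfolding restr_def by (simp add: mk_elts)
qed

lemma graft_enc:
  assumes "small_dom x" "small_dom y"
  shows "graft (enc x) (enc y) = enc (y ++ x)"
proof -
  let ?X = "dom y - dom x"
  have fdom_diff: "fdom (enc y) - fdom (enc x) = hset_of ` ?X"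
    unfolding fdom_enc[OF assms(1)] fdom_enc[OF assms(2)]
    by (rule image_set_diff[symmetric, OF inj_hset_of])
  have "small_dom (y |` ?X)" by (rule small_dom_subset[OF assms(2)]) auto
  moreover have "small_dom (y ++ x)" using assms(2,1) by (rule small_dom_map_add)
  ultimately have "elts (enc x) \<union> elts (enc (y |` ?X)) = elts (enc (y ++ x))"
    using assms(1)
    by (auto simp: elts_enc map_add_Some_iff restrict_map_def dom_def split: if_splits)
  then show ?thesis unfolding graft_def fdom_diff restr_enc[OF assms(2)] by (simp add: mk_elts)
qed

lemma append_val_enc:
  assumes "small_dom t" "a \<notin> dom t"
  shows "append_val (hset_of a) (enc t) (hset_of i) = enc (t(a \<mapsto> i))"
proof -
  have "small_dom [a \<mapsto> i]" by (rule card_of_finite_bound) simp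
  from small_dom_map_add[OF assms(1) this] have "small_dom (t(a \<mapsto> i))" by simp
  have "insert (pair (hset_of a) (hset_of i)) (elts (enc t)) = elts (enc (t(a \<mapsto> i)))"
    unfolding elts_enc[OF \<open>small_dom (t(a \<mapsto> i))\<close>] elts_enc[OF assms(1)]
    using assms(2) by (auto split: if_splits)
  then show ?thesis unfolding append_val_def by (simp add: mk_elts)
qed

lemma elts_enc_glue:
  assumes "map_chain M" and small: "\<And>t. t \<in> M \<Longrightarrow> small_dom t" "small_dom (glue M)"
  shows "elts (enc (glue M)) = (\<Union>t\<in>M. elts (enc t))"
proof
  have "elts (enc t) \<subseteq> elts (enc (glue M))" if "t \<in> M" for t
    unfolding enc_subset[OF small(1)[OF that] small(2)] by (rule map_le_glue[OF assms(1) that])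
  then show "(\<Union>t\<in>M. elts (enc t)) \<subseteq> elts (enc (glue M))" by (rule UN_least)
  show "elts (enc (glue M)) \<subseteq> (\<Union>t\<in>M. elts (enc t))"
  proof
    fix z assume "z \<in> elts (enc (glue M))"
    then obtain x y where z: "z = pair (hset_of x) (hset_of y)" "glue M x = Some y"
      unfolding elts_enc[OF small(2)] by blast
    then have "x \<in> dom (glue M)" by blast
    then obtain t where t: "t \<in> M" "x \<in> dom t" unfolding dom_glue by blast
    then have "t x = Some y" using map_le_glue[OF assms(1)] z(2) unfolding map_le_def by metis
    then have "z \<in> elts (enc t)" unfolding elts_enc[OF small(1)[OF t(1)]] z(1) by blast
    with t(1) show "z \<in> (\<Union>t\<in>M. elts (enc t))" by blast
  qed
qed

lemma trcl_set_subset: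
  assumes "Ord \<alpha>" "elts x \<subseteq> elts \<alpha>" shows "trcl_set x \<subseteq> elts \<alpha>"
proof
  fix y assume "y \<in> trcl_set x"
  then have "(y, x) \<in> mem_rel\<^sup>+" unfolding trcl_set_def by simp
  then show "y \<in> elts \<alpha>"
  proof (induction rule: converse_trancl_induct)
    case (base y)
    then show ?case using assms(2) by (auto simp: mem_rel_def)
  next
    case (step y z)
    then show ?case using Ord_trans[OF assms(1)] by (auto simp: mem_rel_def)
  qed
qed

lemma mem_hered_ltI:
  assumes "Ord \<alpha>" "elts x \<subseteq> elts \<alpha>" "|elts \<alpha>| <o r"
  shows "x \<in> hered_lt r"
  unfolding hered_lt_def
  using ordLeq_ordLess_trans[OF card_of_mono1[OF trcl_set_subset[OF assms(1,2)]] assms(3)] by blast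

lemma hset_of_in_H:
  assumes "regular_uncountable \<kappa>" "a < \<kappa>"
  shows "hset_of a \<in> H (hset_of \<kappa>)"
proof (rule mem_hered_ltI[OF Ord_hset_of order.refl])
  have "|{..<a}| <o |elts (hset_of \<kappa>)|"
    using regular_uncountable.initial[OF assms] unfolding card_less_lessThan_iff .
  then show "|elts (hset_of a)| <o |elts (hset_of \<kappa>)|"
    by (rule ordIso_ordLess_trans[OF ordIso_symmetric[OF card_lessThan]])
qed

section \<open>The coded tree\<close>

locale ordinal_proxy = proxy \<kappa> \<chi> w Cs idx
  for \<kappa> \<chi> :: "'a ordinal" and w Cs idx
begin

abbreviation K :: "'a hset" where
  "K \<equiv> hset_of \<kappa>"

definition coded_tree :: "'a hset set" where
  "coded_tree = enc ` tree"

lemma mem_coded_treeE: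
  assumes "z \<in> coded_tree" obtains t \<alpha> where "z = enc t" "\<alpha> < \<kappa>" "t \<in> Lev \<alpha>"
  using assms unfolding coded_tree_def tree_def by blast

lemma enc_in_coded_tree: "\<alpha> < \<kappa> \<Longrightarrow> t \<in> Lev \<alpha> \<Longrightarrow> enc t \<in> coded_tree"
  unfolding coded_tree_def tree_def by blast

lemma small_dom_Lev: "\<alpha> < \<kappa> \<Longrightarrow> t \<in> Lev \<alpha> \<Longrightarrow> small_dom t"
  by (rule small_dom_lessThan[OF Lev_dom])

lemma small_dom_tree: "t \<in> tree \<Longrightarrow> small_dom t"
  unfolding tree_iff using small_dom_Lev by blast

lemma enc_in_seqs:
  assumes "\<alpha> < \<kappa>" "t \<in> Lev \<alpha>"
  shows "enc t \<in> seqs (hset_of \<alpha>) (H K)"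
proof -
  have "y < \<kappa>" if "t x = Some y" for x y
  proof -
    have "x < \<alpha>" using Lev_dom[OF assms] that by blast
    then have "w x < \<kappa>" using assms(1) by (intro w_less) simp
    then show ?thesis using Lev_value_less[OF assms that] by simp
  qed
  then have "hset_of ` ran t \<subseteq> H K"
    using hset_of_in_H[OF regular_uncountable_axioms] unfolding ran_def by blast
  then show ?thesis
    unfolding enc_in_seqs_iff[OF small_dom_Lev[OF assms]] using Lev_dom[OF assms] by blast
qed

lemma seqs_length_unique: "f \<in> seqs \<alpha> X \<Longrightarrow> f \<in> seqs \<beta> Y \<Longrightarrow> \<alpha> = \<beta>"
  unfolding seqs_def by (auto intro: elts_eqI)

lemma level_coded_tree:
  assumes "\<alpha> < \<kappa>" shows "level K coded_tree (hset_of \<alpha>) = enc ` Lev \<alpha>"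
proof
  show "enc ` Lev \<alpha> \<subseteq> level K coded_tree (hset_of \<alpha>)"
    unfolding level_def using assms enc_in_seqs enc_in_coded_tree by blast
  show "level K coded_tree (hset_of \<alpha>) \<subseteq> enc ` Lev \<alpha>"
  proof
    fix z assume z: "z \<in> level K coded_tree (hset_of \<alpha>)"
    then obtain t \<beta> where t: "z = enc t" "\<beta> < \<kappa>" "t \<in> Lev \<beta>"
      unfolding level_def by (blast elim: mem_coded_treeE)
    then have "hset_of \<beta> = hset_of \<alpha>"
      using z seqs_length_unique[OF enc_in_seqs] unfolding level_def by blast
    with t show "z \<in> enc ` Lev \<alpha>" by simp
  qed
qed

lemma streamlined_coded_tree: "streamlined_tree K coded_tree"
  unfolding streamlined_tree_def
proof (intro conjI ballI subsetI)
  fix z assume "z \<in> coded_tree"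
  then obtain t \<beta> where t: "z = enc t" "\<beta> < \<kappa>" "t \<in> Lev \<beta>" by (rule mem_coded_treeE)
  then show "z \<in> seqs_below K (H K)"
    unfolding seqs_below_def using enc_in_seqs by (intro UN_I[of "hset_of \<beta>"]) simp_all
  fix x assume "x \<in> elts K"
  then obtain \<alpha> where \<alpha>: "\<alpha> < \<kappa>" "x = hset_of \<alpha>" by (rule mem_hset_ofE)
  have restr: "restr z (elts x) = enc (t |` {..<\<alpha>})"
    unfolding t(1) \<alpha>(2) hset_of_image[symmetric] by (rule restr_enc[OF small_dom_Lev[OF t(2,3)]])
  show "restr z (elts x) \<in> coded_tree"
  proof (cases "\<alpha> \<le> \<beta>")
    case True
    then show ?thesis unfolding restr by (rule enc_in_coded_tree[OF \<alpha>(1) Lev_restrict[OF t(2,3)]])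
  next
    case False
    then have "t |` {..<\<alpha>} = t" using Lev_dom[OF t(2,3)] by (intro restrict_map_dom_subset) auto
    then show ?thesis unfolding restr using enc_in_coded_tree[OF t(2,3)] by simp
  qed
qed

lemma height_coded_tree: "tree_height K coded_tree = K"
  unfolding tree_height_def
proof (rule the_equality)
  have "z \<notin> level K coded_tree K" for z
  proof
    assume z: "z \<in> level K coded_tree K"
    then obtain t \<beta> where t: "z = enc t" "\<beta> < \<kappa>" "t \<in> Lev \<beta>"
      unfolding level_def by (blast elim: mem_coded_treeE)
    then have "hset_of \<beta> = K"
      using z seqs_length_unique[OF enc_in_seqs] unfolding level_def by blast
    with t(2) show False by simp
  qed
  moreover have "level K coded_tree x \<noteq> {}" if "x \<in> elts K" for x
    using that Lev_nonempty by (elim mem_hset_ofE) (simp add: level_coded_tree)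
  ultimately show height: "Ord K \<and> level K coded_tree K = {} \<and>
      (\<forall>\<beta>\<in>elts K. level K coded_tree \<beta> \<noteq> {})"
    using Ord_hset_of by blast
  fix \<alpha>
  assume "Ord \<alpha> \<and> level K coded_tree \<alpha> = {} \<and> (\<forall>\<beta>\<in>elts \<alpha>. level K coded_tree \<beta> \<noteq> {})"
  then show "\<alpha> = K" using height Ord_linear[of \<alpha> K] by blast
qed

lemma card_coded_less: "|c| <o |{..<\<kappa>}| \<Longrightarrow> |enc ` c| <o |elts K|"
  unfolding card_less_lessThan_iff by (rule ordLeq_ordLess_trans[OF card_of_image])

lemma card_coded_chain:
  assumes "tree_chain coded_tree b" shows "|b| <o |elts K|"
proof -
  obtain c where c_tree: "c \<subseteq> tree" and b: "b = enc ` c"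
    using assms unfolding tree_chain_def coded_tree_def by (elim conjE subset_imageE)
  have "map_chain c"
  proof (rule chainI)
    fix s t assume st: "s \<in> c" "t \<in> c"
    then have small: "small_dom s" "small_dom t" using c_tree by (auto intro: small_dom_tree)
    have "enc s = enc t \<or> elts (enc s) \<subset> elts (enc t) \<or> elts (enc t) \<subset> elts (enc s)"
      using assms st unfolding tree_chain_def b by simp
    then have "elts (enc s) \<subseteq> elts (enc t) \<or> elts (enc t) \<subseteq> elts (enc s)" by auto
    then show "s \<subseteq>\<^sub>m t \<or> t \<subseteq>\<^sub>m s"
      unfolding enc_subset[OF small] enc_subset[OF small(2,1)] .
  qed
  then show ?thesis unfolding b by (rule card_coded_less[OF card_chain_less[OF c_tree]])
qed

lemma card_coded_antichain:
  assumes "tree_antichain coded_tree A" shows "|A| <o |elts K|"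
proof -
  obtain c where c_tree: "c \<subseteq> tree" and A: "A = enc ` c"
    using assms unfolding tree_antichain_def coded_tree_def by (elim conjE subset_imageE)
  have "|c| <o |{..<\<kappa>}|"
  proof (rule card_antichain_less[OF c_tree])
    fix s t assume st: "s \<in> c" "t \<in> c" "s \<subseteq>\<^sub>m t"
    then have small: "small_dom s" "small_dom t" using c_tree by (auto intro: small_dom_tree)
    have "\<not> elts (enc s) \<subset> elts (enc t)" using assms st unfolding tree_antichain_def A by simp
    then show "s = t" using st(3) unfolding enc_psubset[OF small] by blast
  qed
  then show ?thesis unfolding A by (rule card_coded_less)
qed

theorem souslin_coded_tree: "souslin_tree K coded_tree"
  unfolding souslin_tree_def
proof (intro conjI ballI streamlined_coded_tree height_coded_tree)
  fix x assume "x \<in> elts K"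
  then obtain \<alpha> where "\<alpha> < \<kappa>" "x = hset_of \<alpha>" by (rule mem_hset_ofE)
  then show "|level K coded_tree x| <o |elts K|"
    using card_coded_less[OF card_Lev_less] by (simp add: level_coded_tree)
next
  show "\<not> (\<exists>b. tree_branch coded_tree b \<and> |b| =o |elts K| )"
    using card_coded_chain not_ordLess_ordIso unfolding tree_branch_def by blast
  show "\<not> (\<exists>A. tree_antichain coded_tree A \<and> |A| =o |elts K| )"
    using card_coded_antichain not_ordLess_ordIso by blast
qed

theorem normal_coded_tree: "normal_tree K coded_tree"
  unfolding normal_tree_def
proof (intro ballI impI)
  fix x y z assume "y \<in> elts K" "x \<in> elts y" and z: "z \<in> level K coded_tree x"
  then obtain \<beta> where \<beta>: "\<beta> < \<kappa>" "y = hset_of \<beta>" by (elim mem_hset_ofE)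
  then obtain \<alpha> where \<alpha>: "\<alpha> < \<beta>" "x = hset_of \<alpha>" using \<open>x \<in> elts y\<close> mem_hset_ofE by blast
  have "\<alpha> < \<kappa>" using \<alpha>(1) \<beta>(1) by simp
  then obtain s where s: "z = enc s" "s \<in> Lev \<alpha>"
    using z unfolding \<alpha>(2) by (auto simp: level_coded_tree)
  obtain t where t: "t \<in> Lev \<beta>" "s \<subseteq>\<^sub>m t"
    using Lev_extend[OF s(2) order.strict_implies_order[OF \<alpha>(1)] \<beta>(1)] by blast
  have "s \<noteq> t" using Lev_disjoint[OF s(2) _ \<open>\<alpha> < \<kappa>\<close> \<beta>(1)] t(1) \<alpha>(1) by blast
  then have "elts z \<subset> elts (enc t)"
    using enc_psubset[OF small_dom_Lev[OF \<open>\<alpha> < \<kappa>\<close> s(2)] small_dom_Lev[OF \<beta>(1) t(1)]] t(2)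
    unfolding s(1) by blast
  then show "\<exists>t\<in>level K coded_tree y. elts z \<subset> elts t"
    unfolding \<beta>(2) level_coded_tree[OF \<beta>(1)] using t(1) by blast
qed

lemma append_val_enc_Lev:
  assumes "\<alpha> < \<kappa>" "t \<in> Lev \<alpha>"
  shows "append_val (hset_of \<alpha>) (enc t) (hset_of i) = enc (t(\<alpha> \<mapsto> i))"
  by (rule append_val_enc[OF small_dom_Lev[OF assms]]) (simp add: Lev_dom[OF assms])

theorem prolific_coded_tree:
  assumes "\<And>\<alpha>. \<alpha> < \<kappa> \<Longrightarrow> elts (omax omega (hset_of \<alpha>)) \<subseteq> elts (hset_of (w \<alpha>))"
  shows "prolific_tree K coded_tree"
  unfolding prolific_tree_def
proof (intro ballI subsetI)
  fix x z v assume "x \<in> elts K" and z: "z \<in> level K coded_tree x"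
    and v: "v \<in> {append_val x z i |i. i \<in> elts (omax omega x)}"
  then obtain \<alpha> where \<alpha>: "\<alpha> < \<kappa>" "x = hset_of \<alpha>" by (elim mem_hset_ofE)
  obtain t where t: "z = enc t" "t \<in> Lev \<alpha>"
    using z unfolding \<alpha>(2) level_coded_tree[OF \<alpha>(1)] by blast
  obtain y where y: "v = append_val x z y" "y \<in> elts (hset_of (w \<alpha>))"
    using v assms[OF \<alpha>(1)] unfolding \<alpha>(2) by blast
  obtain i where i: "i < w \<alpha>" "y = hset_of i" using y(2) by (rule mem_hset_ofE)
  obtain \<beta> where \<beta>: "\<beta> < \<kappa>" "is_succ \<alpha> \<beta>" "t(\<alpha> \<mapsto> i) \<in> Lev \<beta>"
    using Lev_succI[OF \<alpha>(1) t(2) i(1)] by blast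
  have "v = enc (t(\<alpha> \<mapsto> i))"
    unfolding y(1) \<alpha>(2) t(1) i(2) by (rule append_val_enc_Lev[OF \<alpha>(1) t(2)])
  then show "v \<in> level K coded_tree (succ x)"
    unfolding \<alpha>(2) hset_of_is_succ[OF \<beta>(2), symmetric] level_coded_tree[OF \<beta>(1)]
    using \<beta>(3) by blast
qed

lemma enc_upd_immediate_succ:
  assumes t: "\<alpha> < \<kappa>" "t \<in> Lev \<alpha>" and "i < w \<alpha>"
  shows "enc (t(\<alpha> \<mapsto> i)) \<in> immediate_succs coded_tree (enc t)" (is "enc ?t' \<in> _")
  unfolding immediate_succs_def
proof (intro CollectI conjI notI)
  obtain \<beta> where \<beta>: "\<beta> < \<kappa>" "?t' \<in> Lev \<beta>" using Lev_succI[OF assms] by blast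
  then show "enc ?t' \<in> coded_tree" by (rule enc_in_coded_tree)
  note small = small_dom_Lev[OF t] small_dom_Lev[OF \<beta>]
  have "\<alpha> \<notin> dom t" by (simp add: Lev_dom[OF t])
  then have "t \<subseteq>\<^sub>m ?t'" "t \<noteq> ?t'" by (auto simp: map_le_def dest: fun_cong[of _ _ \<alpha>])
  then show "elts (enc t) \<subset> elts (enc ?t')" unfolding enc_psubset[OF small] ..
  assume "\<exists>r\<in>coded_tree. elts (enc t) \<subset> elts r \<and> elts r \<subset> elts (enc ?t')"
  then obtain s \<gamma> where s: "\<gamma> < \<kappa>" "s \<in> Lev \<gamma>"
      and between: "elts (enc t) \<subset> elts (enc s)" "elts (enc s) \<subset> elts (enc ?t')"
    by (blast elim: mem_coded_treeE)
  have "t \<subseteq>\<^sub>m s \<and> t \<noteq> s" "s \<subseteq>\<^sub>m ?t' \<and> s \<noteq> ?t'"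
    using between
    unfolding enc_psubset[OF small(1) small_dom_Lev[OF s]]
      enc_psubset[OF small_dom_Lev[OF s] small(2)] by blast+
  then show False using map_le_fun_upd_cases[of t s] by blast
qed

theorem splitting_coded_tree:
  assumes "\<And>\<alpha>. \<alpha> < \<kappa> \<Longrightarrow> elts \<sigma> \<subseteq> elts (hset_of (w \<alpha>))"
  shows "splitting_tree \<sigma> coded_tree"
  unfolding splitting_tree_def
proof
  fix z assume "z \<in> coded_tree"
  then obtain t \<alpha> where t: "z = enc t" "\<alpha> < \<kappa>" "t \<in> Lev \<alpha>" by (rule mem_coded_treeE)
  let ?succ = "\<lambda>i. enc (t(\<alpha> \<mapsto> i))"
  have "inj_on ?succ {..<w \<alpha>}"
  proof (rule inj_onI)
    have small: "small_dom (t(\<alpha> \<mapsto> i))" if "i \<in> {..<w \<alpha>}" for i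
      using Lev_succI[OF t(2,3), of i] that small_dom_Lev by blast
    fix i j assume "i \<in> {..<w \<alpha>}" "j \<in> {..<w \<alpha>}" "?succ i = ?succ j"
    then have "t(\<alpha> \<mapsto> i) = t(\<alpha> \<mapsto> j)" using enc_inject[OF small small] by blast
    then show "i = j" by (metis fun_upd_same option.inject)
  qed
  moreover have "?succ i \<in> immediate_succs coded_tree z" if "i \<in> {..<w \<alpha>}" for i
    unfolding t(1) using that by (intro enc_upd_immediate_succ[OF t(2,3)]) simp
  ultimately have "|{..<w \<alpha>}| \<le>o |immediate_succs coded_tree z|" by (rule card_of_ordLeqI)
  then have "|elts (hset_of (w \<alpha>))| \<le>o |immediate_succs coded_tree z|"
    by (rule ordIso_ordLeq_trans[OF ordIso_symmetric[OF card_lessThan]])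
  then show "|elts \<sigma>| \<le>o |immediate_succs coded_tree z|"
    by (rule ordLeq_transitive[OF card_of_mono1[OF assms[OF t(2)]]])
qed

theorem complete_coded_tree: "complete_tree (hset_of \<chi>) coded_tree"
  unfolding complete_tree_def
proof (intro ballI allI impI, elim conjE)
  fix e f assume e: "e \<in> elts (hset_of \<chi>)" and f: "\<forall>\<xi>\<in>elts e. f \<xi> \<in> coded_tree"
    and increasing: "\<forall>\<xi>\<in>elts e. \<forall>\<xi>'\<in>elts \<xi>. elts (f \<xi>') \<subset> elts (f \<xi>)"
  obtain \<eta> where \<eta>: "\<eta> < \<chi>" "e = hset_of \<eta>" using e by (rule mem_hset_ofE)
  have "\<exists>t. t \<in> tree \<and> f (hset_of \<zeta>) = enc t" if "\<zeta> < \<eta>" for \<zeta>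
  proof -
    have "f (hset_of \<zeta>) \<in> enc ` tree" using f that unfolding \<eta>(2) coded_tree_def by simp
    then show ?thesis by blast
  qed
  then obtain F where F: "\<And>\<zeta>. \<zeta> < \<eta> \<Longrightarrow> F \<zeta> \<in> tree \<and> f (hset_of \<zeta>) = enc (F \<zeta>)" by metis
  have "F \<zeta> \<subseteq>\<^sub>m F \<zeta>'" if "\<zeta> < \<zeta>'" "\<zeta>' < \<eta>" for \<zeta> \<zeta>'
  proof -
    have F\<zeta>: "F \<zeta> \<in> tree" "f (hset_of \<zeta>) = enc (F \<zeta>)"
      and F\<zeta>': "F \<zeta>' \<in> tree" "f (hset_of \<zeta>') = enc (F \<zeta>')"
      using F that by (auto dest: order.strict_trans)
    have "elts (f (hset_of \<zeta>)) \<subset> elts (f (hset_of \<zeta>'))" using increasing that unfolding \<eta>(2) by simp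
    then show ?thesis
      unfolding F\<zeta>(2) F\<zeta>'(2) enc_psubset[OF small_dom_tree[OF F\<zeta>(1)] small_dom_tree[OF F\<zeta>'(1)]] ..
  qed
  then have mono: "monotone_on {..<\<eta>} (\<le>) (\<subseteq>\<^sub>m) F"
    by (auto simp: monotone_on_def order.order_iff_strict)
  have glue: "glue (F ` {..<\<eta>}) \<in> tree"
    using F by (intro glue_short_chain_in_tree[OF \<eta>(1) _ mono]) blast
  have "(\<Union>\<xi>\<in>elts e. elts (f \<xi>)) = (\<Union>t\<in>F ` {..<\<eta>}. elts (enc t))"
    unfolding \<eta>(2) hset_of_image[symmetric] using F by simp
  also have "\<dots> = elts (enc (glue (F ` {..<\<eta>})))"
    by (rule elts_enc_glue[symmetric, OF map_chain_image[OF mono] small_dom_tree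
          small_dom_tree[OF glue]]) (use F in blast)
  finally show "mk (\<Union>\<xi>\<in>elts e. elts (f \<xi>)) \<in> coded_tree"
    using glue unfolding coded_tree_def by (simp add: mk_elts)
qed

theorem homogeneous_coded_tree: "uniformly_homogeneous coded_tree"
  unfolding uniformly_homogeneous_def
proof (intro ballI impI)
  fix y x assume "y \<in> coded_tree" "x \<in> coded_tree" and less: "fdom x \<subset> fdom y"
  then obtain s \<alpha> t \<beta> where s: "x = enc s" "\<alpha> < \<kappa>" "s \<in> Lev \<alpha>"
      and t: "y = enc t" "\<beta> < \<kappa>" "t \<in> Lev \<beta>"
    by (elim mem_coded_treeE)
  note small = small_dom_Lev[OF s(2,3)] small_dom_Lev[OF t(2,3)]
  have "hset_of ` {..<\<alpha>} \<subset> hset_of ` {..<\<beta>}"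
    using less fdom_enc[OF small(1)] fdom_enc[OF small(2)] Lev_dom[OF s(2,3)] Lev_dom[OF t(2,3)]
    unfolding s(1) t(1) by simp
  then have "\<alpha> < \<beta>" unfolding hset_of_image by (simp add: psubset_eq elts_inject less_le)
  then have "t ++ s \<in> Lev \<beta>" using s(3) by (rule Lev_graft[OF t(2,3)])
  then show "graft x y \<in> coded_tree"
    unfolding s(1) t(1) graft_enc[OF small] by (rule enc_in_coded_tree[OF t(2)])
qed

end

section \<open>From the proxy principle to the construction\<close>

lemma unbounded_in_iff:
  "unbounded_in a E \<longleftrightarrow>
    zero \<in> elts (hset_of a) \<and> osup (hset_of ` E \<inter> elts (hset_of a)) = hset_of a"
  unfolding unbounded_in_def hset_of_image_Int osup_eq_iff[OF Int_lower2] zero_mem_iff by blast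

lemma acc_pts_iff: "hset_of a \<in> acc_pts (hset_of ` E) \<longleftrightarrow> a \<in> E \<and> unbounded_in a E"
  unfolding acc_pts_def unbounded_in_iff mem_Collect_eq hset_of_mem_image by blast

lemma club_in_iff:
  assumes "\<exists>\<xi>. \<xi> < a"
  shows "club_in (hset_of a) (hset_of ` E) \<longleftrightarrow> club_below a E"
proof (cases "E \<subseteq> {..<a}")
  case True
  then have "osup (hset_of ` E) = hset_of a \<longleftrightarrow> unbounded_in a E"
    unfolding osup_eq_iff[OF True] unbounded_in_def using assms by blast
  moreover have "hset_of ` E \<subseteq> elts (hset_of a)" using True by auto
  moreover have "(\<forall>\<gamma>\<in>elts (hset_of a). zero \<in> elts \<gamma> \<and> osup (hset_of ` E \<inter> elts \<gamma>) = \<gamma> \<longrightarrow>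
      \<gamma> \<in> hset_of ` E) \<longleftrightarrow> closed_below a E"
    unfolding closed_below_def unbounded_in_iff hset_of_image[of a, symmetric] by auto
  ultimately show ?thesis unfolding club_in_def club_below_def using True by blast
next
  case False
  then have "\<not> hset_of ` E \<subseteq> elts (hset_of a)" by auto
  with False show ?thesis unfolding club_in_def club_below_def by blast
qed

lemma stationary_in_mono: "stationary_in \<kappa> S \<Longrightarrow> S \<subseteq> T \<Longrightarrow> T \<subseteq> elts \<kappa> \<Longrightarrow> stationary_in \<kappa> T"
  unfolding stationary_in_def by blast

lemma lt_closed_cexp:
  fixes \<kappa> \<chi> :: "'a ordinal"
  assumes "lt_closed (hset_of \<chi>) (hset_of \<kappa>)" "\<eta> < \<chi>" "\<mu> < \<kappa>"
  shows "|{..<\<mu>}| ^c |{..<\<eta>}| <o |{..<\<kappa>}|"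
proof -
  define code where "code h = (Some \<circ> h) |` {..<\<eta>}" for h :: "'a ordinal \<Rightarrow> 'a ordinal"
  have dom: "dom (code h) = {..<\<eta>}" for h by (auto simp: code_def)
  note small = small_dom_lessThan[OF dom]
  have "inj_on (\<lambda>h. enc (code h)) (Func {..<\<eta>} {..<\<mu>})"
  proof (rule inj_onI)
    fix g h assume gh: "g \<in> Func {..<\<eta>} {..<\<mu>}" "h \<in> Func {..<\<eta>} {..<\<mu>}"
    assume "enc (code g) = enc (code h)"
    then have "code g \<xi> = code h \<xi>" for \<xi> unfolding enc_inject[OF small small] by simp
    then have "g \<xi> = h \<xi>" if "\<xi> < \<eta>" for \<xi>
      using that unfolding code_def by (metis comp_apply lessThan_iff option.inject restrict_in)
    moreover have "g \<xi> = h \<xi>" if "\<not> \<xi> < \<eta>" for \<xi>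
      using that gh unfolding Func_def by auto
    ultimately show "g = h" by blast
  qed
  moreover have "enc (code h) \<in> seqs_below (hset_of \<chi>) (elts (hset_of \<mu>))"
    if "h \<in> Func {..<\<eta>} {..<\<mu>}" for h
  proof -
    have "ran (code h) \<subseteq> {..<\<mu>}"
      using that unfolding Func_def ran_def code_def by (auto simp: restrict_map_def)
    then have "enc (code h) \<in> seqs (hset_of \<eta>) (elts (hset_of \<mu>))"
      unfolding enc_in_seqs_iff[OF small] hset_of_image[symmetric] using dom by blast
    then show ?thesis
      unfolding seqs_below_def using assms(2) by (intro UN_I[of "hset_of \<eta>"]) simp_all
  qed
  ultimately have "|Func {..<\<eta>} {..<\<mu>}| \<le>o |seqs_below (hset_of \<chi>) (elts (hset_of \<mu>))|"
    by (rule card_of_ordLeqI)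
  moreover have "|seqs_below (hset_of \<chi>) (elts (hset_of \<mu>))| <o |elts (hset_of \<kappa>)|"
    using assms(1,3) unfolding lt_closed_def by simp
  ultimately show ?thesis
    unfolding card_less_lessThan_iff cexp_def Field_card_of by (rule ordLeq_ordLess_trans)
qed

lemma mk_subset_ordinal:
  assumes "X \<subseteq> elts (hset_of \<kappa>)"
  shows "elts (mk X) = X" "mk X \<in> Hplus (hset_of \<kappa>)"
proof -
  show elts: "elts (mk X) = X" by (rule elts_mk[OF small_subset[OF assms small_elts]])
  show "mk X \<in> Hplus (hset_of \<kappa>)"
    by (rule mem_hered_ltI[OF Ord_hset_of _ cardSuc_greater[OF card_of_Card_order]])
      (simp add: elts assms)
qed

text \<open>Only one instance of elementarity is needed, for the formula \<open>\<exists>d \<in> p. i \<in> d\<close>.\<close>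

lemma elem_submodel_reflects_unbounded:
  assumes M: "M \<prec> Hplus (hset_of \<kappa>)" "mk (hset_of ` D) \<in> M"
      "M \<inter> elts (hset_of \<kappa>) = elts (hset_of \<beta>)"
    and D: "D \<subseteq> {..<\<kappa>}" "unbounded_in \<kappa> D" and \<beta>: "\<beta> < \<kappa>" "\<exists>\<xi>. \<xi> < \<beta>"
  shows "unbounded_in \<beta> D"
  unfolding unbounded_in_def
proof (intro conjI allI impI)
  let ?N = "Hplus (hset_of \<kappa>)" and ?p = "mk (hset_of ` D)"
  have D_sub: "hset_of ` D \<subseteq> elts (hset_of \<kappa>)" using D(1) by auto
  note elts_p = mk_subset_ordinal(1)[OF D_sub]
  fix \<xi> assume \<xi>: "\<xi> < \<beta>"
  then have "hset_of \<xi> \<in> M" using M(3) hset_of_mem by blast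
  let ?e = "\<lambda>n :: nat. if n = 0 then ?p else hset_of \<xi>"
    and ?\<phi> = "Exists 2 (Conj (Mem 2 0) (Mem 1 2))"
  have "range ?e \<subseteq> M" using M(2) \<open>hset_of \<xi> \<in> M\<close> by auto
  then have sat_iff: "sat M ?e ?\<phi> \<longleftrightarrow> sat ?N ?e ?\<phi>" using M(1) unfolding elem_submodel_def by blast
  obtain \<eta> where \<eta>: "\<eta> \<in> D" "\<xi> < \<eta>" 
    using unbounded_inD[OF D(2), of \<xi>] \<xi> \<beta>(1) order.strict_trans by blast
  have "elts (hset_of \<eta>) \<subseteq> elts (hset_of \<kappa>)" using \<eta>(1) D(1) by auto
  then have "hset_of \<eta> \<in> ?N"
    using mk_subset_ordinal(2)[of "elts (hset_of \<eta>)" \<kappa>] by (simp add: mk_elts)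
  then have "sat ?N ?e ?\<phi>" using \<eta> by (auto simp: elts_p)
  then have "sat M ?e ?\<phi>" using sat_iff by blast
  then obtain z where z: "z \<in> M" "z \<in> hset_of ` D" "hset_of \<xi> \<in> elts z" by (auto simp: elts_p)
  then obtain \<zeta> where \<zeta>: "z = hset_of \<zeta>" "\<zeta> \<in> D" by blast
  have "z \<in> elts (hset_of \<beta>)" using z(1,2) M(3) D_sub by blast
  then show "\<exists>\<eta>\<in>D. \<xi> < \<eta> \<and> \<eta> < \<beta>" using z(3) \<zeta> by auto
qed (fact \<beta>(2))

locale proxy_sequence =
  fixes \<kappa> \<chi> :: "'a ordinal" and \<C> B :: "'a hset \<Rightarrow> 'a hset set"
  assumes regular_cardinal: "regular_cardinal (hset_of \<kappa>)" and omega_mem: "omega \<in> elts (hset_of \<kappa>)"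
    and omega_subset: "elts omega \<subseteq> elts (hset_of \<chi>)"
    and B_disjoint: "disjoint_family_on B (elts (hset_of \<kappa>))"
    and \<C>_club: "\<lbrakk>\<alpha> \<in> acc_pts (elts (hset_of \<kappa>)); C \<in> \<C> \<alpha>\<rbrakk> \<Longrightarrow>
      C \<in> club_funs (hset_of \<kappa>) \<and> alpha_of C = \<alpha>"
    and \<C>_nonempty: "\<alpha> \<in> acc_pts (elts (hset_of \<kappa>)) \<Longrightarrow> \<C> \<alpha> \<noteq> {}"
    and card_\<C>_less: "\<alpha> \<in> acc_pts (elts (hset_of \<kappa>)) \<Longrightarrow> |\<C> \<alpha>| <o |elts (hset_of \<kappa>)|"
    and \<C>_coherent: "\<lbrakk>\<alpha> \<in> acc_pts (elts (hset_of \<kappa>)); C \<in> \<C> \<alpha>; \<delta> \<in> acc_pts (fdom C)\<rbrakk> \<Longrightarrow>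
      \<exists>D\<in>\<C> \<delta>. sq_chi (hset_of \<chi>) D C"
    and \<C>_guess: "\<lbrakk>\<Omega> \<subseteq> H (hset_of \<kappa>); p \<in> Hplus (hset_of \<kappa>)\<rbrakk> \<Longrightarrow> stationary_in (hset_of \<kappa>)
      {\<alpha> \<in> cof_ge (hset_of \<kappa>) (hset_of \<chi>). \<forall>C\<in>\<C> \<alpha>. \<forall>i\<in>elts \<alpha>.
        osup {\<gamma> \<in> fdom C. succ_n 1 (fdom C - elts \<gamma>) \<subseteq> guess_set (hset_of \<kappa>) (B i) \<Omega> p C} = \<alpha>}"
begin

sublocale regular_uncountable \<kappa>
  by (rule regular_uncountableI[OF regular_cardinal omega_mem])

definition points :: "'a hset \<Rightarrow> 'a ordinal set" where
  "points C = {a. hset_of a \<in> fdom C}"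

definition ordinal_values :: "'a hset \<Rightarrow> 'a ordinal \<Rightarrow> 'a ordinal set" where
  "ordinal_values C b = {a. hset_of a \<in> elts (app C (hset_of b))}"

definition Cs :: "'a ordinal \<Rightarrow> ('a ordinal set \<times> ('a ordinal \<Rightarrow> 'a ordinal set)) set" where
  "Cs \<alpha> = (\<lambda>C. (points C, ordinal_values C)) ` \<C> (hset_of \<alpha>)"

definition idx :: "'a ordinal \<Rightarrow> 'a ordinal" where
  "idx b = (THE i. i < \<kappa> \<and> hset_of b \<in> B (hset_of i))"

lemma idx_eqI:
  assumes "i < \<kappa>" "hset_of b \<in> B (hset_of i)"
  shows "idx b = i"
  unfolding idx_def
proof (rule the_equality)
  fix j assume j: "j < \<kappa> \<and> hset_of b \<in> B (hset_of j)"
  then have "\<not> B (hset_of j) \<inter> B (hset_of i) = {}" using assms(2) by blast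
  moreover have "hset_of i \<in> elts (hset_of \<kappa>)" "hset_of j \<in> elts (hset_of \<kappa>)"
    using assms(1) j by simp_all
  ultimately have "hset_of j = hset_of i"
    using B_disjoint unfolding disjoint_family_on_def by blast
  then show "j = i" by simp
qed (use assms in blast)

lemma is_limit_acc: "\<alpha> < \<kappa> \<Longrightarrow> is_limit \<alpha> \<Longrightarrow> hset_of \<alpha> \<in> acc_pts (elts (hset_of \<kappa>))"
  unfolding hset_of_image[symmetric] acc_pts_iff by (auto elim: unbounded_in_mono)

lemma points_club:
  assumes \<alpha>: "\<alpha> < \<kappa>" "is_limit \<alpha>" and C: "C \<in> \<C> (hset_of \<alpha>)"
  shows "fdom C = hset_of ` points C" "club_below \<alpha> (points C)"
proof -
  have club: "C \<in> club_funs (hset_of \<kappa>)" "alpha_of C = hset_of \<alpha>"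
    using \<C>_club[OF is_limit_acc[OF \<alpha>] C] by auto
  then have "fdom C \<subseteq> hset_of ` {..<\<kappa>}" unfolding club_funs_def hset_of_image by blast
  then show points: "fdom C = hset_of ` points C" unfolding points_def by blast
  have "club_in (hset_of \<alpha>) (hset_of ` points C)"
    using club unfolding club_funs_def points[symmetric] by auto
  moreover have "\<exists>\<xi>. \<xi> < \<alpha>" using \<alpha>(2) unfolding unbounded_in_def by blast
  ultimately show "club_below \<alpha> (points C)" using club_in_iff by blast
qed

lemma Cs_coherent:
  assumes \<alpha>: "\<alpha> < \<kappa>" "is_limit \<alpha>" and Eg: "(E, g) \<in> Cs \<alpha>"
    and \<delta>: "\<delta> \<in> E" "unbounded_in \<delta> E" "\<not> cof_less \<chi> \<delta>"
  shows "\<exists>g'. (E \<inter> {..<\<delta>}, g') \<in> Cs \<delta> \<and> (\<forall>\<xi>\<in>E \<inter> {..<\<delta>}. g' \<xi> = g \<xi>)"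
proof -
  obtain C where C: "C \<in> \<C> (hset_of \<alpha>)" "E = points C" "g = ordinal_values C"
    using Eg unfolding Cs_def by blast
  note points = points_club[OF \<alpha> C(1)]
  have "\<delta> < \<kappa>" using club_belowD(1)[OF points(2)] \<delta>(1) \<alpha>(1) C(2) by auto
  have "hset_of \<delta> \<in> acc_pts (fdom C)" unfolding points(1) acc_pts_iff using \<delta> C(2) by simp
  then obtain D where D: "D \<in> \<C> (hset_of \<delta>)" "sq_chi (hset_of \<chi>) D C"
    using \<C>_coherent[OF is_limit_acc[OF \<alpha>] C(1)] by blast
  have "alpha_of D = hset_of \<delta>"
    using \<C>_club[OF is_limit_acc[OF \<open>\<delta> < \<kappa>\<close> unbounded_in_imp_is_limit[OF \<delta>(2)]] D(1)] by blast
  then have "D = restr C (elts (hset_of \<delta>))"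
    using D(2) \<delta>(3) unfolding sq_chi_def by (simp add: cf_mem_iff)
  then have "elts D = {z \<in> elts C. \<exists>u\<in>elts (hset_of \<delta>). \<exists>y. z = pair u y}"
    unfolding restr_def by (simp add: elts_mk[OF small_subset[OF _ small_elts[of C]]])
  then have pair_mem: "pair u v \<in> elts D \<longleftrightarrow> pair u v \<in> elts C \<and> u \<in> elts (hset_of \<delta>)" for u v
    by (auto simp: pair_inject)
  have "points D = E \<inter> {..<\<delta>}" unfolding C(2) points_def fdom_def pair_mem by auto
  moreover have "ordinal_values D \<xi> = g \<xi>" if "\<xi> \<in> E \<inter> {..<\<delta>}" for \<xi>
    using that unfolding C(3) ordinal_values_def app_def pair_mem by simp
  moreover have "(points D, ordinal_values D) \<in> Cs \<delta>" unfolding Cs_def using D(1) by blast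
  ultimately show ?thesis by metis
qed

definition guesses ::
  "'a ordinal set \<Rightarrow> 'a ordinal set \<Rightarrow> 'a hset \<Rightarrow> 'a hset \<Rightarrow> 'a hset \<Rightarrow> bool" where
  "guesses D \<Omega> C i \<gamma> \<longleftrightarrow> succ_n 1 (fdom C - elts \<gamma>) \<subseteq>
     guess_set (hset_of \<kappa>) (B i) (hset_of ` \<Omega>) (mk (hset_of ` D)) C"

lemma ex_guessing_level:
  assumes D: "D \<subseteq> {..<\<kappa>}" and \<Omega>: "\<Omega> \<subseteq> {..<\<kappa>}"
  shows "\<exists>\<alpha><\<kappa>. \<not> cof_less \<chi> \<alpha> \<and>
    (\<forall>C\<in>\<C> (hset_of \<alpha>). \<forall>i<\<alpha>. osup {\<gamma> \<in> fdom C. guesses D \<Omega> C (hset_of i) \<gamma>} = hset_of \<alpha>)"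
proof -
  let ?K = "hset_of \<kappa>"
  have "hset_of ` \<Omega> \<subseteq> H ?K" using \<Omega> hset_of_in_H[OF regular_uncountable_axioms] by blast
  moreover have "mk (hset_of ` D) \<in> Hplus ?K" by (rule mk_subset_ordinal(2)) (use D in auto)
  ultimately have stationary: "stationary_in ?K {\<alpha> \<in> cof_ge ?K (hset_of \<chi>).
      \<forall>C\<in>\<C> \<alpha>. \<forall>i\<in>elts \<alpha>. osup {\<gamma> \<in> fdom C. guesses D \<Omega> C i \<gamma>} = \<alpha>}"
    unfolding guesses_def by (rule \<C>_guess)
  have nonzero: "\<exists>\<xi>. \<xi> < \<kappa>"
    using club_belowD(2)[OF club_below_lessThan] unfolding unbounded_in_def ..
  have "club_in ?K (elts ?K)"
    unfolding hset_of_image[symmetric] club_in_iff[OF nonzero] by (rule club_below_lessThan)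
  with stationary have "{\<alpha> \<in> cof_ge ?K (hset_of \<chi>).
      \<forall>C\<in>\<C> \<alpha>. \<forall>i\<in>elts \<alpha>. osup {\<gamma> \<in> fdom C. guesses D \<Omega> C i \<gamma>} = \<alpha>} \<noteq> {}"
    unfolding stationary_in_def by blast
  then obtain z where z: "z \<in> elts ?K" "elts (hset_of \<chi>) \<subseteq> elts (cf z)"
      and sup: "\<And>C i. \<lbrakk>C \<in> \<C> z; i \<in> elts z\<rbrakk> \<Longrightarrow> osup {\<gamma> \<in> fdom C. guesses D \<Omega> C i \<gamma>} = z"
    unfolding cof_ge_def by blast
  obtain \<alpha> where \<alpha>: "\<alpha> < \<kappa>" "z = hset_of \<alpha>" using z(1) by (rule mem_hset_ofE)
  moreover have "\<not> cof_less \<chi> \<alpha>" using z(2) unfolding \<alpha>(2) cf_superset_iff .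
  ultimately show ?thesis using sup unfolding \<alpha>(2) by (metis hset_of_mem)
qed

lemma ex_guessing_point:
  assumes \<alpha>: "\<alpha> < \<kappa>" "is_limit \<alpha>" and C: "C \<in> \<C> (hset_of \<alpha>)"
    and sup: "osup {\<gamma> \<in> fdom C. guesses D \<Omega> C i \<gamma>} = hset_of \<alpha>" and "\<xi> < \<alpha>"
  shows "\<exists>\<gamma>\<in>points C. \<xi> < \<gamma> \<and> guesses D \<Omega> C i (hset_of \<gamma>)"
proof -
  note points = points_club[OF \<alpha> C]
  let ?E = "{\<gamma> \<in> points C. guesses D \<Omega> C i (hset_of \<gamma>)}"
  have "{\<gamma> \<in> fdom C. guesses D \<Omega> C i \<gamma>} = hset_of ` ?E" unfolding points(1) by blast
  then have "osup (hset_of ` ?E) = hset_of \<alpha>" using sup by simp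
  moreover have "?E \<subseteq> {..<\<alpha>}" using club_belowD(1)[OF points(2)] by blast
  ultimately show ?thesis using osup_eq_iff \<open>\<xi> < \<alpha>\<close> by blast
qed

lemma guessed_successor:
  assumes \<alpha>: "\<alpha> < \<kappa>" "is_limit \<alpha>" and C: "C \<in> \<C> (hset_of \<alpha>)" and i: "i < \<kappa>"
    and D: "club_below \<kappa> D" and \<Omega>: "\<Omega> \<subseteq> {..<\<kappa>}"
    and \<gamma>: "\<gamma> \<in> points C" "guesses D \<Omega> C (hset_of i) (hset_of \<gamma>)"
  shows "\<exists>\<beta>. consecutive_in (points C) \<gamma> \<beta> \<and> idx \<beta> = i \<and> \<beta> \<in> D \<and>
    ordinal_values C \<beta> = \<Omega> \<inter> {..<\<beta>}"
proof -
  note points = points_club[OF \<alpha> C] and club = club_belowD[OF points_club(2)[OF \<alpha> C]]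
  obtain \<beta> where consec: "consecutive_in (points C) \<gamma> \<beta>"
    using ex_consecutive_successor[OF \<gamma>(1)] unbounded_inD[OF club(2)] club(1) \<gamma>(1) by blast
  have "hset_of \<beta> \<in> guess_set (hset_of \<kappa>) (B (hset_of i)) (hset_of ` \<Omega>) (mk (hset_of ` D)) C"
    using \<gamma>(2) unfolding guesses_def points(1) succ_n_one_consecutive[OF club(1) consec] by simp
  then obtain M where \<beta>_mem: "hset_of \<beta> \<in> B (hset_of i)"
      and M: "M \<prec> Hplus (hset_of \<kappa>)" "mk (hset_of ` D) \<in> M"
        "M \<inter> elts (hset_of \<kappa>) = elts (hset_of \<beta>)"
      and app_C: "M \<inter> hset_of ` \<Omega> = elts (app C (hset_of \<beta>))"
    unfolding guess_set_def by blast
  have "\<beta> < \<kappa>" using consecutive_inD(2)[OF consec] club(1) \<alpha>(1) by auto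
  have "unbounded_in \<beta> D"
    using elem_submodel_reflects_unbounded[OF M club_belowD(1,2)[OF D] \<open>\<beta> < \<kappa>\<close>]
      consecutive_inD(3)[OF consec] by blast
  then have "\<beta> \<in> D" using club_belowD(3)[OF D] \<open>\<beta> < \<kappa>\<close> unfolding closed_below_def by blast
  moreover have "ordinal_values C \<beta> = \<Omega> \<inter> {..<\<beta>}"
  proof -
    have "hset_of ` \<Omega> \<subseteq> elts (hset_of \<kappa>)" using \<Omega> by auto
    then have "M \<inter> hset_of ` \<Omega> = hset_of ` \<Omega> \<inter> elts (hset_of \<beta>)" using M(3) by blast
    then show ?thesis unfolding ordinal_values_def app_C[symmetric] by auto
  qed
  ultimately show ?thesis using consec idx_eqI[OF i \<beta>_mem] by blast
qed

lemma ordinal_proxyI: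
  assumes "\<chi> < \<kappa>" and closed: "lt_closed (hset_of \<chi>) (hset_of \<kappa>)"
    and "\<And>\<alpha>. \<alpha> < \<kappa> \<Longrightarrow> w \<alpha> < \<kappa>" "\<And>\<alpha>. \<alpha> < \<kappa> \<Longrightarrow> \<exists>a b. a < b \<and> b < w \<alpha>"
  shows "ordinal_proxy \<kappa> \<chi> w Cs idx"
proof unfold_locales
  show "\<exists>a b. a < b \<and> b < \<chi>" by (rule two_less_of_omega_subset[OF omega_subset])
  show "|{..<\<mu>}| ^c |{..<\<eta>}| <o |{..<\<kappa>}|" if "\<eta> < \<chi>" "\<mu> < \<kappa>" for \<eta> \<mu>
    by (rule lt_closed_cexp[OF closed that])
  fix \<alpha> assume \<alpha>: "\<alpha> < \<kappa>" "is_limit \<alpha>"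
  show "Cs \<alpha> \<noteq> {}" using \<C>_nonempty[OF is_limit_acc[OF \<alpha>]] unfolding Cs_def by blast
  show "|Cs \<alpha>| <o |{..<\<kappa>}|"
    unfolding Cs_def card_less_lessThan_iff
    by (rule ordLeq_ordLess_trans[OF card_of_image card_\<C>_less[OF is_limit_acc[OF \<alpha>]]])
  show "club_below \<alpha> E" if "(E, g) \<in> Cs \<alpha>" for E g
    using that points_club(2)[OF \<alpha>] unfolding Cs_def by blast
next
  fix D \<Omega> assume D: "club_below \<kappa> D" and \<Omega>: "\<Omega> \<subseteq> {..<\<kappa>}"
  obtain \<alpha> where \<alpha>: "\<alpha> < \<kappa>" "\<not> cof_less \<chi> \<alpha>"
    and sup: "\<And>C i. \<lbrakk>C \<in> \<C> (hset_of \<alpha>); i < \<alpha>\<rbrakk> \<Longrightarrow>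
      osup {\<gamma> \<in> fdom C. guesses D \<Omega> C (hset_of i) \<gamma>} = hset_of \<alpha>"
    using ex_guessing_level[OF club_belowD(1)[OF D] \<Omega>] by blast
  have "is_limit \<alpha>"
    using not_cof_less_imp_is_limit[OF \<alpha>(2)] two_less_of_omega_subset[OF omega_subset] by blast
  have "\<exists>\<gamma> \<beta>. consecutive_in (points C) \<gamma> \<beta> \<and> \<xi> < \<gamma> \<and> idx \<beta> = i \<and> \<beta> \<in> D \<and>
      ordinal_values C \<beta> = \<Omega> \<inter> {..<\<beta>}" if C: "C \<in> \<C> (hset_of \<alpha>)" and "i < \<alpha>" "\<xi> < \<alpha>" for C i \<xi>
  proof -
    obtain \<gamma> where "\<gamma> \<in> points C" "\<xi> < \<gamma>" "guesses D \<Omega> C (hset_of i) (hset_of \<gamma>)"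
      using ex_guessing_point[OF \<alpha>(1) \<open>is_limit \<alpha>\<close> C sup[OF C \<open>i < \<alpha>\<close>] \<open>\<xi> < \<alpha>\<close>] by blast
    moreover have "i < \<kappa>" using \<open>i < \<alpha>\<close> \<alpha>(1) by simp
    ultimately show ?thesis
      using guessed_successor[OF \<alpha>(1) \<open>is_limit \<alpha>\<close> C _ D \<Omega>] by blast
  qed
  with \<alpha> show "\<exists>\<alpha><\<kappa>. \<not> cof_less \<chi> \<alpha> \<and> (\<forall>(E, g)\<in>Cs \<alpha>. \<forall>i<\<alpha>. \<forall>\<xi><\<alpha>.
      \<exists>\<gamma> \<beta>. consecutive_in E \<gamma> \<beta> \<and> \<xi> < \<gamma> \<and> idx \<beta> = i \<and> \<beta> \<in> D \<and> g \<beta> = \<Omega> \<inter> {..<\<beta>})"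
    unfolding Cs_def by blast
qed (use assms Cs_coherent in auto)

end

lemma P_bullet_imp_proxy_sequence:
  assumes "regular_cardinal (hset_of k)" "omega \<in> elts (hset_of k)" "regular_cardinal (hset_of x)"
    and P: "P_bullet (hset_of k) (hset_of k) (sq_chi (hset_of x)) (hset_of k)
      {cof_ge (hset_of k) (hset_of x)} (hset_of k)"
  obtains \<C> B where "proxy_sequence k x \<C> B"
proof -
  let ?K = "hset_of k" and ?S = "cof_ge (hset_of k) (hset_of x)"
  obtain \<C> B where B: "disjoint_family_on B (elts ?K)"
    and \<C>: "\<forall>\<alpha>\<in>acc_pts (elts ?K).
           \<C> \<alpha> \<subseteq> {C \<in> club_funs ?K. alpha_of C = \<alpha>} \<and> \<C> \<alpha> \<noteq> {} \<and> |\<C> \<alpha>| <o |elts ?K| \<and>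
           (\<forall>C\<in>\<C> \<alpha>. \<forall>\<alpha>'\<in>acc_pts (fdom C). \<exists>D\<in>\<C> \<alpha>'. sq_chi (hset_of x) D C)"
    and guess: "\<forall>\<Omega> p \<iota>. (\<forall>i\<in>elts ?K. \<Omega> i \<subseteq> H ?K \<and> p i \<in> Hplus ?K \<and> \<iota> i \<in> elts ?K) \<longrightarrow>
           (\<forall>S\<in>{?S}. \<forall>n. stationary_in ?K {\<alpha> \<in> S. |\<C> \<alpha>| <o |elts ?K| \<and>
                (\<forall>C\<in>\<C> \<alpha>. \<forall>i\<in>elts (omin \<alpha> ?K).
                   osup {\<gamma> \<in> fdom C.
                     succ_n n (fdom C - elts \<gamma>) \<subseteq> guess_set ?K (B (\<iota> i)) (\<Omega> i) (p i) C} = \<alpha>)})"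
    using P unfolding P_bullet_def by (elim exE conjE) (rule that)
  let ?sup = "\<lambda>\<Omega> p C i. osup {\<gamma> \<in> fdom C.
      succ_n 1 (fdom C - elts \<gamma>) \<subseteq> guess_set ?K (B i) \<Omega> p C}"
  have "stationary_in ?K {\<alpha> \<in> ?S. \<forall>C\<in>\<C> \<alpha>. \<forall>i\<in>elts \<alpha>. ?sup \<Omega> p C i = \<alpha>}"
    if "\<Omega> \<subseteq> H ?K" "p \<in> Hplus ?K" for \<Omega> p
  proof (rule stationary_in_mono)
    show "stationary_in ?K {\<alpha> \<in> ?S. |\<C> \<alpha>| <o |elts ?K| \<and>
        (\<forall>C\<in>\<C> \<alpha>. \<forall>i\<in>elts (omin \<alpha> ?K). ?sup \<Omega> p C i = \<alpha>)}"
      using spec[OF spec[OF spec[OF guess, of "\<lambda>_. \<Omega>"], of "\<lambda>_. p"], of "\<lambda>i. i"] that by blast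
    have "omin \<alpha> ?K = \<alpha>" if "\<alpha> \<in> ?S" for \<alpha>
      using that Ord_hset_of[of k] unfolding cof_ge_def omin_def Ord_def by auto
    then show "{\<alpha> \<in> ?S. |\<C> \<alpha>| <o |elts ?K| \<and>
        (\<forall>C\<in>\<C> \<alpha>. \<forall>i\<in>elts (omin \<alpha> ?K). ?sup \<Omega> p C i = \<alpha>)} \<subseteq>
      {\<alpha> \<in> ?S. \<forall>C\<in>\<C> \<alpha>. \<forall>i\<in>elts \<alpha>. ?sup \<Omega> p C i = \<alpha>}"
      by auto
  qed (auto simp: cof_ge_def)
  then have "proxy_sequence k x \<C> B"
    using assms(1-3) B \<C> unfolding regular_cardinal_def[of "hset_of x"] by unfold_locales blast+
  then show thesis by (rule that)
qed

theorem theorem6p32: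
  fixes \<kappa> \<chi> \<sigma> :: "'a hset"
  assumes "regular_cardinal \<kappa>" and "omega \<in> elts \<kappa>"
    and "regular_cardinal \<chi>" and "\<chi> \<in> elts \<kappa>"
    and "lt_closed \<chi> \<kappa>"
    and "\<sigma> \<in> elts \<kappa>"
    and "P_bullet \<kappa> \<kappa> (sq_chi \<chi>) \<kappa> {cof_ge \<kappa> \<chi>} \<kappa>"
  shows "\<exists>T. souslin_tree \<kappa> T \<and> normal_tree \<kappa> T \<and> prolific_tree \<kappa> T \<and> splitting_tree \<sigma> T \<and>
    complete_tree \<chi> T \<and> uniformly_homogeneous T"
proof -
  have "Ord \<kappa>" using assms(1) unfolding regular_cardinal_def Cardinal_def by blast
  then obtain k where k: "\<kappa> = hset_of k" by (rule OrdE)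
  obtain x where x: "x < k" "\<chi> = hset_of x" using assms(4) unfolding k by (rule mem_hset_ofE)
  obtain s where s: "s < k" "\<sigma> = hset_of s" using assms(6) unfolding k by (rule mem_hset_ofE)
  obtain q where q: "q < k" "omega = hset_of q" using assms(2) unfolding k by (rule mem_hset_ofE)
  define w where "w \<alpha> = max q (max \<alpha> s)" for \<alpha>
  have omega_le_w: "elts omega \<subseteq> elts (hset_of (w \<alpha>))" for \<alpha>
    by (simp add: w_def q(2) le_max_iff_disj)
  obtain \<C> B where "proxy_sequence k x \<C> B"
    using P_bullet_imp_proxy_sequence assms(1,2,3,7) unfolding k x(2) by blast
  then interpret proxy_sequence k x \<C> B .
  interpret ordinal_proxy k x w Cs idx
  proof (rule ordinal_proxyI[OF x(1)])
    show "w \<alpha> < k" if "\<alpha> < k" for \<alpha> using that q(1) s(1) by (simp add: w_def)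
  qed (use assms(5) k x(2) two_less_of_omega_subset[OF omega_le_w] in simp_all)
  show ?thesis
    unfolding k x(2)
    by (intro exI[of _ coded_tree] conjI souslin_coded_tree normal_coded_tree prolific_coded_tree
        splitting_coded_tree complete_coded_tree homogeneous_coded_tree)
      (simp_all add: omax_def w_def q(2) s(2) le_max_iff_disj)
qed

end
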